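(* Let $d\ge 0$ and let $(\mathcal T,\mathcal T^{\mathrm p},\mathcal S)$ be a $(-d)$-CY triple over a field $k$. Let $\mathcal H=\mathrm{Filt}(\mathcal S)$, let $\mathcal F=\mathcal T_{>0}^{\perp}\cap{}^{\perp}(\mathcal T_{\le -1}\cap\mathcal T^{\mathrm p})$, and let $\mathcal T_{\mathrm{sg}}=\mathcal T/\mathcal T^{\mathrm p}$ be the Verdier quotient. Then $$\mathcal F=\mathcal H[d]*\mathcal H[d-1]*\cdots*\mathcal H,$$ and $\mathcal S$ (regarded in $\mathcal T_{\mathrm{sg}}$ via the quotient functor $\mathcal T\to\mathcal T_{\mathrm{sg}}$) is a $d$-simple-minded system in $\mathcal T_{\mathrm{sg}}$.
   Context: $k$ is a field; subcategories are full. For a collection $\mathcal S$ of objects in a triangulated category $\mathcal T$ and $n\in\mathbb Z$, $\mathcal S[\ge n]=\{S[i]\mid S\in\mathcal S,i\ge n\}$, and similarly for $>,\le,<$. $\mathcal S^{\perp}=\{X\mid\mathrm{Hom}_{\mathcal T}(\mathcal S,X)=0\}$, ${}^{\perp}\mathcal S=\{X\mid\mathrm{Hom}_{\mathcal T}(X,\mathcal S)=0\}$. $\mathrm{Filt}(\mathcal S)$ is the smallest extension-closed full subcategory containing $\mathcal S$. $\mathcal S$ is a simple-minded collection (SMC) if for all $X,Y\in\mathcal S$: $\mathrm{Hom}_{\mathcal T}(X,Y[i])=0$ for $i<0$, $\dim_k\mathrm{Hom}_{\mathcal T}(X,Y)=\delta_{X,Y}$, and the smallest thick subcategory containing $\mathcal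 S$ is $\mathcal T$. $\mathcal X*\mathcal Y$ consists of all $T$ admitting a triangle $X\to T\to Y\to X[1]$ with $X\in\mathcal X,Y\in\mathcal Y$; one writes $\mathcal X\perp\mathcal Y$ for $\mathcal X*\mathcal Y$ when $\mathrm{Hom}_{\mathcal T}(\mathcal X,\mathcal Y)=0$. $\mathcal T=\mathcal X\perp\mathcal Y$ is a torsion pair if also $\mathcal X^\perp=\mathcal Y$, ${}^\perp\mathcal Y=\mathcal X$, and a co-$t$-structure if moreover $\mathcal Y[1]\subset\mathcal Y$. A $(-d)$-CY triple $(\mathcal T,\mathcal T^{\mathrm p},\mathcal S)$, $d\ge0$, consists of the following. (RS0) $\mathcal T$ is a $k$-linear Hom-finite Krull–Schmidt triangulated category and $\mathcal T^{\mathrm p}$ is a thick subcategory. (RS1) There is a bifunctorial isomorphism $D\mathrm{Hom}_{\mathcal T}(X,Y)\simeq\mathrm{Hom}_{\mathcal T}(Y,X[-d])$ for $X\in\mathcal T^{\mathrm p}$, $Y\in\mathcal T$, where $D=\mathrm{Hom}_k(-,k)$. (RS2) $\mathcal S$ is an SMC in $\mathcal T$, and $\mathcal T={}^{\perp}\mathcal S[\ge 0]\perp{}^{\perp}\mathcal S[<0]=\mathcal S[\ge 0]^{\perp}\perp\mathcal S[<0]^{\perp}$ are co-$t$-structures with ${}^{\perp}\mathcal S[\ge 0]\subset\mathcal T^{\mathrm p}$ and $\mathcal S[<0]^{\perp}\subset\mathcal T^{\mathrm p}$. Notation: $\mathcal T_{>0}={}^{\perp}\mathcal S[\ge 0]$,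 $\mathcal T_{\le -1}={}^{\perp}\mathcal S[<1]$. A collection $\mathcal S'$ of objects in a triangulated category $\mathcal C$ is a $d$-simple-minded system ($d$-SMS) if for all $X,Y\in\mathcal S'$: (1) $\dim_k\mathrm{Hom}_{\mathcal C}(X,Y)=\delta_{X,Y}$; (2) if $d\ge1$, $\mathrm{Hom}_{\mathcal C}(X[i],Y)=0$ for $1\le i\le d$; (3) $\mathcal C=\mathrm{add}\,\mathrm{Filt}(\mathcal S'[d]\cup\mathcal S'[d-1]\cup\cdots\cup\mathcal S')$, where $\mathrm{add}$ denotes closure under isomorphism, finite direct sums and direct summands.
   Formalization: For d = 0 the claim that S is a 0-SMS needs that no member of S lies in T^p (it fails for T = T^p = D^b(mod k), S = {k}); this is assumed there, and in general the members of S nonzero in T_sg are shown to form a d-SMS. *)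

theory Defs
  imports "Jordan_Normal_Form.Missing_VectorSpace"
begin

section \<open>Linear categories with a shift and candidate triangles\<close>

text \<open>
  Objects form a set, and every hom-space is a module record, so that the library's
  \<^const>\<open>vectorspace\<close> applies to it; the multiplicative fields \<open>mult\<close>, \<open>one\<close> of these records are
  junk. Hom-spaces need not be disjoint: the source and target of a morphism are always carried
  along explicitly. A sextuple \<open>(X, Y, Z, f, g, h)\<close> in \<open>Tri\<close> stands for
  \<open>X \<rightarrow> Y \<rightarrow> Z \<rightarrow> X[1]\<close>.
\<close>

type_synonym ('o, 'm) sextuple = "'o \<times> 'o \<times> 'o \<times> 'm \<times> 'm \<times> 'm"

record ('k, 'o, 'm) tricat =
  Ob :: "'o set"
  Hom :: "'o \<Rightarrow> 'o \<Rightarrow> ('k, 'm) module"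
  Idm :: "'o \<Rightarrow> 'm"
  Cmp :: "'m \<Rightarrow> 'm \<Rightarrow> 'm"  (infixr \<open>\<cdot>\<index>\<close> 75)
  Sh :: "'o \<Rightarrow> 'o"
  Shm :: "'m \<Rightarrow> 'm"
  Tri :: "('o, 'm) sextuple set"

definition has_dim ::
    "('k, 'r) ring_scheme \<Rightarrow> ('k, 'm, 's) module_scheme \<Rightarrow> nat \<Rightarrow> bool" where
  "has_dim K V n \<longleftrightarrow> vectorspace K V \<and> vectorspace.fin_dim K V \<and> vectorspace.dim K V = n"

definition hom_zero :: "('k, 'o, 'm) tricat \<Rightarrow> 'o \<Rightarrow> 'o \<Rightarrow> bool" where
  "hom_zero C X Y \<longleftrightarrow> carrier (Hom C X Y) = {\<zero>\<^bsub>Hom C X Y\<^esub>}"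

definition is_iso :: "('k, 'o, 'm) tricat \<Rightarrow> 'o \<Rightarrow> 'o \<Rightarrow> 'm \<Rightarrow> bool" where
  "is_iso C X Y f \<longleftrightarrow> f \<in> carrier (Hom C X Y) \<and>
     (\<exists>g \<in> carrier (Hom C Y X). g \<cdot>\<^bsub>C\<^esub> f = Idm C X \<and> f \<cdot>\<^bsub>C\<^esub> g = Idm C Y)"

definition is_zero :: "('k, 'o, 'm) tricat \<Rightarrow> 'o \<Rightarrow> bool" where
  "is_zero C Z \<longleftrightarrow> Z \<in> Ob C \<and> Idm C Z = \<zero>\<^bsub>Hom C Z Z\<^esub>"

text \<open>\<open>Z\<close> is a direct sum of \<open>A 0, \<dots>, A (n - 1)\<close>; for \<open>n = 0\<close> this says that \<open>Z\<close> is zero.\<close>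

definition is_dsum :: "('k, 'o, 'm) tricat \<Rightarrow> nat \<Rightarrow> (nat \<Rightarrow> 'o) \<Rightarrow> 'o \<Rightarrow> bool" where
  "is_dsum C n A Z \<longleftrightarrow> Z \<in> Ob C \<and> (\<forall>i<n. A i \<in> Ob C) \<and>
     (\<exists>\<iota> \<pi>.
        (\<forall>i<n. \<iota> i \<in> carrier (Hom C (A i) Z) \<and> \<pi> i \<in> carrier (Hom C Z (A i))) \<and>
        (\<forall>i<n. \<forall>j<n. \<pi> j \<cdot>\<^bsub>C\<^esub> \<iota> i =
            (if i = j then Idm C (A i) else \<zero>\<^bsub>Hom C (A i) (A j)\<^esub>)) \<and>
        (\<Oplus>\<^bsub>Hom C Z Z\<^esub>i\<in>{..<n}. \<iota> i \<cdot>\<^bsub>C\<^esub> \<pi> i) = Idm C Z)"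

definition candidates :: "('k, 'o, 'm) tricat \<Rightarrow> ('o, 'm) sextuple set" where
  "candidates C = {(X, Y, Z, f, g, h). X \<in> Ob C \<and> Y \<in> Ob C \<and> Z \<in> Ob C \<and>
     f \<in> carrier (Hom C X Y) \<and> g \<in> carrier (Hom C Y Z) \<and> h \<in> carrier (Hom C Z (Sh C X))}"

definition cand_iso ::
    "('k, 'o, 'm) tricat \<Rightarrow> ('o, 'm) sextuple \<Rightarrow> ('o, 'm) sextuple \<Rightarrow> bool" where
  "cand_iso C = (\<lambda>(X, Y, Z, f, g, h) (X', Y', Z', f', g', h').
     \<exists>a b c. is_iso C X X' a \<and> is_iso C Y Y' b \<and> is_iso C Z Z' c \<and>
       b \<cdot>\<^bsub>C\<^esub> f = f' \<cdot>\<^bsub>C\<^esub> a \<and> c \<cdot>\<^bsub>C\<^esub> g = g' \<cdot>\<^bsub>C\<^esub> b \<and> Shm C a \<cdot>\<^bsub>C\<^esub> h = h' \<cdot>\<^bsub>C\<^esub> c)"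

text \<open>\<open>X[i]\<close> and \<open>f[i]\<close> for an integer \<open>i\<close>. As \<open>[1]\<close> is an automorphism (see below), negative shifts
  are literal inverses; on morphisms the inverse is taken on one hom-space at a time.\<close>

definition shift :: "('k, 'o, 'm) tricat \<Rightarrow> int \<Rightarrow> 'o \<Rightarrow> 'o" where
  "shift C i X = (if 0 \<le> i then (Sh C ^^ nat i) X
                  else (the_inv_into (Ob C) (Sh C) ^^ nat (- i)) X)"

definition shift_mor :: "('k, 'o, 'm) tricat \<Rightarrow> int \<Rightarrow> 'o \<Rightarrow> 'o \<Rightarrow> 'm \<Rightarrow> 'm" where
  "shift_mor C i X Y f = (if 0 \<le> i then (Shm C ^^ nat i) f
     else the_inv_into (carrier (Hom C (shift C i X) (shift C i Y))) (Shm C ^^ nat (- i)) f)"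


section \<open>Triangulated categories\<close>

locale linear_category = field K
  for K :: "('k, 'r) ring_scheme" (structure) +
  fixes C :: "('k, 'o, 'm) tricat"
  assumes hom_vectorspace: "\<lbrakk>X \<in> Ob C; Y \<in> Ob C\<rbrakk> \<Longrightarrow> vectorspace K (Hom C X Y)"
    and idm_closed: "X \<in> Ob C \<Longrightarrow> Idm C X \<in> carrier (Hom C X X)"
    and cmp_closed:
      "\<lbrakk>X \<in> Ob C; Y \<in> Ob C; Z \<in> Ob C; f \<in> carrier (Hom C X Y); g \<in> carrier (Hom C Y Z)\<rbrakk>
       \<Longrightarrow> g \<cdot>\<^bsub>C\<^esub> f \<in> carrier (Hom C X Z)"
    and cmp_idm_right:
      "\<lbrakk>X \<in> Ob C; Y \<in> Ob C; f \<in> carrier (Hom C X Y)\<rbrakk> \<Longrightarrow> f \<cdot>\<^bsub>C\<^esub> Idm C X = f"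
    and cmp_idm_left:
      "\<lbrakk>X \<in> Ob C; Y \<in> Ob C; f \<in> carrier (Hom C X Y)\<rbrakk> \<Longrightarrow> Idm C Y \<cdot>\<^bsub>C\<^esub> f = f"
    and cmp_assoc:
      "\<lbrakk>W \<in> Ob C; X \<in> Ob C; Y \<in> Ob C; Z \<in> Ob C;
        f \<in> carrier (Hom C W X); g \<in> carrier (Hom C X Y); h \<in> carrier (Hom C Y Z)\<rbrakk>
       \<Longrightarrow> (h \<cdot>\<^bsub>C\<^esub> g) \<cdot>\<^bsub>C\<^esub> f = h \<cdot>\<^bsub>C\<^esub> (g \<cdot>\<^bsub>C\<^esub> f)"
    and precomp_linear:
      "\<lbrakk>X \<in> Ob C; Y \<in> Ob C; Z \<in> Ob C; f \<in> carrier (Hom C X Y)\<rbrakk>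
       \<Longrightarrow> (\<lambda>g. g \<cdot>\<^bsub>C\<^esub> f) \<in> module_hom K (Hom C Y Z) (Hom C X Z)"
    and postcomp_linear:
      "\<lbrakk>X \<in> Ob C; Y \<in> Ob C; Z \<in> Ob C; g \<in> carrier (Hom C Y Z)\<rbrakk>
       \<Longrightarrow> (\<lambda>f. g \<cdot>\<^bsub>C\<^esub> f) \<in> module_hom K (Hom C X Y) (Hom C X Z)"

locale linear_additive_category = linear_category +
  assumes dsum_exists: "(\<forall>i<n. A i \<in> Ob C) \<Longrightarrow> \<exists>Z. is_dsum C n A Z"

text \<open>As in Verdier's definition, the shift is an automorphism of the category.\<close>

locale triangulated_category = linear_additive_category +
  assumes sh_bij: "bij_betw (Sh C) (Ob C) (Ob C)"
    and shm_bij: "\<lbrakk>X \<in> Ob C; Y \<in> Ob C\<rbrakk> \<Longrightarrow>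
      bij_betw (Shm C) (carrier (Hom C X Y)) (carrier (Hom C (Sh C X) (Sh C Y)))"
    and shm_linear: "\<lbrakk>X \<in> Ob C; Y \<in> Ob C\<rbrakk> \<Longrightarrow>
      Shm C \<in> module_hom K (Hom C X Y) (Hom C (Sh C X) (Sh C Y))"
    and shm_idm: "X \<in> Ob C \<Longrightarrow> Shm C (Idm C X) = Idm C (Sh C X)"
    and shm_cmp:
      "\<lbrakk>X \<in> Ob C; Y \<in> Ob C; Z \<in> Ob C; f \<in> carrier (Hom C X Y); g \<in> carrier (Hom C Y Z)\<rbrakk>
       \<Longrightarrow> Shm C (g \<cdot>\<^bsub>C\<^esub> f) = Shm C g \<cdot>\<^bsub>C\<^esub> Shm C f"
    and tri_candidates: "Tri C \<subseteq> candidates C"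
    and TR1_iso: "\<lbrakk>t \<in> Tri C; t' \<in> candidates C; cand_iso C t t'\<rbrakk> \<Longrightarrow> t' \<in> Tri C"
    and TR1_idm: "\<lbrakk>X \<in> Ob C; is_zero C Z\<rbrakk> \<Longrightarrow>
      (X, X, Z, Idm C X, \<zero>\<^bsub>Hom C X Z\<^esub>, \<zero>\<^bsub>Hom C Z (Sh C X)\<^esub>) \<in> Tri C"
    and TR1_cone: "\<lbrakk>X \<in> Ob C; Y \<in> Ob C; f \<in> carrier (Hom C X Y)\<rbrakk> \<Longrightarrow>
      \<exists>Z g h. (X, Y, Z, f, g, h) \<in> Tri C"
    and TR2: "(X, Y, Z, f, g, h) \<in> candidates C \<Longrightarrow>
      (X, Y, Z, f, g, h) \<in> Tri C \<longleftrightarrow>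
      (Y, Z, Sh C X, g, h, \<ominus>\<^bsub>Hom C (Sh C X) (Sh C Y)\<^esub> (Shm C f)) \<in> Tri C"
    and TR3: "\<lbrakk>(X, Y, Z, f, g, h) \<in> Tri C; (X', Y', Z', f', g', h') \<in> Tri C;
      a \<in> carrier (Hom C X X'); b \<in> carrier (Hom C Y Y'); b \<cdot>\<^bsub>C\<^esub> f = f' \<cdot>\<^bsub>C\<^esub> a\<rbrakk> \<Longrightarrow>
      \<exists>c \<in> carrier (Hom C Z Z'). c \<cdot>\<^bsub>C\<^esub> g = g' \<cdot>\<^bsub>C\<^esub> b \<and> Shm C a \<cdot>\<^bsub>C\<^esub> h = h' \<cdot>\<^bsub>C\<^esub> c"
    and TR4: "\<lbrakk>(X, Y, Z', f, i, i') \<in> Tri C; (Y, Z, X', g, j, j') \<in> Tri C;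
      (X, Z, Y', g \<cdot>\<^bsub>C\<^esub> f, k, k') \<in> Tri C\<rbrakk> \<Longrightarrow>
      \<exists>u v. (Z', Y', X', u, v, Shm C i \<cdot>\<^bsub>C\<^esub> j') \<in> Tri C \<and>
        u \<cdot>\<^bsub>C\<^esub> i = k \<cdot>\<^bsub>C\<^esub> g \<and> k' \<cdot>\<^bsub>C\<^esub> u = i' \<and> v \<cdot>\<^bsub>C\<^esub> k = j \<and> j' \<cdot>\<^bsub>C\<^esub> v = Shm C f \<cdot>\<^bsub>C\<^esub> k'"


section \<open>Full subcategories, given by their sets of objects\<close>

text \<open>\<open>shifts C P I\<close> is the collection of all \<open>X[i]\<close> with \<open>X \<in> P\<close> and \<open>i \<in> I\<close>: \<open>P[\<ge>n]\<close> is
  \<open>shifts C P {n..}\<close>, \<open>P[<n]\<close> is \<open>shifts C P {..<n}\<close>, and \<open>P[n]\<close> is \<open>shifts C P {n}\<close>.\<close>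

definition shifts :: "('k, 'o, 'm) tricat \<Rightarrow> 'o set \<Rightarrow> int set \<Rightarrow> 'o set" where
  "shifts C P I = {shift C i X | i X. i \<in> I \<and> X \<in> P}"

definition right_perp :: "('k, 'o, 'm) tricat \<Rightarrow> 'o set \<Rightarrow> 'o set" where
  "right_perp C P = {X \<in> Ob C. \<forall>A\<in>P. hom_zero C A X}"

definition left_perp :: "('k, 'o, 'm) tricat \<Rightarrow> 'o set \<Rightarrow> 'o set" where
  "left_perp C P = {X \<in> Ob C. \<forall>A\<in>P. hom_zero C X A}"

definition star :: "('k, 'o, 'm) tricat \<Rightarrow> 'o set \<Rightarrow> 'o set \<Rightarrow> 'o set" where
  "star C P Q = {E. \<exists>X Y f g h. (X, E, Y, f, g, h) \<in> Tri C \<and> X \<in> P \<and> Y \<in> Q}"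

text \<open>\<open>star_chain C H n = H[n] * (H[n - 1] * (\<dots> * H))\<close>\<close>

primrec star_chain :: "('k, 'o, 'm) tricat \<Rightarrow> 'o set \<Rightarrow> nat \<Rightarrow> 'o set" where
  "star_chain C H 0 = H"
| "star_chain C H (Suc n) = star C (shifts C H {int (Suc n)}) (star_chain C H n)"

text \<open>Subcategories contain the zero objects and are closed under isomorphism. In particular \<open>Filt\<close>
  contains zero, the object filtered in zero steps; otherwise \<open>H[d] * \<dots> * H\<close> would miss \<open>H\<close>.\<close>

definition iso_closed :: "('k, 'o, 'm) tricat \<Rightarrow> 'o set \<Rightarrow> bool" where
  "iso_closed C P \<longleftrightarrow> (\<forall>X\<in>P. \<forall>Y\<in>Ob C. \<forall>f. is_iso C X Y f \<longrightarrow> Y \<in> P)"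

definition extension_closed :: "('k, 'o, 'm) tricat \<Rightarrow> 'o set \<Rightarrow> bool" where
  "extension_closed C P \<longleftrightarrow> P \<subseteq> Ob C \<and> {Z. is_zero C Z} \<subseteq> P \<and> iso_closed C P \<and> star C P P \<subseteq> P"

definition Filt :: "('k, 'o, 'm) tricat \<Rightarrow> 'o set \<Rightarrow> 'o set" where
  "Filt C P = \<Inter>{Q. extension_closed C Q \<and> P \<subseteq> Q}"

definition dsum_closed :: "('k, 'o, 'm) tricat \<Rightarrow> 'o set \<Rightarrow> bool" where
  "dsum_closed C P \<longleftrightarrow> (\<forall>n A Z. is_dsum C n A Z \<longrightarrow> (\<forall>i<n. A i \<in> P) \<longrightarrow> Z \<in> P)"

definition summand_closed :: "('k, 'o, 'm) tricat \<Rightarrow> 'o set \<Rightarrow> bool" where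
  "summand_closed C P \<longleftrightarrow> (\<forall>n A Z. is_dsum C n A Z \<longrightarrow> Z \<in> P \<longrightarrow> (\<forall>i<n. A i \<in> P))"

definition add_closure :: "('k, 'o, 'm) tricat \<Rightarrow> 'o set \<Rightarrow> 'o set" where
  "add_closure C P =
     \<Inter>{Q. Q \<subseteq> Ob C \<and> iso_closed C Q \<and> dsum_closed C Q \<and> summand_closed C Q \<and> P \<subseteq> Q}"

definition thick :: "('k, 'o, 'm) tricat \<Rightarrow> 'o set \<Rightarrow> bool" where
  "thick C P \<longleftrightarrow> P \<subseteq> Ob C \<and> {Z. is_zero C Z} \<subseteq> P \<and> iso_closed C P \<and>
     (\<forall>X\<in>Ob C. Sh C X \<in> P \<longleftrightarrow> X \<in> P) \<and>
     (\<forall>X Y Z f g h. (X, Y, Z, f, g, h) \<in> Tri C \<longrightarrow> X \<in> P \<longrightarrow> Y \<in> P \<longrightarrow> Z \<in> P) \<and>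
     summand_closed C P"

definition thick_closure :: "('k, 'o, 'm) tricat \<Rightarrow> 'o set \<Rightarrow> 'o set" where
  "thick_closure C P = \<Inter>{Q. thick C Q \<and> P \<subseteq> Q}"

definition torsion_pair :: "('k, 'o, 'm) tricat \<Rightarrow> 'o set \<Rightarrow> 'o set \<Rightarrow> bool" where
  "torsion_pair C P Q \<longleftrightarrow> P \<subseteq> Ob C \<and> Q \<subseteq> Ob C \<and> (\<forall>X\<in>P. \<forall>Y\<in>Q. hom_zero C X Y) \<and>
     star C P Q = Ob C \<and> right_perp C P = Q \<and> left_perp C Q = P"

definition co_t_structure :: "('k, 'o, 'm) tricat \<Rightarrow> 'o set \<Rightarrow> 'o set \<Rightarrow> bool" where
  "co_t_structure C P Q \<longleftrightarrow> torsion_pair C P Q \<and> shifts C Q {1} \<subseteq> Q"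


section \<open>Simple-minded collections and simple-minded systems\<close>

definition simple_minded_collection ::
    "('k, 'r) ring_scheme \<Rightarrow> ('k, 'o, 'm) tricat \<Rightarrow> 'o set \<Rightarrow> bool" where
  "simple_minded_collection K C S \<longleftrightarrow> S \<subseteq> Ob C \<and>
     (\<forall>X\<in>S. \<forall>Y\<in>S. \<forall>i<0. hom_zero C X (shift C i Y)) \<and>
     (\<forall>X\<in>S. \<forall>Y\<in>S. has_dim K (Hom C X Y) (if X = Y then 1 else 0)) \<and>
     thick_closure C S = Ob C"

definition simple_minded_system ::
    "('k, 'r) ring_scheme \<Rightarrow> ('k, 'o, 'm) tricat \<Rightarrow> nat \<Rightarrow> 'o set \<Rightarrow> bool" where
  "simple_minded_system K C d S \<longleftrightarrow> S \<subseteq> Ob C \<and>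
     (\<forall>X\<in>S. \<forall>Y\<in>S. has_dim K (Hom C X Y) (if X = Y then 1 else 0)) \<and>
     (d \<ge> 1 \<longrightarrow> (\<forall>X\<in>S. \<forall>Y\<in>S. \<forall>i\<in>{1..int d}. hom_zero C (shift C i X) Y)) \<and>
     Ob C = add_closure C (Filt C (shifts C S {0..int d}))"


section \<open>The Verdier quotient\<close>

text \<open>
  Morphisms \<open>X \<rightarrow> Y\<close> in the quotient by \<open>P\<close> are classes of roofs \<open>X \<leftarrow>s\<midarrow> Z \<midarrow>f\<rightarrow> Y\<close>, written
  \<open>(X, Z, Y, s, f)\<close>, where the cone of \<open>s\<close> lies in \<open>P\<close>. The operations on classes are given as
  unions of the classes obtained from all choices of representatives; for a triangulated category
  and a thick \<open>P\<close> these classes coincide.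
\<close>

type_synonym ('o, 'm) roof = "'o \<times> 'o \<times> 'o \<times> 'm \<times> 'm"

definition cone_in :: "('k, 'o, 'm) tricat \<Rightarrow> 'o set \<Rightarrow> 'o \<Rightarrow> 'o \<Rightarrow> 'm \<Rightarrow> bool" where
  "cone_in T P X Y s \<longleftrightarrow> (\<exists>Z g h. (X, Y, Z, s, g, h) \<in> Tri T \<and> Z \<in> P)"

definition is_roof :: "('k, 'o, 'm) tricat \<Rightarrow> 'o set \<Rightarrow> ('o, 'm) roof \<Rightarrow> bool" where
  "is_roof T P = (\<lambda>(X, Z, Y, s, f). X \<in> Ob T \<and> Z \<in> Ob T \<and> Y \<in> Ob T \<and>
     s \<in> carrier (Hom T Z X) \<and> cone_in T P Z X s \<and> f \<in> carrier (Hom T Z Y))"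

definition roof_equiv ::
    "('k, 'o, 'm) tricat \<Rightarrow> 'o set \<Rightarrow> ('o, 'm) roof \<Rightarrow> ('o, 'm) roof \<Rightarrow> bool" where
  "roof_equiv T P = (\<lambda>(X, Z, Y, s, f) (X', Z', Y', s', f').
     is_roof T P (X, Z, Y, s, f) \<and> is_roof T P (X', Z', Y', s', f') \<and> X = X' \<and> Y = Y' \<and>
     (\<exists>W\<in>Ob T. \<exists>u \<in> carrier (Hom T W Z). \<exists>v \<in> carrier (Hom T W Z').
        s \<cdot>\<^bsub>T\<^esub> u = s' \<cdot>\<^bsub>T\<^esub> v \<and> f \<cdot>\<^bsub>T\<^esub> u = f' \<cdot>\<^bsub>T\<^esub> v \<and> cone_in T P W X (s \<cdot>\<^bsub>T\<^esub> u)))"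

definition roof_class ::
    "('k, 'o, 'm) tricat \<Rightarrow> 'o set \<Rightarrow> ('o, 'm) roof \<Rightarrow> ('o, 'm) roof set" where
  "roof_class T P r = {r'. roof_equiv T P r r'}"

definition quot_hom ::
    "('k, 'o, 'm) tricat \<Rightarrow> 'o set \<Rightarrow> 'o \<Rightarrow> 'o \<Rightarrow> ('k, ('o, 'm) roof set) module" where
  "quot_hom T P X Y =
     \<lparr>carrier = {roof_class T P (X, Z, Y, s, f) | Z s f. is_roof T P (X, Z, Y, s, f)},
      mult = (\<lambda>_ _. roof_class T P (X, X, Y, Idm T X, \<zero>\<^bsub>Hom T X Y\<^esub>)),
      one = roof_class T P (X, X, Y, Idm T X, \<zero>\<^bsub>Hom T X Y\<^esub>),
      zero = roof_class T P (X, X, Y, Idm T X, \<zero>\<^bsub>Hom T X Y\<^esub>),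
      add = (\<lambda>c c'. \<Union>{roof_class T P (X, Z, Y, s, f \<oplus>\<^bsub>Hom T Z Y\<^esub> f') | Z s f f'.
               (X, Z, Y, s, f) \<in> c \<and> (X, Z, Y, s, f') \<in> c'}),
      smult = (\<lambda>a c. \<Union>{roof_class T P (X, Z, Y, s, a \<odot>\<^bsub>Hom T Z Y\<^esub> f) | Z s f.
               (X, Z, Y, s, f) \<in> c})\<rparr>"

text \<open>For \<open>X \<leftarrow>s\<midarrow> A \<midarrow>f\<rightarrow> Y\<close> followed by \<open>Y \<leftarrow>t\<midarrow> B \<midarrow>g\<rightarrow> Z\<close>, complete \<open>f\<close>, \<open>t\<close> to a commutative
  square \<open>f u = t v\<close> with the cone of \<open>u\<close> in \<open>P\<close>.\<close>

definition quot_cmp ::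
    "('k, 'o, 'm) tricat \<Rightarrow> 'o set \<Rightarrow>
     ('o, 'm) roof set \<Rightarrow> ('o, 'm) roof set \<Rightarrow> ('o, 'm) roof set" where
  "quot_cmp T P c' c =
     \<Union>{roof_class T P (X, W, Z, s \<cdot>\<^bsub>T\<^esub> u, g \<cdot>\<^bsub>T\<^esub> v) | X A Y B Z W s f t g u v.
        (X, A, Y, s, f) \<in> c \<and> (Y, B, Z, t, g) \<in> c' \<and> W \<in> Ob T \<and>
        u \<in> carrier (Hom T W A) \<and> cone_in T P W A u \<and> v \<in> carrier (Hom T W B) \<and>
        f \<cdot>\<^bsub>T\<^esub> u = t \<cdot>\<^bsub>T\<^esub> v}"

definition quot_cat ::
    "('k, 'o, 'm) tricat \<Rightarrow> 'o set \<Rightarrow> ('k, 'o, ('o, 'm) roof set) tricat" where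
  "quot_cat T P =
     \<lparr>Ob = Ob T,
      Hom = quot_hom T P,
      Idm = (\<lambda>X. roof_class T P (X, X, X, Idm T X, Idm T X)),
      Cmp = quot_cmp T P,
      Sh = Sh T,
      Shm = (\<lambda>c. \<Union>{roof_class T P (Sh T X, Sh T Z, Sh T Y, Shm T s, Shm T f) | X Z Y s f.
               (X, Z, Y, s, f) \<in> c}),
      Tri = {}\<rparr>"

text \<open>The quotient functor is the identity on objects; this is its action on \<open>f : X \<rightarrow> Y\<close>.\<close>

definition quot_functor ::
    "('k, 'o, 'm) tricat \<Rightarrow> 'o set \<Rightarrow> 'o \<Rightarrow> 'o \<Rightarrow> 'm \<Rightarrow> ('o, 'm) roof set" where
  "quot_functor T P X Y f = roof_class T P (X, X, Y, Idm T X, f)"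

text \<open>Triangles in the quotient are the candidates isomorphic to images of triangles in \<open>T\<close>.\<close>

definition verdier_quotient ::
    "('k, 'o, 'm) tricat \<Rightarrow> 'o set \<Rightarrow> ('k, 'o, ('o, 'm) roof set) tricat" where
  "verdier_quotient T P = (quot_cat T P)
     \<lparr>Tri := {t \<in> candidates (quot_cat T P). \<exists>X Y Z f g h. (X, Y, Z, f, g, h) \<in> Tri T \<and>
        cand_iso (quot_cat T P)
          (X, Y, Z, quot_functor T P X Y f, quot_functor T P Y Z g, quot_functor T P Z (Sh T X) h)
          t}\<rparr>"


section \<open>Calabi-Yau triples\<close>

definition hom_finite :: "('k, 'r) ring_scheme \<Rightarrow> ('k, 'o, 'm) tricat \<Rightarrow> bool" where
  "hom_finite K C \<longleftrightarrow> (\<forall>X\<in>Ob C. \<forall>Y\<in>Ob C. vectorspace.fin_dim K (Hom C X Y))"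

text \<open>A ring is local if it is nonzero and its non-units are closed under addition.\<close>

definition local_end :: "('k, 'o, 'm) tricat \<Rightarrow> 'o \<Rightarrow> bool" where
  "local_end C X \<longleftrightarrow> Idm C X \<noteq> \<zero>\<^bsub>Hom C X X\<^esub> \<and>
     (\<forall>f \<in> carrier (Hom C X X). \<forall>g \<in> carrier (Hom C X X).
        \<not> is_iso C X X f \<longrightarrow> \<not> is_iso C X X g \<longrightarrow> \<not> is_iso C X X (f \<oplus>\<^bsub>Hom C X X\<^esub> g))"

definition krull_schmidt :: "('k, 'o, 'm) tricat \<Rightarrow> bool" where
  "krull_schmidt C \<longleftrightarrow>
     (\<forall>X\<in>Ob C. \<exists>n A. is_dsum C n A X \<and> (\<forall>i<n. local_end C (A i)))"

definition dual_space ::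
    "('k, 'r) ring_scheme \<Rightarrow> ('k, 'm, 's) module_scheme \<Rightarrow> ('k, 'm \<Rightarrow> 'k) module" where
  "dual_space K V = (ring.func_space K (carrier V))
     \<lparr>carrier := {\<xi> \<in> carrier V \<rightarrow>\<^sub>E carrier K.
        (\<forall>x \<in> carrier V. \<forall>y \<in> carrier V. \<xi> (x \<oplus>\<^bsub>V\<^esub> y) = \<xi> x \<oplus>\<^bsub>K\<^esub> \<xi> y) \<and>
        (\<forall>a \<in> carrier K. \<forall>x \<in> carrier V. \<xi> (a \<odot>\<^bsub>V\<^esub> x) = a \<otimes>\<^bsub>K\<^esub> \<xi> x)}\<rparr>"

text \<open>A bifunctorial isomorphism \<open>D Hom(X, Y) \<simeq> Hom(Y, X[-d])\<close> for \<open>X\<close> in \<open>P\<close> and \<open>Y\<close> in \<open>T\<close>. Both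
  sides are covariant in \<open>X\<close> and contravariant in \<open>Y\<close>.\<close>

definition relative_serre_duality ::
    "('k, 'r) ring_scheme \<Rightarrow> ('k, 'o, 'm) tricat \<Rightarrow> 'o set \<Rightarrow> nat \<Rightarrow> bool" where
  "relative_serre_duality K T P d \<longleftrightarrow> (\<exists>\<Phi>.
     (\<forall>X\<in>P. \<forall>Y\<in>Ob T.
        \<Phi> X Y \<in> module_hom K (dual_space K (Hom T X Y)) (Hom T Y (shift T (- int d) X)) \<and>
        bij_betw (\<Phi> X Y) (carrier (dual_space K (Hom T X Y)))
          (carrier (Hom T Y (shift T (- int d) X)))) \<and>
     (\<forall>X\<in>P. \<forall>X'\<in>P. \<forall>Y\<in>Ob T. \<forall>a \<in> carrier (Hom T X X').
        \<forall>\<xi> \<in> carrier (dual_space K (Hom T X Y)).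
        \<Phi> X' Y (\<lambda>g \<in> carrier (Hom T X' Y). \<xi> (g \<cdot>\<^bsub>T\<^esub> a))
          = shift_mor T (- int d) X X' a \<cdot>\<^bsub>T\<^esub> \<Phi> X Y \<xi>) \<and>
     (\<forall>X\<in>P. \<forall>Y\<in>Ob T. \<forall>Y'\<in>Ob T. \<forall>b \<in> carrier (Hom T Y' Y).
        \<forall>\<xi> \<in> carrier (dual_space K (Hom T X Y)).
        \<Phi> X Y' (\<lambda>g \<in> carrier (Hom T X Y'). \<xi> (b \<cdot>\<^bsub>T\<^esub> g)) = \<Phi> X Y \<xi> \<cdot>\<^bsub>T\<^esub> b))"

locale CY_triple = triangulated_category K T
  for K :: "('k, 'r) ring_scheme" (structure) and T :: "('k, 'o, 'm) tricat" +
  fixes Tp :: "'o set" and S :: "'o set" and d :: nat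
  assumes RS0: "hom_finite K T" "krull_schmidt T" "thick T Tp"
    and RS1: "relative_serre_duality K T Tp d"
    and RS2: "simple_minded_collection K T S"
      "co_t_structure T (left_perp T (shifts T S {0..})) (left_perp T (shifts T S {..<0}))"
      "co_t_structure T (right_perp T (shifts T S {0..})) (right_perp T (shifts T S {..<0}))"
      "left_perp T (shifts T S {0..}) \<subseteq> Tp"
      "right_perp T (shifts T S {..<0}) \<subseteq> Tp"

definition T_pos :: "('k, 'o, 'm) tricat \<Rightarrow> 'o set \<Rightarrow> 'o set" where
  "T_pos T S = left_perp T (shifts T S {0..})"

definition T_le_minus1 :: "('k, 'o, 'm) tricat \<Rightarrow> 'o set \<Rightarrow> 'o set" where
  "T_le_minus1 T S = left_perp T (shifts T S {..<1})"

definition fundamental_domain :: "('k, 'o, 'm) tricat \<Rightarrow> 'o set \<Rightarrow> 'o set \<Rightarrow> 'o set" where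
  "fundamental_domain T Tp S =
     right_perp T (T_pos T S) \<inter> left_perp T (T_le_minus1 T S \<inter> Tp)"

end

theory Submission
  imports Defs
begin

text \<open>
  By relative Serre duality \<open>\<T>\<^sub>\<le>\<^sub>-\<^sub>1 \<inter> \<T>\<^sup>p = (\<S>[<0]\<^sup>\<bottom>)[d+1]\<close>, so the torsion pairs of (RS2) give
  \<open>\<F> = {X. Hom(X, \<S>[<0]) = 0 = Hom(\<S>[>d], X)}\<close>. Every object of \<open>\<T>\<close> is an iterated extension of
  shifts \<open>X\<^sub>i[n\<^sub>i]\<close> with \<open>X\<^sub>i \<in> \<S>\<close>; two neighbouring factors in the wrong order can be swapped or cancel
  each other, so that \<open>n\<^sub>i\<close> may be taken to decrease, and for objects of \<open>\<F>\<close> all \<open>n\<^sub>i\<close> then lie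
  between \<open>0\<close> and \<open>d\<close>. That these objects exhaust \<open>\<T>\<close> needs closure under direct summands, which
  follows from Schur's lemma: a nonzero map from such an extension onto its lowest simple shift can
  be completed to a triangle with a shorter extension. Truncating by both torsion pairs shows that \<open>\<F>\<close>
  is dense in \<open>\<T>\<^sub>s\<^sub>g\<close>, and the orthogonality defining \<open>\<F>\<close> makes \<open>Hom\<^sub>\<T>(X, Y) \<rightarrow> Hom\<^sub>s\<^sub>g(X, Y)\<close>
  surjective for \<open>X, Y \<in> \<F>\<close>. On members of \<open>\<S>\<close> outside \<open>\<T>\<^sup>p\<close> it is also injective, since a nonzero
  morphism between them is invertible and the identity does not become zero in \<open>\<T>\<^sub>s\<^sub>g\<close>.
\<close>

text \<open>The delicate case is d = 0. For d \<ge> 1 a member X of S never lies in Tp, since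
  duality would pair End(X) with Hom(X, X[-d]) = 0. For d = 0 that argument gives no contradiction:
  X may lie in Tp, vanish in the quotient and have a zero endomorphism space there. The system is
  therefore built from the members of S outside Tp, and the assertion for S itself follows when S
  and Tp are disjoint.

  In the shift by d + 1 the summand d comes from duality. The summand 1 arises because
  \<open>T_le_minus1\<close> is cut out by S[<1], whereas the class it is compared with is cut out
  by S[<0].

  Filtrations are carried as words of shifted simple objects, so that their length is available for
  induction. The obstacle in the summand argument is that maps between cones are not unique:
  comparing the cocones of a retract yields an endomorphism that need not be the identity. It is
  only compatible with the two neighbouring maps of a triangle, and a square-zero argument shows
  that this already makes it invertible.\<close>

section \<open>Vector spaces\<close>

context vectorspace
begin

lemma lin_indpt_singleton:
  assumes "v \<in> carrier V" "v \<noteq> \<zero>\<^bsub>V\<^esub>" shows "lin_indpt {v}"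
proof -
  have "lin_indpt {}" by (rule finite_lin_indpt2) auto
  then show ?thesis
    using lin_dep_iff_in_span[of "{}" v] assms span_empty by auto
qed

lemma dim_0_trivial:
  assumes "fin_dim" "dim = 0" "v \<in> carrier V" shows "v = \<zero>\<^bsub>V\<^esub>"
proof (rule ccontr)
  assume "v \<noteq> \<zero>\<^bsub>V\<^esub>"
  then show False using li_le_dim[OF assms(1), of "{v}"] lin_indpt_singleton[OF assms(3)] assms by simp
qed

lemma dim_1_multiple:
  assumes "fin_dim" "dim = 1" "v \<in> carrier V" "v \<noteq> \<zero>\<^bsub>V\<^esub>" "w \<in> carrier V"
  obtains a where "a \<in> carrier K" "w = a \<odot>\<^bsub>V\<^esub> v"
proof -
  have "basis {v}"
    by (rule dim_li_is_basis[OF assms(1)]) (use assms lin_indpt_singleton in auto)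
  then have "w \<in> span {v}" using assms(5) by (simp add: basis_def)
  then obtain c where c: "c \<in> {v} \<rightarrow> carrier K" "w = lincomb c {v}"
    using finite_in_span[of "{v}" w] assms(3) by auto
  then have "w = c v \<odot>\<^bsub>V\<^esub> v"
    using assms(3) unfolding lincomb_def by (simp add: module.sum_simp)
  then show ?thesis using that c by blast
qed

text \<open>A coordinate function of a finite basis serves: some coordinate of \<open>v\<close> is
  nonzero because \<open>v\<close> is.\<close>

lemma exists_functional:
  assumes fd: "fin_dim" and v: "v \<in> carrier V" "v \<noteq> \<zero>\<^bsub>V\<^esub>"
  obtains \<xi> where "\<xi> \<in> carrier (dual_space K V)" "\<xi> v \<noteq> \<zero>\<^bsub>K\<^esub>"
proof -
  obtain B where B: "finite B" "basis B" using finite_basis_exists[OF fd] by blast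
  have BV: "B \<subseteq> carrier V" using B by (simp add: basis_def)
  have ex: "\<exists>!a. a \<in> B \<rightarrow>\<^sub>E carrier K \<and> lincomb a B = x" if "x \<in> carrier V" for x
    using basis_criterion[OF B(1) BV] B(2) that by blast
  \<comment> \<open>Coefficient functions are unique only when normalised to
    \<open>undefined\<close> off \<open>B\<close>; \<open>uniq\<close> restricts an arbitrary one
    accordingly.\<close>
  define c where "c x = (THE a. a \<in> B \<rightarrow>\<^sub>E carrier K \<and> lincomb a B = x)" for x
  have c: "c x \<in> B \<rightarrow>\<^sub>E carrier K" "lincomb (c x) B = x" if "x \<in> carrier V" for x
    using theI'[OF ex[OF that]] by (auto simp: c_def)
  have uniq: "c x = restrict a B" if x: "x \<in> carrier V" and a: "a \<in> B \<rightarrow> carrier K" "lincomb a B = x" for x a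
  proof -
    have "lincomb (restrict a B) B = lincomb a B" using a BV by (intro lincomb_cong) auto
    moreover have "restrict a B \<in> B \<rightarrow>\<^sub>E carrier K" using a by auto
    ultimately have "restrict a B \<in> B \<rightarrow>\<^sub>E carrier K \<and> lincomb (restrict a B) B = x" using a by simp
    then show ?thesis unfolding c_def by (rule the1_equality[OF ex[OF x]])
  qed
  have "\<exists>b\<in>B. c v b \<noteq> \<zero>\<^bsub>K\<^esub>"
  proof (rule ccontr)
    assume "\<not> ?thesis"
    then have "c v \<in> B \<rightarrow> {\<zero>\<^bsub>K\<^esub>}" by auto
    then have "lincomb (c v) B = \<zero>\<^bsub>V\<^esub>" using lincomb_zero BV by blast
    then show False using c[OF v(1)] v by simp
  qed
  then obtain b where b: "b \<in> B" "c v b \<noteq> \<zero>\<^bsub>K\<^esub>" by blast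
  define \<xi> where "\<xi> = (\<lambda>x\<in>carrier V. c x b)"
  have cP: "c x \<in> B \<rightarrow> carrier K" if "x \<in> carrier V" for x using c(1)[OF that] by auto
  have "\<xi> \<in> carrier V \<rightarrow>\<^sub>E carrier K" using cP b by (auto simp: \<xi>_def)
  moreover have "\<xi> (x \<oplus>\<^bsub>V\<^esub> y) = \<xi> x \<oplus>\<^bsub>K\<^esub> \<xi> y" if x: "x \<in> carrier V" and y: "y \<in> carrier V" for x y
  proof -
    have "lincomb (\<lambda>w. c x w \<oplus>\<^bsub>K\<^esub> c y w) B = x \<oplus>\<^bsub>V\<^esub> y"
      using lincomb_sum[OF B(1) BV cP[OF x] cP[OF y]] c(2) x y by simp
    then have "c (x \<oplus>\<^bsub>V\<^esub> y) = restrict (\<lambda>w. c x w \<oplus>\<^bsub>K\<^esub> c y w) B"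
      using cP[OF x] cP[OF y] x y by (intro uniq) auto
    then show ?thesis using b x y by (simp add: \<xi>_def)
  qed
  moreover have "\<xi> (a \<odot>\<^bsub>V\<^esub> x) = a \<otimes>\<^bsub>K\<^esub> \<xi> x" if a: "a \<in> carrier K" and x: "x \<in> carrier V" for a x
  proof -
    have "lincomb (\<lambda>w. a \<otimes>\<^bsub>K\<^esub> c x w) B = a \<odot>\<^bsub>V\<^esub> x"
      using lincomb_smult[OF BV cP[OF x] a] c(2) x by simp
    then have "c (a \<odot>\<^bsub>V\<^esub> x) = restrict (\<lambda>w. a \<otimes>\<^bsub>K\<^esub> c x w) B"
      using cP[OF x] x a by (intro uniq) auto
    then show ?thesis using b x a by (simp add: \<xi>_def)
  qed
  ultimately have "\<xi> \<in> carrier (dual_space K V)" by (simp add: dual_space_def)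
  moreover have "\<xi> v \<noteq> \<zero>\<^bsub>K\<^esub>" using b v by (simp add: \<xi>_def)
  ultimately show ?thesis by (rule that)
qed

lemma zero_functional:
  "(\<lambda>x\<in>carrier V. \<zero>\<^bsub>K\<^esub>) \<in> carrier (dual_space K V)"
  by (simp add: dual_space_def)

text \<open>Triviality of the dual is expressed as having a single element, a property that every
  bijection preserves; \<open>serre_hom_zero\<close> transports it along the bijection of relative
  Serre duality.\<close>

lemma dual_space_trivial_iff:
  assumes fd: "fin_dim"
  shows "(\<exists>\<xi>. carrier (dual_space K V) = {\<xi>}) \<longleftrightarrow> carrier V = {\<zero>\<^bsub>V\<^esub>}"
proof
  assume "\<exists>\<xi>. carrier (dual_space K V) = {\<xi>}"
  then have z: "\<xi> = (\<lambda>x\<in>carrier V. \<zero>\<^bsub>K\<^esub>)" if "\<xi> \<in> carrier (dual_space K V)" for \<xi>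
    using zero_functional that by auto
  have "v = \<zero>\<^bsub>V\<^esub>" if v: "v \<in> carrier V" for v
  proof (rule ccontr)
    assume "v \<noteq> \<zero>\<^bsub>V\<^esub>"
    then obtain \<xi> where "\<xi> \<in> carrier (dual_space K V)" "\<xi> v \<noteq> \<zero>\<^bsub>K\<^esub>" using exists_functional[OF fd v] by blast
    then show False using z v by fastforce
  qed
  then show "carrier V = {\<zero>\<^bsub>V\<^esub>}" by auto
next
  assume V: "carrier V = {\<zero>\<^bsub>V\<^esub>}"
  have "\<xi> = (\<lambda>x\<in>carrier V. \<zero>\<^bsub>K\<^esub>)" if xi: "\<xi> \<in> carrier (dual_space K V)" for \<xi>
  proof (rule extensionalityI)
    show "\<xi> \<in> extensional (carrier V)" using xi by (auto simp: dual_space_def PiE_def)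
    show "(\<lambda>x\<in>carrier V. \<zero>\<^bsub>K\<^esub>) \<in> extensional (carrier V)" by simp
    fix x assume x: "x \<in> carrier V"
    have xk: "\<xi> x \<in> carrier K" using xi x by (auto simp: dual_space_def)
    have "\<xi> (x \<oplus>\<^bsub>V\<^esub> x) = \<xi> x \<oplus>\<^bsub>K\<^esub> \<xi> x" using xi x by (simp add: dual_space_def)
    moreover have "x \<oplus>\<^bsub>V\<^esub> x = x" using x V by auto
    ultimately have "\<xi> x = \<zero>\<^bsub>K\<^esub>" using xk by (metis R.add.r_cancel_one')
    then show "\<xi> x = (\<lambda>x\<in>carrier V. \<zero>\<^bsub>K\<^esub>) x" using x by simp
  qed
  then show "\<exists>\<xi>. carrier (dual_space K V) = {\<xi>}" using zero_functional by blast
qed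

end

text \<open>\<open>W\<close> is not known in advance to be a vector space. This is the situation of
  the Hom-spaces of the quotient, whose operations are unions of classes: the axioms are carried
  along \<open>q\<close> together with the dimension.\<close>

lemma has_dim_transport:
  fixes K (structure) and V W q
  assumes V: "has_dim K V n" and q: "bij_betw q (carrier V) (carrier W)"
    and add: "\<And>x y. x \<in> carrier V \<Longrightarrow> y \<in> carrier V \<Longrightarrow> q x \<oplus>\<^bsub>W\<^esub> q y = q (x \<oplus>\<^bsub>V\<^esub> y)"
    and smult: "\<And>a x. a \<in> carrier K \<Longrightarrow> x \<in> carrier V \<Longrightarrow> a \<odot>\<^bsub>W\<^esub> q x = q (a \<odot>\<^bsub>V\<^esub> x)"
    and zero: "\<zero>\<^bsub>W\<^esub> = q \<zero>\<^bsub>V\<^esub>"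
  shows "has_dim K W n"
proof -
  interpret V: vectorspace K V using V by (simp add: has_dim_def)
  have im: "carrier W = q ` carrier V" and inj: "inj_on q (carrier V)"
    using q by (auto simp: bij_betw_def)
  have W: "vectorspace K W"
  proof (rule vs_criteria)
    show "field K" by unfold_locales
    show "\<forall>v\<in>carrier W. \<exists>w\<in>carrier W. v \<oplus>\<^bsub>W\<^esub> w = \<zero>\<^bsub>W\<^esub>"
    proof
      fix v assume "v \<in> carrier W"
      then obtain x where x: "x \<in> carrier V" "v = q x" using im by auto
      then have "v \<oplus>\<^bsub>W\<^esub> q (\<ominus>\<^bsub>V\<^esub> x) = \<zero>\<^bsub>W\<^esub>" by (simp add: add zero V.r_neg)
      then show "\<exists>w\<in>carrier W. v \<oplus>\<^bsub>W\<^esub> w = \<zero>\<^bsub>W\<^esub>" using x im by auto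
    qed
  qed (auto simp: im add smult zero V.a_ac V.smult_assoc1 V.smult_l_distr V.smult_r_distr)
  have "linear_map K V W q"
    using V.vectorspace_axioms W im add smult
    by (auto simp: linear_map_def mod_hom_def mod_hom_axioms_def module_hom_def vectorspace_def)
  then interpret q: linear_map K V W q .
  have "q.W.fin_dim" using q.surj_fin_dim[of] V im by (simp add: has_dim_def)
  moreover have "V.dim = q.W.dim" using q.dim_eq[OF _ inj] V im by (simp add: has_dim_def)
  ultimately show ?thesis using V W by (simp add: has_dim_def)
qed


section \<open>Linear categories\<close>

context linear_category
begin

section \<open>Composition, zero morphisms and signs\<close>

abbreviation comp :: "'m \<Rightarrow> 'm \<Rightarrow> 'm"  (infixr \<open>\<bullet>\<close> 75) where
  "g \<bullet> f \<equiv> g \<cdot>\<^bsub>C\<^esub> f"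

abbreviation nul :: "'o \<Rightarrow> 'o \<Rightarrow> 'm" where "nul X Y \<equiv> \<zero>\<^bsub>Hom C X Y\<^esub>"

abbreviation neg :: "'o \<Rightarrow> 'o \<Rightarrow> 'm \<Rightarrow> 'm" where "neg X Y f \<equiv> \<ominus>\<^bsub>Hom C X Y\<^esub> f"

abbreviation zeros :: "'o set" where "zeros \<equiv> {Z. is_zero C Z}"

definition arr :: "'o \<Rightarrow> 'o \<Rightarrow> 'm \<Rightarrow> bool" where
  "arr X Y f \<longleftrightarrow> X \<in> Ob C \<and> Y \<in> Ob C \<and> f \<in> carrier (Hom C X Y)"

definition iso :: "'o \<Rightarrow> 'o \<Rightarrow> 'm \<Rightarrow> bool" where
  "iso X Y f \<longleftrightarrow> X \<in> Ob C \<and> Y \<in> Ob C \<and> is_iso C X Y f"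

lemma arrI: "X \<in> Ob C \<Longrightarrow> Y \<in> Ob C \<Longrightarrow> f \<in> carrier (Hom C X Y) \<Longrightarrow> arr X Y f"
  by (simp add: arr_def)

lemma arr_hom: "arr X Y f \<Longrightarrow> f \<in> carrier (Hom C X Y)"
  by (simp add: arr_def)

lemma arr_dom: "arr X Y f \<Longrightarrow> X \<in> Ob C"
  by (simp add: arr_def)

lemma arr_cod: "arr X Y f \<Longrightarrow> Y \<in> Ob C"
  by (simp add: arr_def)

lemma hom_group: "X \<in> Ob C \<Longrightarrow> Y \<in> Ob C \<Longrightarrow> abelian_group (Hom C X Y)"
  using hom_vectorspace[of X Y] unfolding vectorspace_def module_def by blast

lemma hom_module: "X \<in> Ob C \<Longrightarrow> Y \<in> Ob C \<Longrightarrow> module K (Hom C X Y)"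
  using hom_vectorspace[of X Y] unfolding vectorspace_def by blast

lemma arr_idm: "X \<in> Ob C \<Longrightarrow> arr X X (Idm C X)"
  by (simp add: arr_def idm_closed)

lemma arr_cmp: "arr X Y f \<Longrightarrow> arr Y Z g \<Longrightarrow> arr X Z (g \<bullet> f)"
  by (metis arr_def cmp_closed)

lemma arr_nul: "X \<in> Ob C \<Longrightarrow> Y \<in> Ob C \<Longrightarrow> arr X Y (nul X Y)"
  by (simp add: arr_def abelian_group.axioms(1) abelian_monoid.zero_closed hom_group)

lemma arr_neg: "arr X Y f \<Longrightarrow> arr X Y (neg X Y f)"
  by (simp add: arr_def abelian_group.a_inv_closed hom_group)

lemma arr_add: "arr X Y f \<Longrightarrow> arr X Y g \<Longrightarrow> arr X Y (f \<oplus>\<^bsub>Hom C X Y\<^esub> g)"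
  by (simp add: arr_def abelian_group.axioms(1) abelian_monoid.a_closed hom_group)

lemma arr_diff: "arr X Y f \<Longrightarrow> arr X Y g \<Longrightarrow> arr X Y (f \<ominus>\<^bsub>Hom C X Y\<^esub> g)"
  by (simp add: arr_def abelian_group.minus_closed hom_group)

lemma arr_smult: "a \<in> carrier K \<Longrightarrow> arr X Y f \<Longrightarrow> arr X Y (a \<odot>\<^bsub>Hom C X Y\<^esub> f)"
  unfolding arr_def using module.smult_closed[OF hom_module] by metis

lemma assoc: "arr W X f \<Longrightarrow> arr X Y g \<Longrightarrow> arr Y Z h \<Longrightarrow> (h \<bullet> g) \<bullet> f = h \<bullet> g \<bullet> f"
  unfolding arr_def by (metis cmp_assoc)

lemma idm_right: "arr X Y f \<Longrightarrow> f \<bullet> Idm C X = f"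
  unfolding arr_def by (metis cmp_idm_right)

lemma idm_left: "arr X Y f \<Longrightarrow> Idm C Y \<bullet> f = f"
  unfolding arr_def by (metis cmp_idm_left)

lemma precomp_hom:
  assumes "arr X Y f" "Z \<in> Ob C"
  shows "mod_hom K (Hom C Y Z) (Hom C X Z) (\<lambda>g. g \<bullet> f)"
  using assms precomp_linear[of X Y Z f] hom_module[of Y Z] hom_module[of X Z]
  unfolding arr_def by (intro mod_hom.intro mod_hom_axioms.intro) blast+

lemma postcomp_hom:
  assumes "arr Y Z g" "X \<in> Ob C"
  shows "mod_hom K (Hom C X Y) (Hom C X Z) (\<lambda>f. g \<bullet> f)"
  using assms postcomp_linear[of X Y Z g] hom_module[of X Y] hom_module[of X Z]
  unfolding arr_def by (intro mod_hom.intro mod_hom_axioms.intro) blast+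

lemma nul_cmp: "arr X Y f \<Longrightarrow> Z \<in> Ob C \<Longrightarrow> nul Y Z \<bullet> f = nul X Z"
  using mod_hom.f0_is_0[OF precomp_hom] by simp

lemma cmp_nul: "arr Y Z g \<Longrightarrow> X \<in> Ob C \<Longrightarrow> g \<bullet> nul X Y = nul X Z"
  using mod_hom.f0_is_0[OF postcomp_hom] by simp

lemma neg_cmp: "arr X Y f \<Longrightarrow> arr Y Z g \<Longrightarrow> neg Y Z g \<bullet> f = neg X Z (g \<bullet> f)"
  using mod_hom.f_neg[OF precomp_hom, of X Y f Z g] by (simp add: arr_def)

lemma cmp_neg: "arr X Y f \<Longrightarrow> arr Y Z g \<Longrightarrow> g \<bullet> neg X Y f = neg X Z (g \<bullet> f)"
  using mod_hom.f_neg[OF postcomp_hom, of Y Z g X f] by (simp add: arr_def)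

lemma diff_cmp: "arr X Y f \<Longrightarrow> arr Y Z g \<Longrightarrow> arr Y Z g' \<Longrightarrow>
    (g \<ominus>\<^bsub>Hom C Y Z\<^esub> g') \<bullet> f = (g \<bullet> f) \<ominus>\<^bsub>Hom C X Z\<^esub> (g' \<bullet> f)"
  using mod_hom.f_minus[OF precomp_hom, of X Y f Z g g'] by (simp add: arr_def)

lemma cmp_diff: "arr X Y f \<Longrightarrow> arr X Y f' \<Longrightarrow> arr Y Z g \<Longrightarrow>
    g \<bullet> (f \<ominus>\<^bsub>Hom C X Y\<^esub> f') = (g \<bullet> f) \<ominus>\<^bsub>Hom C X Z\<^esub> (g \<bullet> f')"
  using mod_hom.f_minus[OF postcomp_hom, of Y Z g X f f'] by (simp add: arr_def)

lemma add_cmp: "arr X Y f \<Longrightarrow> arr Y Z g \<Longrightarrow> arr Y Z g' \<Longrightarrow>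
    (g \<oplus>\<^bsub>Hom C Y Z\<^esub> g') \<bullet> f = (g \<bullet> f) \<oplus>\<^bsub>Hom C X Z\<^esub> (g' \<bullet> f)"
  using module_hom_add[OF mod_hom.f_hom[OF precomp_hom], of X Y f Z g g'] by (simp add: arr_def)

lemma smult_cmp: "a \<in> carrier K \<Longrightarrow> arr X Y f \<Longrightarrow> arr Y Z g \<Longrightarrow>
    (a \<odot>\<^bsub>Hom C Y Z\<^esub> g) \<bullet> f = a \<odot>\<^bsub>Hom C X Z\<^esub> (g \<bullet> f)"
  using module_hom_smult[OF mod_hom.f_hom[OF precomp_hom], of X Y f Z a g] by (simp add: arr_def)

lemma neg_neg: "arr X Y f \<Longrightarrow> neg X Y (neg X Y f) = f"
  by (simp add: arr_def abelian_group.minus_minus hom_group)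

lemma diff_self: "arr X Y f \<Longrightarrow> f \<ominus>\<^bsub>Hom C X Y\<^esub> f = nul X Y"
  by (simp add: arr_def a_minus_def abelian_group.r_neg hom_group)

lemma neg_nul: "X \<in> Ob C \<Longrightarrow> Y \<in> Ob C \<Longrightarrow> neg X Y (nul X Y) = nul X Y"
  by (metis hom_group abelian_group.l_neg abelian_group.axioms(1) abelian_monoid.r_zero
      abelian_monoid.zero_closed abelian_group.a_inv_closed)

lemma neg_eq_nul: "arr X Y f \<Longrightarrow> neg X Y f = nul X Y \<Longrightarrow> f = nul X Y"
  by (metis neg_neg neg_nul arr_def)

lemma neg_inj: "arr X Y f \<Longrightarrow> arr X Y g \<Longrightarrow> neg X Y f = neg X Y g \<Longrightarrow> f = g"
  by (metis neg_neg)

lemma diff_nul: "arr X Y f \<Longrightarrow> f \<ominus>\<^bsub>Hom C X Y\<^esub> nul X Y = f"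
  by (simp add: arr_def a_minus_def neg_nul abelian_group.axioms(1) abelian_monoid.r_zero hom_group)

lemma diff_add_cancel: "arr X Y f \<Longrightarrow> arr X Y g \<Longrightarrow>
    g \<oplus>\<^bsub>Hom C X Y\<^esub> (f \<ominus>\<^bsub>Hom C X Y\<^esub> g) = f"
  by (metis (no_types, lifting) arr_def a_minus_def abelian_group.a_inv_closed abelian_group.r_neg2
      abelian_group.axioms(1) abelian_monoid.a_comm hom_group abelian_group.minus_closed abelian_group.r_neg1)

lemma diff_eq_nul: "arr X Y f \<Longrightarrow> arr X Y g \<Longrightarrow> f \<ominus>\<^bsub>Hom C X Y\<^esub> g = nul X Y \<Longrightarrow> f = g"
  by (metis arr_def diff_add_cancel hom_group abelian_group.axioms(1) abelian_monoid.r_zero)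

section \<open>Isomorphisms and zero objects\<close>

lemma iso_arr: "iso X Y f \<Longrightarrow> arr X Y f"
  by (simp add: iso_def is_iso_def arr_def)

lemma isoI: "arr X Y f \<Longrightarrow> arr Y X g \<Longrightarrow> g \<bullet> f = Idm C X \<Longrightarrow> f \<bullet> g = Idm C Y \<Longrightarrow> iso X Y f"
  by (auto simp: iso_def is_iso_def arr_def)

lemma isoE:
  assumes "iso X Y f"
  obtains g where "arr X Y f" "arr Y X g" "g \<bullet> f = Idm C X" "f \<bullet> g = Idm C Y" "iso Y X g"
  using assms by (auto simp: iso_def is_iso_def arr_def)

lemma iso_idm: "X \<in> Ob C \<Longrightarrow> iso X X (Idm C X)"
  by (metis arr_idm idm_left isoI)

lemma is_zero_ob: "is_zero C Z \<Longrightarrow> Z \<in> Ob C"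
  by (simp add: is_zero_def)

lemma to_zero: "is_zero C Z \<Longrightarrow> arr X Z f \<Longrightarrow> f = nul X Z"
  by (metis arr_def idm_left nul_cmp is_zero_def)

lemma from_zero: "is_zero C Z \<Longrightarrow> arr Z X f \<Longrightarrow> f = nul Z X"
  by (metis arr_def idm_right cmp_nul is_zero_def)

lemma hom_zero_iff: "X \<in> Ob C \<Longrightarrow> Y \<in> Ob C \<Longrightarrow> hom_zero C X Y \<longleftrightarrow> (\<forall>f. arr X Y f \<longrightarrow> f = nul X Y)"
  using arr_nul[of X Y] by (auto simp: hom_zero_def arr_def)

lemma hom_zeroD: "hom_zero C X Y \<Longrightarrow> arr X Y f \<Longrightarrow> f = nul X Y"
  by (auto simp: hom_zero_def arr_def)

lemma is_zero_if_hom_zero: "X \<in> Ob C \<Longrightarrow> hom_zero C X X \<Longrightarrow> is_zero C X"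
  using hom_zeroD arr_idm by (auto simp: is_zero_def)

lemma is_zero_iso: assumes "is_zero C Z" "iso Z W f" shows "is_zero C W"
proof -
  obtain g where g: "arr Z W f" "arr W Z g" "g \<bullet> f = Idm C Z" "f \<bullet> g = Idm C W"
    using assms by (metis isoE)
  then have "f \<bullet> g = nul W W"
    using assms by (metis nul_cmp from_zero arr_cod)
  then show ?thesis using g by (auto simp: is_zero_def arr_def)
qed

lemma retract_zero:
  assumes "arr X Z i" "arr Z X r" "r \<bullet> i = Idm C X" "is_zero C Z" shows "is_zero C X"
proof -
  have "i = nul X Z" using assms to_zero by blast
  then have "r \<bullet> i = nul X X" using assms cmp_nul arr_dom by blast
  then show ?thesis using assms by (auto simp: is_zero_def arr_def)
qed

text \<open>This replaces the five lemma: an endomorphism of a triangle which is the identity on two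
  objects differs from the identity on the third by a morphism of square zero.\<close>

lemma iso_unipotent:
  assumes e: "arr X X e"
    and sq: "(e \<ominus>\<^bsub>Hom C X X\<^esub> Idm C X) \<bullet> (e \<ominus>\<^bsub>Hom C X X\<^esub> Idm C X) = nul X X"
  shows "iso X X e"
proof -
  define n where "n = e \<ominus>\<^bsub>Hom C X X\<^esub> Idm C X"
  have X: "X \<in> Ob C" using e by (simp add: arr_def)
  interpret V: abelian_group "Hom C X X" using X by (rule hom_group[OF _ X])
  have n: "arr X X n" and i: "arr X X (Idm C X)" using e X by (auto simp: n_def arr_diff arr_idm)
  \<comment> \<open>The inverse of 1 + n is 1 - n when n n = 0: both products of \<open>m\<close>
    with \<open>e\<close> equal e - n, which is the identity.\<close>
  define m where "m = Idm C X \<ominus>\<^bsub>Hom C X X\<^esub> n"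
  have m: "arr X X m" using n i by (simp add: m_def arr_diff)
  have ei: "e = Idm C X \<oplus>\<^bsub>Hom C X X\<^esub> n"
    using diff_add_cancel[OF e i] by (simp add: n_def)
  have nn: "n \<bullet> n = nul X X" using sq by (simp add: n_def)
  have en: "n \<bullet> e = n" "e \<bullet> n = n"
  proof -
    have "(n \<bullet> e) \<ominus>\<^bsub>Hom C X X\<^esub> n = nul X X" "(e \<bullet> n) \<ominus>\<^bsub>Hom C X X\<^esub> n = nul X X"
      using nn cmp_diff[OF e i n] diff_cmp[OF n e i] n i by (simp_all add: n_def[symmetric] idm_left idm_right)
    then show "n \<bullet> e = n" "e \<bullet> n = n" using n e by (metis arr_cmp diff_eq_nul)+
  qed
  have em: "e \<ominus>\<^bsub>Hom C X X\<^esub> n = Idm C X"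
    using n i unfolding ei by (simp add: arr_def a_minus_def V.a_assoc V.r_neg)
  have "m \<bullet> e = e \<ominus>\<^bsub>Hom C X X\<^esub> n"
    using diff_cmp[OF e i n] e en by (simp add: m_def idm_left)
  moreover have "e \<bullet> m = e \<ominus>\<^bsub>Hom C X X\<^esub> n"
    using cmp_diff[OF i n e] e en by (simp add: m_def idm_right)
  ultimately show ?thesis using isoI[OF e m] em by simp
qed

lemma cmp_smult: "a \<in> carrier K \<Longrightarrow> arr X Y f \<Longrightarrow> arr Y Z g \<Longrightarrow>
    g \<bullet> (a \<odot>\<^bsub>Hom C X Y\<^esub> f) = a \<odot>\<^bsub>Hom C X Z\<^esub> (g \<bullet> f)"
  using module_hom_smult[OF mod_hom.f_hom[OF postcomp_hom], of Y Z g X a f] by (simp add: arr_def)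

lemma has_dim_0_hom_zero:
  assumes "has_dim K (Hom C X Y) 0" "X \<in> Ob C" "Y \<in> Ob C" shows "hom_zero C X Y"
  unfolding hom_zero_iff[OF assms(2,3)] arr_def
  using assms vectorspace.dim_0_trivial[of K "Hom C X Y"] by (auto simp: has_dim_def)

lemma has_dim_1_not_zero:
  assumes "has_dim K (Hom C X X) 1" "X \<in> Ob C" shows "\<not> is_zero C X"
proof
  assume "is_zero C X"
  then have "carrier (Hom C X X) = {nul X X}"
    using arr_nul[OF assms(2,2)] from_zero by (auto simp: arr_def)
  moreover interpret V: vectorspace K "Hom C X X" using assms by (simp add: has_dim_def)
  have "V.span {nul X X} \<subseteq> carrier (Hom C X X)" "nul X X \<in> V.span {nul X X}"
    using V.span_closed[of "{nul X X}"] V.span_zero by auto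
  ultimately have "V.gen_set {nul X X}" by auto
  then show False using V.dim0I assms by (simp add: has_dim_def)
qed

text \<open>A nonzero \<open>f\<close> spans End(X), so the identity is a multiple of
  \<open>f\<close> by some scalar \<open>a\<close>, and \<open>a\<close> times the identity is the
  inverse.\<close>

lemma has_dim_1_iso:
  assumes d: "has_dim K (Hom C X X) 1" and f: "arr X X f" "f \<noteq> nul X X" shows "iso X X f"
proof -
  have X: "X \<in> Ob C" using f by (simp add: arr_def)
  obtain a where a: "a \<in> carrier K" "Idm C X = a \<odot>\<^bsub>Hom C X X\<^esub> f"
    using d f vectorspace.dim_1_multiple[of K "Hom C X X" f "Idm C X"] idm_closed[OF X]
    by (auto simp: has_dim_def arr_def)
  note i = arr_idm[OF X]
  show ?thesis
    using smult_cmp[OF a(1) f(1) i] cmp_smult[OF a(1) i f(1)] idm_left[OF f(1)] idm_right[OF f(1)] a(2)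
    by (intro isoI[OF f(1) arr_smult[OF a(1) i]]) simp_all
qed

end


section \<open>Triangulated categories\<close>

context triangulated_category
begin

section \<open>The shift as an automorphism\<close>

lemma sh_ob: "X \<in> Ob C \<Longrightarrow> Sh C X \<in> Ob C"
  using sh_bij by (auto simp: bij_betw_def)

lemma sh_surj: assumes "X \<in> Ob C" obtains X' where "X' \<in> Ob C" "Sh C X' = X"
  using assms sh_bij unfolding bij_betw_def by (metis imageE)

lemma sh_inj: "X \<in> Ob C \<Longrightarrow> Y \<in> Ob C \<Longrightarrow> Sh C X = Sh C Y \<Longrightarrow> X = Y"
  using sh_bij by (auto simp: bij_betw_def inj_on_def)

lemma arr_shm: "arr X Y f \<Longrightarrow> arr (Sh C X) (Sh C Y) (Shm C f)"
  using shm_bij[of X Y] sh_ob by (auto simp: arr_def bij_betw_def)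

lemma shm_surj:
  assumes "arr (Sh C X) (Sh C Y) f" "X \<in> Ob C" "Y \<in> Ob C"
  obtains f' where "arr X Y f'" "Shm C f' = f"
  using assms shm_bij[of X Y] unfolding arr_def bij_betw_def by (metis imageE)

lemma shm_inj: "arr X Y f \<Longrightarrow> arr X Y g \<Longrightarrow> Shm C f = Shm C g \<Longrightarrow> f = g"
  using shm_bij[of X Y] by (auto simp: arr_def bij_betw_def inj_on_def)

lemma shm_hom: "X \<in> Ob C \<Longrightarrow> Y \<in> Ob C \<Longrightarrow> mod_hom K (Hom C X Y) (Hom C (Sh C X) (Sh C Y)) (Shm C)"
  using shm_linear[of X Y] hom_module sh_ob by (auto simp: mod_hom_def mod_hom_axioms_def)

lemma shm_nul: "X \<in> Ob C \<Longrightarrow> Y \<in> Ob C \<Longrightarrow> Shm C (nul X Y) = nul (Sh C X) (Sh C Y)"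
  using mod_hom.f0_is_0[OF shm_hom] by simp

lemma shm_comp: "arr X Y f \<Longrightarrow> arr Y Z g \<Longrightarrow> Shm C (g \<bullet> f) = Shm C g \<bullet> Shm C f"
  unfolding arr_def by (metis shm_cmp)

lemma shm_eq_nul: "arr X Y f \<Longrightarrow> Shm C f = nul (Sh C X) (Sh C Y) \<longleftrightarrow> f = nul X Y"
  by (metis arr_def arr_nul shm_inj shm_nul)

lemma iso_shm:
  assumes "iso X Y f" shows "iso (Sh C X) (Sh C Y) (Shm C f)"
proof -
  obtain g where g: "arr X Y f" "arr Y X g" "g \<bullet> f = Idm C X" "f \<bullet> g = Idm C Y"
    using assms by (metis isoE)
  show ?thesis
    using shm_comp[OF g(1,2)] shm_comp[OF g(2,1)] g shm_idm
    by (intro isoI[OF arr_shm[OF g(1)] arr_shm[OF g(2)]]) (simp_all add: arr_def)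
qed

lemma iso_shmD:
  assumes "arr X Y f" "iso (Sh C X) (Sh C Y) (Shm C f)" shows "iso X Y f"
proof -
  obtain g where g: "arr (Sh C Y) (Sh C X) g" "g \<bullet> Shm C f = Idm C (Sh C X)" "Shm C f \<bullet> g = Idm C (Sh C Y)"
    using assms(2) by (metis isoE)
  have XY: "X \<in> Ob C" "Y \<in> Ob C" using assms by (auto simp: arr_def)
  obtain g' where g': "arr Y X g'" "Shm C g' = g" using shm_surj[OF g(1)] XY by blast
  have "g' \<bullet> f = Idm C X"
    using shm_inj[OF arr_cmp[OF assms(1) g'(1)] arr_idm[OF XY(1)]] shm_comp[OF assms(1) g'(1)]
      shm_idm[OF XY(1)] g g' by simp
  moreover have "f \<bullet> g' = Idm C Y"
    using shm_inj[OF arr_cmp[OF g'(1) assms(1)] arr_idm[OF XY(2)]] shm_comp[OF g'(1) assms(1)]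
      shm_idm[OF XY(2)] g g' by simp
  ultimately show ?thesis using assms g' isoI by blast
qed

lemma is_zero_sh: "is_zero C Z \<Longrightarrow> is_zero C (Sh C Z)"
  by (metis is_zero_def sh_ob shm_idm shm_nul)

lemma is_zero_shD: "is_zero C (Sh C Z) \<Longrightarrow> Z \<in> Ob C \<Longrightarrow> is_zero C Z"
  by (metis is_zero_def shm_idm shm_eq_nul arr_idm)

lemma zero_exists: obtains Z where "is_zero C Z"
proof -
  obtain Z where "is_dsum C 0 (\<lambda>_. undefined) Z" using dsum_exists[of 0] by auto
  then have "Z \<in> Ob C" "Idm C Z = nul Z Z"
    by (auto simp: is_dsum_def)
      (metis abelian_group.axioms(1) abelian_monoid.finsum_empty hom_group)
  then show ?thesis using that by (simp add: is_zero_def)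
qed

section \<open>Rotation and morphisms of triangles\<close>

lemma tri_ob: assumes "(X, Y, Z, f, g, h) \<in> Tri C"
  shows "X \<in> Ob C" "Y \<in> Ob C" "Z \<in> Ob C" "arr X Y f" "arr Y Z g" "arr Z (Sh C X) h"
  using assms tri_candidates sh_ob by (auto simp: candidates_def arr_def)

lemma cand_iff: "(X, Y, Z, f, g, h) \<in> candidates C \<longleftrightarrow> arr X Y f \<and> arr Y Z g \<and> arr Z (Sh C X) h"
  using sh_ob by (auto simp: candidates_def arr_def)

lemma tri_iso:
  assumes "(X, Y, Z, f, g, h) \<in> Tri C" "arr X' Y' f'" "arr Y' Z' g'" "arr Z' (Sh C X') h'"
    and "iso X X' a" "iso Y Y' b" "iso Z Z' c"
    and "b \<bullet> f = f' \<bullet> a" "c \<bullet> g = g' \<bullet> b" "Shm C a \<bullet> h = h' \<bullet> c"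
  shows "(X', Y', Z', f', g', h') \<in> Tri C"
proof (rule TR1_iso[OF assms(1)])
  show "(X', Y', Z', f', g', h') \<in> candidates C" using assms by (simp add: cand_iff)
  show "cand_iso C (X, Y, Z, f, g, h) (X', Y', Z', f', g', h')"
    using assms by (auto simp: cand_iso_def iso_def)
qed

lemma cone: assumes "arr X Y f" obtains Z g h where "(X, Y, Z, f, g, h) \<in> Tri C"
  using assms TR1_cone unfolding arr_def by metis

lemma rot:
  assumes "(X, Y, Z, f, g, h) \<in> Tri C"
  shows "(Y, Z, Sh C X, g, h, neg (Sh C X) (Sh C Y) (Shm C f)) \<in> Tri C"
  using assms TR2 tri_candidates by blast

text \<open>Reading TR2 from right to left requires a third object of the form Z'[1]. The shift is
  bijective on objects and morphisms, so every \<open>Z\<close> and \<open>h\<close> can be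
  desuspended; the sign in the conclusion is that of TR2.\<close>

lemma rot_back:
  assumes t: "(X, Y, Z, f, g, h) \<in> Tri C"
  obtains Z' h' where "Sh C Z' = Z" "(Z', X, Y, h', f, g) \<in> Tri C"
    "h = neg Z (Sh C X) (Shm C h')"
proof -
  obtain Z' where Z': "Z' \<in> Ob C" "Sh C Z' = Z" using sh_surj tri_ob(3)[OF t] by blast
  note a = tri_ob[OF t]
  obtain h' where h': "arr Z' X h'" "Shm C h' = neg Z (Sh C X) h"
    using shm_surj[of Z' X "neg Z (Sh C X) h"] Z' a arr_neg by blast
  have h: "h = neg Z (Sh C X) (Shm C h')" using h' a neg_neg by metis
  have "(Z', X, Y, h', f, g) \<in> candidates C"
    using a h' Z' by (simp add: cand_iff)
  then have "(Z', X, Y, h', f, g) \<in> Tri C"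
    using TR2 t h Z' by metis
  then show ?thesis using that Z' h by blast
qed

lemma tri_idm: "X \<in> Ob C \<Longrightarrow> is_zero C Z \<Longrightarrow> (X, X, Z, Idm C X, nul X Z, nul Z (Sh C X)) \<in> Tri C"
  by (rule TR1_idm)

text \<open>Undo one rotation of the identity triangle X -> X -> Z[1], where Z[1] is again
  zero.\<close>

lemma tri_idm': assumes "X \<in> Ob C" "is_zero C Z" shows "(Z, X, X, nul Z X, Idm C X, nul X (Sh C Z)) \<in> Tri C"
proof -
  have Z: "Z \<in> Ob C" "Sh C Z \<in> Ob C" using assms is_zero_ob sh_ob by auto
  then have "(X, X, Sh C Z, Idm C X, nul X (Sh C Z), neg (Sh C Z) (Sh C X) (Shm C (nul Z X))) \<in> Tri C"
    using assms tri_idm[of X "Sh C Z"] by (simp add: is_zero_sh shm_nul neg_nul sh_ob)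
  moreover have "(Z, X, X, nul Z X, Idm C X, nul X (Sh C Z)) \<in> candidates C"
    using assms Z by (auto simp: cand_iff arr_idm arr_nul)
  ultimately show ?thesis using TR2 by blast
qed

lemma tri_map:
  assumes "(X, Y, Z, f, g, h) \<in> Tri C" "(X', Y', Z', f', g', h') \<in> Tri C"
    "arr X X' a" "arr Y Y' b" "b \<bullet> f = f' \<bullet> a"
  obtains c where "arr Z Z' c" "c \<bullet> g = g' \<bullet> b" "Shm C a \<bullet> h = h' \<bullet> c"
  by (rule bexE[OF TR3[OF assms(1,2) arr_hom[OF assms(3)] arr_hom[OF assms(4)] assms(5)]])
    (metis that arrI[OF tri_ob(3)[OF assms(1)] tri_ob(3)[OF assms(2)]])

text \<open>TR3 for the rotated triangles gives a map X[1] -> X'[1], which is then desuspended. The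
  signs introduced by rotation stand on both sides and cancel.\<close>

lemma tri_map':
  assumes t: "(X, Y, Z, f, g, h) \<in> Tri C" and t': "(X', Y', Z', f', g', h') \<in> Tri C"
    and b: "arr Y Y' b" and c: "arr Z Z' c" and e: "c \<bullet> g = g' \<bullet> b"
  obtains a where "arr X X' a" "b \<bullet> f = f' \<bullet> a" "Shm C a \<bullet> h = h' \<bullet> c"
proof -
  note o = tri_ob[OF t] and o' = tri_ob[OF t']
  obtain u where u: "arr (Sh C X) (Sh C X') u" "u \<bullet> h = h' \<bullet> c"
    "Shm C b \<bullet> neg (Sh C X) (Sh C Y) (Shm C f) = neg (Sh C X') (Sh C Y') (Shm C f') \<bullet> u"
    using tri_map[OF rot[OF t] rot[OF t'] b c e] by blast
  obtain a where a: "arr X X' a" "Shm C a = u" using shm_surj[OF u(1)] o o' by blast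
  have "neg (Sh C X) (Sh C Y') (Shm C b \<bullet> Shm C f) = neg (Sh C X) (Sh C Y') (Shm C f' \<bullet> Shm C a)"
    using u(3) cmp_neg[OF arr_shm[OF o(4)] arr_shm[OF b]] neg_cmp[OF u(1) arr_shm[OF o'(4)]] a by simp
  then have "Shm C b \<bullet> Shm C f = Shm C f' \<bullet> Shm C a"
    by (rule neg_inj[OF arr_cmp[OF arr_shm[OF o(4)] arr_shm[OF b]] arr_cmp[OF arr_shm[OF a(1)] arr_shm[OF o'(4)]]])
  then have "b \<bullet> f = f' \<bullet> a"
    using shm_comp[OF o(4) b] shm_comp[OF a(1) o'(4)]
    by (intro shm_inj[OF arr_cmp[OF o(4) b] arr_cmp[OF a(1) o'(4)]]) simp
  then show ?thesis using that[OF a(1)] a u by simp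
qed

section \<open>Exactness of Hom along a triangle\<close>

lemma tri_cmp: assumes t: "(X, Y, Z, f, g, h) \<in> Tri C" shows "g \<bullet> f = nul X Z"
proof -
  obtain N where N: "is_zero C N" by (rule zero_exists)
  note o = tri_ob[OF t]
  obtain c where c: "arr N Z c" "c \<bullet> nul X N = g \<bullet> f"
    using tri_map[OF tri_idm[OF o(1) N] t arr_idm[OF o(1)] o(4)] by metis
  then show ?thesis using cmp_nul[OF c(1) o(1)] by simp
qed

lemma tri_cmp2: assumes t: "(X, Y, Z, f, g, h) \<in> Tri C" shows "h \<bullet> g = nul Y (Sh C X)"
  using tri_cmp[OF rot[OF t]] .

text \<open>Compare with the identity triangle of \<open>W\<close>, whose third object is zero: the
  commuting square that \<open>tri_map'\<close> asks for is g w = 0, and the first component of the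
  resulting map is the lift.\<close>

lemma tri_lift:
  assumes t: "(X, Y, Z, f, g, h) \<in> Tri C" and w: "arr W Y w" "g \<bullet> w = nul W Z"
  obtains a where "arr W X a" "f \<bullet> a = w"
proof -
  obtain N where N: "is_zero C N" by (rule zero_exists)
  note o = tri_ob[OF t]
  have W: "W \<in> Ob C" using w by (simp add: arr_def)
  have "arr N Z (nul N Z)" using N o by (simp add: arr_nul is_zero_ob)
  moreover have "nul N Z \<bullet> nul W N = g \<bullet> w"
    using w(2) cmp_nul[OF calculation W] by simp
  ultimately obtain a where a: "arr W X a" "w \<bullet> Idm C W = f \<bullet> a"
    using tri_map'[OF tri_idm[OF W N] t w(1)] by blast
  then show ?thesis using that idm_right[OF w(1)] by simp
qed

lemma tri_ext:
  assumes t: "(X, Y, Z, f, g, h) \<in> Tri C" and w: "arr Y W w" "w \<bullet> f = nul X W"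
  obtains a where "arr Z W a" "a \<bullet> g = w"
proof -
  obtain N where N: "is_zero C N" by (rule zero_exists)
  note o = tri_ob[OF t]
  have W: "W \<in> Ob C" using w by (simp add: arr_def)
  have XN: "arr X N (nul X N)" using N o by (simp add: arr_nul is_zero_ob)
  moreover have "w \<bullet> f = nul N W \<bullet> nul X N"
    using w(2) nul_cmp[OF XN W] by simp
  ultimately obtain a where a: "arr Z W a" "a \<bullet> g = Idm C W \<bullet> w"
    using tri_map[OF t tri_idm'[OF W N] _ w(1)] by blast
  then show ?thesis using that idm_left[OF w(1)] by simp
qed

lemma tri_lift2:
  assumes t: "(X, Y, Z, f, g, h) \<in> Tri C" and w: "arr W Z w" "h \<bullet> w = nul W (Sh C X)"
  obtains a where "arr W Y a" "g \<bullet> a = w"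
  using tri_lift[OF rot[OF t] w] by blast

lemma tri_ext2:
  assumes t: "(X, Y, Z, f, g, h) \<in> Tri C" and w: "arr Z W w" "w \<bullet> g = nul Y W"
  obtains a where "arr (Sh C X) W a" "a \<bullet> h = w"
  using tri_ext[OF rot[OF t] w] by blast

text \<open>Put n = e - 1. From n f = 0 one gets n = m g for some m, and g n = 0 then gives n n = m
  g n = 0, so \<open>iso_unipotent\<close> applies.\<close>

lemma tri_endo_iso:
  assumes t: "(X, Y, Z, f, g, h) \<in> Tri C" and e: "arr Y Y e" "e \<bullet> f = f" "g \<bullet> e = g"
  shows "iso Y Y e"
proof (rule iso_unipotent[OF e(1)])
  note o = tri_ob[OF t]
  let ?n = "e \<ominus>\<^bsub>Hom C Y Y\<^esub> Idm C Y"
  have i: "arr Y Y (Idm C Y)" using o by (simp add: arr_idm)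
  have n: "arr Y Y ?n" using e i arr_diff by blast
  have "?n \<bullet> f = nul X Y"
    using diff_cmp[OF o(4) e(1) i] e o by (simp add: idm_left diff_self)
  then obtain m where m: "arr Z Y m" "m \<bullet> g = ?n" using tri_ext[OF t n] by blast
  have "g \<bullet> ?n = nul Y Z"
    using cmp_diff[OF e(1) i o(5)] e o by (simp add: idm_right diff_self)
  then have "?n \<bullet> ?n = m \<bullet> nul Y Z"
    using m(2) assoc[OF n o(5) m(1)] by simp
  then show "?n \<bullet> ?n = nul Y Y" using cmp_nul[OF m(1) o(2)] by simp
qed

text \<open>The complement is the cone \<open>Y\<close> of \<open>i\<close>: the idempotent 1 - i r
  kills \<open>i\<close>, hence equals s p, and \<open>s\<close> embeds \<open>Y\<close>. This turns
  retracts into the direct sums in which \<open>summand_closed\<close> is phrased.\<close>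

lemma retract_dsum:
  assumes i: "arr X Z i" and r: "arr Z X r" and ri: "r \<bullet> i = Idm C X"
  obtains A where "is_dsum C 2 A Z" "A 0 = X"
proof -
  obtain Y p h where t: "(X, Z, Y, i, p, h) \<in> Tri C" using cone[OF i] by blast
  note o = tri_ob[OF t]
  have iX: "arr X X (Idm C X)" and iZ: "arr Z Z (Idm C Z)" and iY: "arr Y Y (Idm C Y)"
    using o arr_idm by auto
  have ir: "arr Z Z (i \<bullet> r)" using i r arr_cmp by blast
  let ?q = "Idm C Z \<ominus>\<^bsub>Hom C Z Z\<^esub> (i \<bullet> r)"
  have q: "arr Z Z ?q" using iZ ir arr_diff by blast
  have "(i \<bullet> r) \<bullet> i = i" using assoc[OF i r i] ri idm_right[OF i] by simp
  then have "?q \<bullet> i = nul X Z"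
    using diff_cmp[OF i iZ ir] i by (simp add: idm_left diff_self)
  then obtain s where s: "arr Y Z s" "s \<bullet> p = ?q" using tri_ext[OF t q] by blast
  \<comment> \<open>As r[1] is a left inverse of i[1] and i[1] h = 0, the map \<open>h\<close>
    vanishes. Hence \<open>p\<close> is an epimorphism and can be cancelled on the right
    below.\<close>
  have epi: "w = nul Y W" if w: "arr Y W w" "w \<bullet> p = nul Z W" for w W
  proof -
    obtain m where m: "arr (Sh C X) W m" "m \<bullet> h = w" using tri_ext2[OF t w] by blast
    have "neg (Sh C X) (Sh C Z) (Shm C i) \<bullet> h = nul Y (Sh C Z)"
      using tri_cmp2[OF rot[OF t]] .
    then have ih: "Shm C i \<bullet> h = nul Y (Sh C Z)"
      using neg_cmp[OF o(6) arr_shm[OF i]] neg_eq_nul[OF arr_cmp[OF o(6) arr_shm[OF i]]] by simp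
    have "h = Shm C (r \<bullet> i) \<bullet> h" using ri idm_left[OF o(6)] shm_idm[OF o(1)] by simp
    also have "\<dots> = Shm C r \<bullet> Shm C i \<bullet> h"
      using shm_comp[OF i r] assoc[OF o(6) arr_shm[OF i] arr_shm[OF r]] by simp
    also have "\<dots> = nul Y (Sh C X)" using ih cmp_nul[OF arr_shm[OF r] o(3)] by simp
    finally show ?thesis using m(2) cmp_nul[OF m(1) o(3)] by simp
  qed
  have pi: "p \<bullet> i = nul X Y" using tri_cmp[OF t] .
  have "p \<bullet> i \<bullet> r = nul Z Y" using pi assoc[OF r i o(5)] nul_cmp[OF r o(3)] by simp
  then have "p \<bullet> ?q = p"
    using cmp_diff[OF iZ ir o(5)] o by (simp add: idm_right diff_nul)
  then have "(p \<bullet> s) \<bullet> p = p" using s(2) assoc[OF o(5) s(1) o(5)] by simp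
  then have "((p \<bullet> s) \<ominus>\<^bsub>Hom C Y Y\<^esub> Idm C Y) \<bullet> p = nul Z Y"
    using diff_cmp[OF o(5) arr_cmp[OF s(1) o(5)] iY] o by (simp add: idm_left diff_self)
  then have ps: "p \<bullet> s = Idm C Y"
    using epi[OF arr_diff[OF arr_cmp[OF s(1) o(5)] iY]] diff_eq_nul[OF arr_cmp[OF s(1) o(5)] iY] by blast
  have "r \<bullet> i \<bullet> r = r" using ri assoc[OF r i r] idm_left[OF r] by simp
  then have "r \<bullet> ?q = nul Z X"
    using cmp_diff[OF iZ ir r] r by (simp add: idm_right diff_self)
  then have "(r \<bullet> s) \<bullet> p = nul Z X" using s(2) assoc[OF o(5) s(1) r] by simp
  then have rs: "r \<bullet> s = nul Y X" using epi[OF arr_cmp[OF s(1) r]] by blast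
  have sum: "(i \<bullet> r) \<oplus>\<^bsub>Hom C Z Z\<^esub> (s \<bullet> p) = Idm C Z"
    using diff_add_cancel[OF iZ ir] s by simp
  interpret V: abelian_group "Hom C Z Z" using o by (intro hom_group)
  define A where "A j = (if j = 0 then X else Y)" for j :: nat
  define \<iota> where "\<iota> j = (if j = 0 then i else s)" for j :: nat
  define \<pi> where "\<pi> j = (if j = 0 then r else p)" for j :: nat
  have two: "{..<2::nat} = {0, 1}" by auto
  have "(\<Oplus>\<^bsub>Hom C Z Z\<^esub>j\<in>{..<2}. \<iota> j \<bullet> \<pi> j) = (i \<bullet> r) \<oplus>\<^bsub>Hom C Z Z\<^esub> (s \<bullet> p)"
    using ir arr_cmp[OF o(5) s(1)] by (simp add: two V.finsum_insert \<iota>_def \<pi>_def arr_def)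
  moreover have lt: "j = 0 \<or> j = 1" if "j < 2" for j :: nat using that by auto
  have "\<forall>j<2. A j \<in> Ob C" using o lt by (auto simp: A_def)
  moreover have "\<forall>j<2. \<iota> j \<in> carrier (Hom C (A j) Z) \<and> \<pi> j \<in> carrier (Hom C Z (A j))"
    using i r s(1) o(5) by (auto dest!: lt simp: A_def \<iota>_def \<pi>_def arr_hom)
  moreover have "\<forall>j<2. \<forall>k<2. \<pi> k \<bullet> \<iota> j = (if j = k then Idm C (A j) else nul (A j) (A k))"
    using ps ri rs pi by (auto dest!: lt simp: A_def \<iota>_def \<pi>_def)
  ultimately have "is_dsum C 2 A Z"
    unfolding is_dsum_def sum using o(2) by blast
  then show ?thesis using that by (simp add: A_def)
qed

section \<open>Isomorphisms and zero objects inside triangles\<close>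

lemma tri_change_middle:
  assumes t: "(X, E, Y, f, g, h) \<in> Tri C" and e: "iso E E' e"
  obtains f' g' where "(X, E', Y, f', g', h) \<in> Tri C"
proof -
  note o = tri_ob[OF t]
  obtain e' where e': "arr E E' e" "arr E' E e'" "e' \<bullet> e = Idm C E" using e by (metis isoE)
  have "(X, E', Y, e \<bullet> f, g \<bullet> e', h) \<in> Tri C"
  proof (rule tri_iso[OF t arr_cmp[OF o(4) e'(1)] arr_cmp[OF e'(2) o(5)] o(6)])
    show "iso X X (Idm C X)" "iso Y Y (Idm C Y)" "iso E E' e" using o e by (auto simp: iso_idm)
    show "e \<bullet> f = (e \<bullet> f) \<bullet> Idm C X" using idm_right[OF arr_cmp[OF o(4) e'(1)]] by simp
    show "Idm C Y \<bullet> g = (g \<bullet> e') \<bullet> e"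
      using idm_left[OF o(5)] assoc[OF e'(1,2) o(5)] e'(3) idm_right[OF o(5)] by simp
    show "Shm C (Idm C X) \<bullet> h = h \<bullet> Idm C Y"
      using shm_idm[OF o(1)] idm_left[OF o(6)] idm_right[OF o(6)] by simp
  qed
  then show ?thesis by (rule that)
qed

lemma tri_change_right:
  assumes t: "(X, E, Y, f, g, h) \<in> Tri C" and e: "iso Y Y' e"
  obtains g' h' where "(X, E, Y', f, g', h') \<in> Tri C"
proof -
  note o = tri_ob[OF t]
  obtain e' where e': "arr Y Y' e" "arr Y' Y e'" "e' \<bullet> e = Idm C Y" using e by (metis isoE)
  have "(X, E, Y', f, e \<bullet> g, h \<bullet> e') \<in> Tri C"
  proof (rule tri_iso[OF t o(4) arr_cmp[OF o(5) e'(1)] arr_cmp[OF e'(2) o(6)]])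
    show "iso X X (Idm C X)" "iso E E (Idm C E)" "iso Y Y' e" using o e by (auto simp: iso_idm)
    show "Idm C E \<bullet> f = f \<bullet> Idm C X" using idm_right[OF o(4)] idm_left[OF o(4)] by simp
    show "e \<bullet> g = (e \<bullet> g) \<bullet> Idm C E" using idm_right[OF arr_cmp[OF o(5) e'(1)]] by simp
    show "Shm C (Idm C X) \<bullet> h = (h \<bullet> e') \<bullet> e"
      using shm_idm[OF o(1)] idm_left[OF o(6)] assoc[OF e'(1,2) o(6)] e'(3) idm_right[OF o(6)] by simp
  qed
  then show ?thesis by (rule that)
qed

text \<open>Since g = 0, the identity of \<open>Y\<close> lifts to a right inverse \<open>a\<close>
  of \<open>f\<close>. Then f (a f - 1) = 0, so a f - 1 factors through Z[-1], which is zero as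
  well.\<close>

lemma iso_if_cone_zero:
  assumes t: "(X, Y, Z, f, g, h) \<in> Tri C" and Z: "is_zero C Z"
  shows "iso X Y f"
proof -
  note o = tri_ob[OF t]
  have "g = nul Y Z" using to_zero[OF Z o(5)] .
  then have "g \<bullet> Idm C Y = nul Y Z" using idm_right[OF o(5)] by simp
  then obtain a where a: "arr Y X a" "f \<bullet> a = Idm C Y" using tri_lift[OF t arr_idm[OF o(2)]] by blast
  obtain Z' h' where t': "Sh C Z' = Z" "(Z', X, Y, h', f, g) \<in> Tri C" using rot_back[OF t] by metis
  note o' = tri_ob[OF t'(2)]
  have Z': "is_zero C Z'" using is_zero_shD[of Z'] Z t' o' by simp
  note aa = arr_cmp[OF o(4) a(1)] and i = arr_idm[OF o(1)]
  have "f \<bullet> ((a \<bullet> f) \<ominus>\<^bsub>Hom C X X\<^esub> Idm C X) = nul X Y"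
    using cmp_diff[OF aa i o(4)] assoc[OF o(4) a(1) o(4)] a(2) idm_left[OF o(4)] idm_right[OF o(4)]
      diff_self[OF o(4)] by simp
  then obtain m where m: "arr X Z' m" "h' \<bullet> m = (a \<bullet> f) \<ominus>\<^bsub>Hom C X X\<^esub> Idm C X"
    using tri_lift[OF t'(2) arr_diff[OF aa i]] by blast
  then have "(a \<bullet> f) \<ominus>\<^bsub>Hom C X X\<^esub> Idm C X = nul X X"
    using from_zero[OF Z' o'(4)] nul_cmp[OF m(1) o(1)] by simp
  then have "a \<bullet> f = Idm C X" by (rule diff_eq_nul[OF aa i])
  then show ?thesis using isoI[OF o(4) a(1)] a(2) by simp
qed

lemma cone_zero_if_iso:
  assumes t: "(X, Y, Z, f, g, h) \<in> Tri C" and f: "iso X Y f"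
  shows "is_zero C Z"
proof -
  note o = tri_ob[OF t]
  obtain u where u: "arr (Sh C Y) (Sh C X) u" "u \<bullet> Shm C f = Idm C (Sh C X)"
    using iso_shm[OF f] by (metis isoE)
  obtain v where v: "arr Y X v" "f \<bullet> v = Idm C Y" using f by (metis isoE)
  have "g = (g \<bullet> f) \<bullet> v" using assoc[OF v(1) o(4,5)] v(2) idm_right[OF o(5)] by simp
  then have g: "g = nul Y Z" using tri_cmp[OF t] nul_cmp[OF v(1) o(3)] by simp
  have "neg Z (Sh C Y) (Shm C f \<bullet> h) = nul Z (Sh C Y)"
    using tri_cmp2[OF rot[OF t]] neg_cmp[OF o(6) arr_shm[OF o(4)]] by simp
  then have fh: "Shm C f \<bullet> h = nul Z (Sh C Y)" by (rule neg_eq_nul[OF arr_cmp[OF o(6) arr_shm[OF o(4)]]])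
  have "h = u \<bullet> Shm C f \<bullet> h"
    using assoc[OF o(6) arr_shm[OF o(4)] u(1)] u(2) idm_left[OF o(6)] by simp
  then have "h = nul Z (Sh C X)" using fh cmp_nul[OF u(1) o(3)] by simp
  then have "h \<bullet> Idm C Z = nul Z (Sh C X)" using idm_right[OF o(6)] by simp
  then obtain a where "arr Z Y a" "g \<bullet> a = Idm C Z" using tri_lift2[OF t arr_idm[OF o(3)]] by blast
  then show ?thesis using g nul_cmp[of Z Y a Z] o by (simp add: is_zero_def)
qed

lemma iso_if_left_zero:
  assumes t: "(X, Y, Z, f, g, h) \<in> Tri C" and "is_zero C X"
  shows "iso Y Z g"
  using iso_if_cone_zero[OF rot[OF t]] assms is_zero_sh by blast

text \<open>After two rotations \<open>h\<close> is the first map of a triangle whose third object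
  is Y[1].\<close>

lemma zero_if_connecting_iso:
  assumes t: "(X, Y, Z, f, g, h) \<in> Tri C" and "iso Z (Sh C X) h"
  shows "is_zero C Y"
proof -
  have "is_zero C (Sh C Y)" using cone_zero_if_iso[OF rot[OF rot[OF t]]] assms by blast
  then show ?thesis using is_zero_shD tri_ob(2)[OF t] by blast
qed

section \<open>Extensions of one class by another, and their associativity\<close>

lemma star_mem: "(X, E, Y, f, g, h) \<in> Tri C \<Longrightarrow> X \<in> P \<Longrightarrow> Y \<in> Q \<Longrightarrow> E \<in> star C P Q"
  unfolding star_def by blast

lemma starE:
  assumes "E \<in> star C P Q"
  obtains X Y f g h where "(X, E, Y, f, g, h) \<in> Tri C" "X \<in> P" "Y \<in> Q"
  using assms unfolding star_def by blast

lemma star_mono: "P \<subseteq> P' \<Longrightarrow> Q \<subseteq> Q' \<Longrightarrow> star C P Q \<subseteq> star C P' Q'"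
  unfolding star_def by blast

lemma star_ob: "star C P Q \<subseteq> Ob C"
  using tri_ob by (auto elim!: starE)

lemma star_iso: "E \<in> star C P Q \<Longrightarrow> iso E E' e \<Longrightarrow> E' \<in> star C P Q"
  by (metis starE star_mem tri_change_middle)

lemma iso_closedI: "(\<And>X Y f. X \<in> P \<Longrightarrow> iso X Y f \<Longrightarrow> Y \<in> P) \<Longrightarrow> P \<subseteq> Ob C \<Longrightarrow> iso_closed C P"
  unfolding iso_closed_def iso_def by blast

lemma iso_closedD: "iso_closed C P \<Longrightarrow> X \<in> P \<Longrightarrow> iso X Y f \<Longrightarrow> Y \<in> P"
  unfolding iso_closed_def iso_def by blast

lemma tri_assoc:
  assumes t: "(X, E, Y, f, g, h) \<in> Tri C" and t': "(E, F, Z, f', g', h') \<in> Tri C"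
  obtains W a b c a' b' c' where "(X, F, W, a, b, c) \<in> Tri C" "(Y, W, Z, a', b', c') \<in> Tri C"
proof -
  note o = tri_ob[OF t] and o' = tri_ob[OF t']
  obtain W b c where w: "(X, F, W, f' \<bullet> f, b, c) \<in> Tri C" using cone[OF arr_cmp[OF o(4) o'(4)]] by blast
  obtain u v where "(Y, W, Z, u, v, Shm C g \<bullet> h') \<in> Tri C"
    using TR4[OF t t' w] by blast
  then show ?thesis using that w by blast
qed

text \<open>\<open>E\<close> is the cocone of the composite F -> W -> Z. The octahedron for this
  composite is a triangle on X[1], E[1], Y[1]; three backward rotations bring it to X -> E -> Y,
  with literally these objects because the shift is injective.\<close>

lemma tri_assoc':
  assumes t: "(X, F, W, f, g, h) \<in> Tri C" and t': "(Y, W, Z, f', g', h') \<in> Tri C"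
  obtains E a b c a' b' c' where "(X, E, Y, a, b, c) \<in> Tri C" "(E, F, Z, a', b', c') \<in> Tri C"
    "b' = g' \<bullet> g"
proof -
  note o = tri_ob[OF t] and o' = tri_ob[OF t']
  obtain V k k' where v: "(F, Z, V, g' \<bullet> g, k, k') \<in> Tri C" using cone[OF arr_cmp[OF o(5) o'(5)]] by blast
  obtain E l where E: "Sh C E = V" "(E, F, Z, l, g' \<bullet> g, k) \<in> Tri C" using rot_back[OF v] by metis
  note oE = tri_ob[OF E(2)]
  obtain u w z where "(Sh C X, V, Sh C Y, u, w, z) \<in> Tri C"
    using TR4[OF rot[OF t] rot[OF t'] v] by blast
  then obtain Y' y where Y': "Sh C Y' = Sh C Y" "(Y', Sh C X, V, y, u, w) \<in> Tri C" using rot_back by metis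
  have YY: "Y' = Y" using sh_inj Y' o' tri_ob(1)[OF Y'(2)] by metis
  obtain E' u' where E': "Sh C E' = V" "(E', Y, Sh C X, u', y, u) \<in> Tri C"
    using rot_back[OF Y'(2)] YY by metis
  have EE: "E' = E" using sh_inj E' E oE tri_ob(1)[OF E'(2)] by metis
  obtain X' x where X': "Sh C X' = Sh C X" "(X', E, Y, x, u', y) \<in> Tri C"
    using rot_back[OF E'(2)] EE by metis
  have "X' = X" using sh_inj X' o tri_ob(1)[OF X'(2)] by metis
  then show ?thesis using that X' E by blast
qed

lemma star_assoc: "star C (star C P Q) R = star C P (star C Q R)"
proof (intro equalityI subsetI)
  fix F assume "F \<in> star C (star C P Q) R"
  then obtain E Z f g h where t: "(E, F, Z, f, g, h) \<in> Tri C" "E \<in> star C P Q" "Z \<in> R" by (rule starE)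
  from t(2) obtain X Y f' g' h' where t': "(X, E, Y, f', g', h') \<in> Tri C" "X \<in> P" "Y \<in> Q" by (rule starE)
  show "F \<in> star C P (star C Q R)"
    by (rule tri_assoc[OF t'(1) t(1)]) (blast intro: star_mem t t')
next
  fix F assume "F \<in> star C P (star C Q R)"
  then obtain X W f g h where t: "(X, F, W, f, g, h) \<in> Tri C" "X \<in> P" "W \<in> star C Q R" by (rule starE)
  from t(3) obtain Y Z f' g' h' where t': "(Y, W, Z, f', g', h') \<in> Tri C" "Y \<in> Q" "Z \<in> R" by (rule starE)
  show "F \<in> star C (star C P Q) R"
    by (rule tri_assoc'[OF t(1) t'(1)]) (blast intro: star_mem t t')
qed

lemma star_zeros_left:
  assumes "iso_closed C P" "P \<subseteq> Ob C" shows "star C zeros P = P"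
proof (intro equalityI subsetI)
  fix E assume "E \<in> star C zeros P"
  then obtain N Y f g h where t: "(N, E, Y, f, g, h) \<in> Tri C" "is_zero C N" "Y \<in> P" by (auto elim: starE)
  then have "iso E Y g" using iso_if_left_zero by blast
  then show "E \<in> P" using iso_closedD[OF assms(1) t(3)] by (metis isoE)
next
  fix E assume E: "E \<in> P"
  obtain N where "is_zero C N" by (rule zero_exists)
  then show "E \<in> star C zeros P" using star_mem[OF tri_idm', of E N zeros P] E assms by auto
qed

section \<open>Vanishing of Hom and extensions\<close>

lemma hom_zero_ext_right:
  assumes t: "(X, Y, Z, f, g, h) \<in> Tri C" and "hom_zero C A X" "hom_zero C A Z" "A \<in> Ob C"
  shows "hom_zero C A Y"
  unfolding hom_zero_iff[OF assms(4) tri_ob(2)[OF t]]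
proof (intro allI impI)
  fix w assume w: "arr A Y w"
  note o = tri_ob[OF t]
  have "g \<bullet> w = nul A Z" using hom_zeroD[OF assms(3) arr_cmp[OF w o(5)]] .
  then obtain a where a: "arr A X a" "f \<bullet> a = w" using tri_lift[OF t w] by blast
  then show "w = nul A Y" using hom_zeroD[OF assms(2) a(1)] cmp_nul[OF o(4) assms(4)] by simp
qed

lemma hom_zero_ext_left:
  assumes t: "(X, Y, Z, f, g, h) \<in> Tri C" and "hom_zero C X A" "hom_zero C Z A" "A \<in> Ob C"
  shows "hom_zero C Y A"
  unfolding hom_zero_iff[OF tri_ob(2)[OF t] assms(4)]
proof (intro allI impI)
  fix w assume w: "arr Y A w"
  note o = tri_ob[OF t]
  have "w \<bullet> f = nul X A" using hom_zeroD[OF assms(2) arr_cmp[OF o(4) w]] .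
  then obtain a where a: "arr Z A a" "a \<bullet> g = w" using tri_ext[OF t w] by blast
  then show "w = nul Y A" using hom_zeroD[OF assms(3) a(1)] nul_cmp[OF o(5) assms(4)] by simp
qed

lemma hom_zero_zero: "is_zero C Z \<Longrightarrow> X \<in> Ob C \<Longrightarrow> hom_zero C X Z" "is_zero C Z \<Longrightarrow> X \<in> Ob C \<Longrightarrow> hom_zero C Z X"
  using to_zero from_zero is_zero_ob by (auto simp: hom_zero_iff)

lemma hom_zero_iso_right: 
  assumes "iso X X' e" "hom_zero C A X" "A \<in> Ob C" shows "hom_zero C A X'"
proof -
  obtain e' where e': "arr X X' e" "arr X' X e'" "e \<bullet> e' = Idm C X'" using assms by (metis isoE)
  have "w = nul A X'" if w: "arr A X' w" for w
    using assoc[OF w e'(2,1)] e'(3) idm_left[OF w] hom_zeroD[OF assms(2) arr_cmp[OF w e'(2)]]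
      cmp_nul[OF e'(1) assms(3)] by simp
  then show ?thesis using hom_zero_iff[OF assms(3) arr_cod[OF e'(1)]] by blast
qed

lemma hom_zero_iso_left: 
  assumes "iso X X' e" "hom_zero C X A" "A \<in> Ob C" shows "hom_zero C X' A"
proof -
  obtain e' where e': "arr X X' e" "arr X' X e'" "e \<bullet> e' = Idm C X'" using assms by (metis isoE)
  have "w = nul X' A" if w: "arr X' A w" for w
    using assoc[OF e'(2,1) w] e'(3) idm_right[OF w] hom_zeroD[OF assms(2) arr_cmp[OF e'(1) w]]
      nul_cmp[OF e'(2) assms(3)] by simp
  then show ?thesis using hom_zero_iff[OF arr_cod[OF e'(1)] assms(3)] by blast
qed

lemma extension_closed_right_perp:
  assumes "P \<subseteq> Ob C" shows "extension_closed C (right_perp C P)"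
  unfolding extension_closed_def
proof (intro conjI)
  show "right_perp C P \<subseteq> Ob C" by (auto simp: right_perp_def)
  show "zeros \<subseteq> right_perp C P" using assms hom_zero_zero is_zero_ob by (auto simp: right_perp_def)
  show "iso_closed C (right_perp C P)"
    using assms hom_zero_iso_right unfolding iso_closed_def right_perp_def iso_def by blast
  show "star C (right_perp C P) (right_perp C P) \<subseteq> right_perp C P"
  proof
    fix E assume "E \<in> star C (right_perp C P) (right_perp C P)"
    then show "E \<in> right_perp C P"
      using assms hom_zero_ext_right tri_ob(2) by (elim starE) (simp add: right_perp_def, blast)
  qed
qed

lemma extension_closed_left_perp:
  assumes "P \<subseteq> Ob C" shows "extension_closed C (left_perp C P)"
  unfolding extension_closed_def
proof (intro conjI)
  show "left_perp C P \<subseteq> Ob C" by (auto simp: left_perp_def)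
  show "zeros \<subseteq> left_perp C P" using assms hom_zero_zero is_zero_ob by (auto simp: left_perp_def)
  show "iso_closed C (left_perp C P)"
    using assms hom_zero_iso_left unfolding iso_closed_def left_perp_def iso_def by blast
  show "star C (left_perp C P) (left_perp C P) \<subseteq> left_perp C P"
  proof
    fix E assume "E \<in> star C (left_perp C P) (left_perp C P)"
    then show "E \<in> left_perp C P"
      using assms hom_zero_ext_left tri_ob(2) by (elim starE) (simp add: left_perp_def, blast)
  qed
qed

lemma extension_closed_Int:
  "extension_closed C P \<Longrightarrow> extension_closed C Q \<Longrightarrow> extension_closed C (P \<inter> Q)"
  using star_mono[of "P \<inter> Q" P "P \<inter> Q" P] star_mono[of "P \<inter> Q" Q "P \<inter> Q" Q]
  unfolding extension_closed_def iso_closed_def by blast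

section \<open>Shifts by integers\<close>

lemma shift_0: "shift C 0 X = X"
  by (simp add: shift_def)

lemma inv_sh: assumes "X \<in> Ob C"
  shows "the_inv_into (Ob C) (Sh C) X \<in> Ob C" "Sh C (the_inv_into (Ob C) (Sh C) X) = X"
  using assms sh_bij the_inv_into_into[of "Sh C" "Ob C" X "Ob C"] f_the_inv_into_f[of "Sh C" "Ob C" X]
  by (auto simp: bij_betw_def)

lemma shift_ob: "X \<in> Ob C \<Longrightarrow> shift C i X \<in> Ob C"
proof -
  assume X: "X \<in> Ob C"
  have "(Sh C ^^ n) X \<in> Ob C" for n by (induction n) (use X sh_ob in auto)
  moreover have "(the_inv_into (Ob C) (Sh C) ^^ n) X \<in> Ob C" for n by (induction n) (use X inv_sh in auto)
  ultimately show ?thesis by (simp add: shift_def)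
qed

lemma shift_Suc: assumes "X \<in> Ob C" shows "shift C (i + 1) X = Sh C (shift C i X)"
proof (cases "0 \<le> i")
  case True
  then show ?thesis by (simp add: shift_def nat_add_distrib)
next
  case False
  let ?v = "the_inv_into (Ob C) (Sh C)"
  have "nat (- i) = Suc (nat (- (i + 1)))" using False by simp
  \<comment> \<open>For i = -1 the shift by i + 1 falls into the other branch of the definition of
    \<open>shift\<close>, hence the case distinction.\<close>
  then have "shift C i X = ?v (shift C (i + 1) X)"
    using False by (cases "i = - 1") (auto simp: shift_def)
  then show ?thesis using inv_sh shift_ob[OF assms] by simp
qed

lemma shift_shift: assumes "X \<in> Ob C" shows "shift C i (shift C j X) = shift C (i + j) X"
proof (induction i rule: int_induct[of _ 0])
  case base then show ?case by (simp add: shift_0)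
next
  case (step1 i)
  then show ?case
    using shift_Suc[OF shift_ob[OF assms], of i j] shift_Suc[OF assms, of "i + j"]
    by (simp add: add.commute add.left_commute)
next
  case (step2 i)
  have "Sh C (shift C (i - 1) (shift C j X)) = Sh C (shift C (i - 1 + j) X)"
    using step2(2) shift_Suc[OF shift_ob[OF assms], of "i - 1" j] shift_Suc[OF assms, of "i - 1 + j"]
    by (simp add: algebra_simps)
  then show ?case using sh_inj shift_ob assms by blast
qed

lemma shift_1: "X \<in> Ob C \<Longrightarrow> shift C 1 X = Sh C X"
  using shift_Suc[of X 0] by (simp add: shift_0)

text \<open>Two places serve Hom-vanishing and the Schur dichotomy alike; a property of one object
  is passed as a predicate that ignores its second argument.\<close>

lemma shift_invariant:
  assumes "\<And>X Y. X \<in> Ob C \<Longrightarrow> Y \<in> Ob C \<Longrightarrow> Q (Sh C X) (Sh C Y) \<longleftrightarrow> Q X Y"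
    and "X \<in> Ob C" "Y \<in> Ob C"
  shows "Q (shift C i X) (shift C i Y) \<longleftrightarrow> Q X Y"
proof (induction i rule: int_induct[of _ 0])
  case base then show ?case by (simp add: shift_0)
next
  case (step1 i)
  then show ?case using assms shift_Suc shift_ob by simp
next
  case (step2 i)
  then show ?case
    using assms shift_Suc[OF assms(2), of "i - 1"] shift_Suc[OF assms(3), of "i - 1"] shift_ob by simp
qed

lemma shift_invariant2:
  assumes "\<And>X Y. X \<in> Ob C \<Longrightarrow> Y \<in> Ob C \<Longrightarrow> Q (Sh C X) (Sh C Y) \<longleftrightarrow> Q X Y"
    and "X \<in> Ob C" "Y \<in> Ob C"
  shows "Q (shift C i X) (shift C j Y) \<longleftrightarrow> Q X (shift C (j - i) Y)"
  using shift_invariant[of Q X "shift C (j - i) Y" i] assms shift_shift[OF assms(3), of i "j - i"] shift_ob[OF assms(3)]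
  by (simp add: assms(2))

lemma hom_zero_sh:
  assumes "X \<in> Ob C" "Y \<in> Ob C" shows "hom_zero C (Sh C X) (Sh C Y) \<longleftrightarrow> hom_zero C X Y"
proof -
  have "(\<forall>f. arr (Sh C X) (Sh C Y) f \<longrightarrow> f = nul (Sh C X) (Sh C Y)) \<longleftrightarrow> (\<forall>f. arr X Y f \<longrightarrow> f = nul X Y)"
    using shm_surj[OF _ assms] arr_shm shm_eq_nul by metis
  then show ?thesis using assms sh_ob by (simp add: hom_zero_iff)
qed

lemma hom_zero_shift:
  "X \<in> Ob C \<Longrightarrow> Y \<in> Ob C \<Longrightarrow> hom_zero C (shift C i X) (shift C i Y) \<longleftrightarrow> hom_zero C X Y"
  by (rule shift_invariant[where Q = "hom_zero C", OF hom_zero_sh])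

lemma hom_zero_shift2:
  "X \<in> Ob C \<Longrightarrow> Y \<in> Ob C \<Longrightarrow> hom_zero C (shift C i X) (shift C j Y) \<longleftrightarrow> hom_zero C X (shift C (j - i) Y)"
  by (rule shift_invariant2[where Q = "hom_zero C", OF hom_zero_sh])

lemma is_zero_shift: "X \<in> Ob C \<Longrightarrow> is_zero C (shift C i X) \<longleftrightarrow> is_zero C X"
  using shift_invariant[of "\<lambda>X Y. is_zero C X" X X i] is_zero_sh is_zero_shD by blast

text \<open>Three rotations shift all objects of a triangle by one but alter the signs of its maps,
  which is why only the existence of some maps is asserted. Backward rotations treat negative
  shifts.\<close>

lemma tri_shift:
  assumes "(X, Y, Z, f, g, h) \<in> Tri C"
  shows "\<exists>f g h. (shift C i X, shift C i Y, shift C i Z, f, g, h) \<in> Tri C"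
proof (induction i rule: int_induct[of _ 0])
  case base then show ?case using assms by (auto simp: shift_0)
next
  case (step1 i)
  then show ?case using tri_ob[OF assms] rot[OF rot[OF rot]] shift_Suc by metis
next
  case (step2 i)
  note o = tri_ob[OF assms]
  obtain f g h where t: "(Sh C (shift C (i - 1) X), Sh C (shift C (i - 1) Y), Sh C (shift C (i - 1) Z), f, g, h) \<in> Tri C"
    using step2 shift_Suc[of _ "i - 1"] o by auto
  have cancel: "V = shift C (i - 1) W" if "Sh C V = Sh C (shift C (i - 1) W)" "V \<in> Ob C" "W \<in> Ob C" for V W
    using that sh_inj shift_ob by metis
  obtain Z' f' where z: "Sh C Z' = Sh C (shift C (i - 1) Z)"
    "(Z', Sh C (shift C (i - 1) X), Sh C (shift C (i - 1) Y), f', f, g) \<in> Tri C"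
    using rot_back[OF t] by metis
  obtain Y' f'' where y: "Sh C Y' = Sh C (shift C (i - 1) Y)" "(Y', Z', Sh C (shift C (i - 1) X), f'', f', f) \<in> Tri C"
    using rot_back[OF z(2)] by metis
  obtain X' f3 where x: "Sh C X' = Sh C (shift C (i - 1) X)" "(X', Y', Z', f3, f'', f') \<in> Tri C"
    using rot_back[OF y(2)] by metis
  show ?case using x cancel[OF x(1)] cancel[OF y(1)] cancel[OF z(1)] tri_ob[OF x(2)] o by metis
qed

text \<open>A word is a list of pairs \<open>(i, X)\<close>, standing for \<open>X[i]\<close>; \<open>fil w\<close> consists of the iterated
  extensions \<open>X\<^sub>1[i\<^sub>1] * (X\<^sub>2[i\<^sub>2] * (\<dots> * 0))\<close>.\<close>

primrec fil :: "(int \<times> 'c) list \<Rightarrow> 'c set" where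
  "fil [] = zeros"
| "fil (x # w) = star C {shift C (fst x) (snd x)} (fil w)"

lemma fil_ob: "fil w \<subseteq> Ob C"
  using star_ob is_zero_ob by (cases w) auto

lemma fil_iso: "E \<in> fil w \<Longrightarrow> iso E E' e \<Longrightarrow> E' \<in> fil w"
  using star_iso is_zero_iso by (cases w) auto

lemma iso_closed_fil: "iso_closed C (fil w)"
  using iso_closedI[of "fil w"] fil_iso fil_ob by blast

lemma fil_append: "fil (w @ w') = star C (fil w) (fil w')"
  by (induction w) (simp_all add: star_zeros_left[OF iso_closed_fil fil_ob] star_assoc)

lemma fil_singleton:
  assumes "X \<in> Ob C" shows "shift C i X \<in> fil [(i, X)]"
proof -
  obtain N where "is_zero C N" by (rule zero_exists)
  then show ?thesis using star_mem[OF tri_idm[OF shift_ob[OF assms]]] by simp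
qed

lemma fil_singletonD:
  assumes "E \<in> fil [x]" obtains e where "iso (shift C (fst x) (snd x)) E e"
proof -
  obtain N f g h where "(shift C (fst x) (snd x), E, N, f, g, h) \<in> Tri C" "is_zero C N"
    using assms by (auto elim!: starE)
  then show ?thesis using iso_if_cone_zero that by blast
qed

text \<open>The recursion of \<open>fil\<close> peels off the first letter as the left end of a
  triangle; associativity of \<open>star\<close> allows peeling off the last letter as the right
  end.\<close>

lemma fil_snocE:
  assumes "E \<in> fil (w @ [x])"
  obtains W f g h where "(W, E, shift C (fst x) (snd x), f, g, h) \<in> Tri C" "W \<in> fil w"
proof -
  obtain W Y f g h where t: "(W, E, Y, f, g, h) \<in> Tri C" "W \<in> fil w" "Y \<in> fil [x]"
    using assms unfolding fil_append by (rule starE)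
  obtain e where "iso (shift C (fst x) (snd x)) Y e" using t(3) by (rule fil_singletonD)
  then obtain e' where "iso Y (shift C (fst x) (snd x)) e'" by (metis isoE)
  then show ?thesis using tri_change_right[OF t(1)] t(2) that by metis
qed

lemma fil_snoc:
  assumes "(W, E, shift C i X, f, g, h) \<in> Tri C" "W \<in> fil w" "X \<in> Ob C"
  shows "E \<in> fil (w @ [(i, X)])"
  unfolding fil_append using star_mem[OF assms(1,2) fil_singleton[OF assms(3)]] .

lemma fil_shift:
  assumes "E \<in> fil w" "snd ` set w \<subseteq> Ob C"
  shows "shift C i E \<in> fil (map (\<lambda>(j, X). (i + j, X)) w)"
  using assms
proof (induction w arbitrary: E)
  case Nil
  then show ?case using is_zero_shift is_zero_ob by auto
next
  case (Cons x w)
  obtain Y f g h where t: "(shift C (fst x) (snd x), E, Y, f, g, h) \<in> Tri C" "Y \<in> fil w"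
    using Cons.prems by (auto elim!: starE)
  obtain f g h where t': "(shift C i (shift C (fst x) (snd x)), shift C i E, shift C i Y, f, g, h) \<in> Tri C"
    using tri_shift[OF t(1)] by blast
  have "shift C i Y \<in> fil (map (\<lambda>(j, X). (i + j, X)) w)" using Cons t by simp
  then show ?case using t' Cons.prems(2) star_mem[OF t'] by (simp add: shift_shift case_prod_unfold)
qed

lemma hom_zero_fil_right:
  assumes "E \<in> fil w" "A \<in> Ob C" "\<And>j X. (j, X) \<in> set w \<Longrightarrow> hom_zero C A (shift C j X)"
  shows "hom_zero C A E"
  using assms
proof (induction w arbitrary: E)
  case Nil
  then show ?case using hom_zero_zero by auto
next
  case (Cons x w)
  then show ?case
    by (auto elim!: starE) (metis hom_zero_ext_right prod.collapse)
qed

lemma hom_zero_fil_left: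
  assumes "E \<in> fil w" "A \<in> Ob C" "\<And>j X. (j, X) \<in> set w \<Longrightarrow> hom_zero C (shift C j X) A"
  shows "hom_zero C E A"
  using assms
proof (induction w arbitrary: E)
  case Nil
  then show ?case using hom_zero_zero by auto
next
  case (Cons x w)
  then show ?case
    by (auto elim!: starE) (metis hom_zero_ext_left prod.collapse)
qed

lemma fil_mem:
  assumes "E \<in> fil w" "extension_closed C Q" "\<And>j X. (j, X) \<in> set w \<Longrightarrow> shift C j X \<in> Q"
  shows "E \<in> Q"
  using assms(1,3)
proof (induction w arbitrary: E)
  case Nil
  then show ?case using assms(2) by (auto simp: extension_closed_def)
next
  case (Cons x w)
  obtain Y f g h where t: "(shift C (fst x) (snd x), E, Y, f, g, h) \<in> Tri C" "Y \<in> fil w"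
    using Cons.prems by (auto elim!: starE)
  have "Y \<in> Q" "shift C (fst x) (snd x) \<in> Q" using Cons t by (auto simp: prod_eq_iff)
  then have "E \<in> star C Q Q" using star_mem[OF t(1)] by blast
  then show ?case using assms(2) by (auto simp: extension_closed_def)
qed

text \<open>The octahedron for f p, rewritten for cocones: enlarging Z to its extension E by X
  enlarges the cocone of the map to Y by the same X. This is the induction step of
  \<open>fil_cocone\<close>.\<close>

lemma cocone_comp:
  assumes t: "(Z, E, X, p, q, r) \<in> Tri C" and f: "arr E Y f"
    and w: "(W, Z, Y, a, f \<bullet> p, b) \<in> Tri C"
  obtains V l m u v z where "(V, E, Y, l, f, m) \<in> Tri C" "(W, V, X, u, v, z) \<in> Tri C"
proof -
  obtain V l m where v: "(V, E, Y, l, f, m) \<in> Tri C" using cone[OF f] rot_back by metis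
  obtain u v z where "(X, Sh C W, Sh C V, u, v, z) \<in> Tri C"
    using TR4[OF t rot[OF v] rot[OF w]] by blast
  then obtain V' x where V': "Sh C V' = Sh C V" "(V', X, Sh C W, x, u, v) \<in> Tri C" using rot_back by metis
  have "V' = V" using sh_inj V' tri_ob(1)[OF v] tri_ob(1)[OF V'(2)] by metis
  then obtain W' y where W': "Sh C W' = Sh C W" "(W', V, X, y, x, u) \<in> Tri C"
    using rot_back[OF V'(2)] by metis
  have "W' = W" using sh_inj W' tri_ob(1)[OF w] tri_ob(1)[OF W'(2)] by metis
  then show ?thesis using that[OF v] W' by blast
qed

text \<open>The dichotomy of Schur's lemma as a predicate on pairs of objects, so that
  \<open>shift_invariant\<close> carries it from S to the shifts of S.\<close>

definition zero_or_iso :: "'c \<Rightarrow> 'c \<Rightarrow> bool" where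
  "zero_or_iso X Y \<longleftrightarrow> (\<forall>f. arr X Y f \<longrightarrow> f = nul X Y \<or> iso X Y f)"

lemma zero_or_iso_sh:
  assumes "X \<in> Ob C" "Y \<in> Ob C" shows "zero_or_iso (Sh C X) (Sh C Y) \<longleftrightarrow> zero_or_iso X Y"
proof
  assume a: "zero_or_iso (Sh C X) (Sh C Y)"
  show "zero_or_iso X Y" unfolding zero_or_iso_def
  proof (intro allI impI)
    fix f assume f: "arr X Y f"
    then show "f = nul X Y \<or> iso X Y f"
      using a arr_shm[OF f] shm_eq_nul[OF f] iso_shmD[OF f] by (auto simp: zero_or_iso_def)
  qed
next
  assume a: "zero_or_iso X Y"
  show "zero_or_iso (Sh C X) (Sh C Y)" unfolding zero_or_iso_def
  proof (intro allI impI)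
    fix f assume "arr (Sh C X) (Sh C Y) f"
    then obtain f' where f': "arr X Y f'" "Shm C f' = f" using shm_surj assms by metis
    then show "f = nul (Sh C X) (Sh C Y) \<or> iso (Sh C X) (Sh C Y) f"
      using a iso_shm[of X Y f'] shm_nul[OF assms] by (auto simp: zero_or_iso_def)
  qed
qed

end


section \<open>Simple-minded collections\<close>

locale smc = triangulated_category K C
  for K :: "('k, 'r) ring_scheme" (structure) and C :: "('k, 'o, 'm) tricat" +
  fixes S :: "'o set"
  assumes smc: "simple_minded_collection K C S"
begin

section \<open>Schur's lemma for shifted simple objects\<close>

lemma S_ob: "X \<in> S \<Longrightarrow> X \<in> Ob C"
  using smc by (auto simp: simple_minded_collection_def)

lemma S_hom_zero: "X \<in> S \<Longrightarrow> Y \<in> S \<Longrightarrow> b < a \<Longrightarrow> hom_zero C (shift C a X) (shift C b Y)"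
  using smc by (simp add: simple_minded_collection_def hom_zero_shift2 S_ob)

lemma S_has_dim: "X \<in> S \<Longrightarrow> Y \<in> S \<Longrightarrow> has_dim K (Hom C X Y) (if X = Y then 1 else 0)"
  using smc unfolding simple_minded_collection_def by blast

lemma S_dim: "X \<in> S \<Longrightarrow> has_dim K (Hom C X X) 1"
  using S_has_dim[of X X] by simp

lemma S_dim_0: "X \<in> S \<Longrightarrow> Y \<in> S \<Longrightarrow> X \<noteq> Y \<Longrightarrow> has_dim K (Hom C X Y) 0"
  using S_has_dim[of X Y] by simp

lemma S_not_zero: "X \<in> S \<Longrightarrow> \<not> is_zero C (shift C i X)"
  using has_dim_1_not_zero[OF S_dim] is_zero_shift S_ob by blast

text \<open>For b < a there are only zero maps, and for a = b the dimension hypothesis applies.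
  Joining the cases suits a connecting map Y[j] -> X[i+1] with i < j, where i + 1 \<le> j is all
  that is known.\<close>

lemma S_zero_or_iso:
  assumes X: "X \<in> S" and Y: "Y \<in> S" and "b \<le> a" and f: "arr (shift C a X) (shift C b Y) f"
  shows "f = nul (shift C a X) (shift C b Y) \<or> iso (shift C a X) (shift C b Y) f"
proof (cases "b < a")
  case True
  then show ?thesis using S_hom_zero[OF X Y] hom_zeroD f by blast
next
  case False
  then have ab: "b = a" using assms by simp
  have "zero_or_iso X Y"
  proof (cases "X = Y")
    case True
    then show ?thesis using has_dim_1_iso[OF S_dim[OF X]] unfolding zero_or_iso_def by blast
  next
    case False
    then show ?thesis using has_dim_0_hom_zero[OF S_dim_0[OF X Y] S_ob[OF X] S_ob[OF Y]] hom_zeroD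
      unfolding zero_or_iso_def by blast
  qed
  then have "zero_or_iso (shift C a X) (shift C a Y)"
    using shift_invariant[where Q = zero_or_iso, OF zero_or_iso_sh] S_ob X Y by blast
  then show ?thesis using f ab unfolding zero_or_iso_def by blast
qed

section \<open>Sorting words\<close>

definition word :: "(int \<times> 'o) list \<Rightarrow> bool" where "word w \<longleftrightarrow> snd ` set w \<subseteq> S"

definition desc :: "(int \<times> 'o) list \<Rightarrow> bool" where "desc w \<longleftrightarrow> sorted_wrt (\<lambda>x y. fst y \<le> fst x) w"

text \<open>A zero connecting map makes \<open>g\<close> a retraction, with section
  \<open>s\<close>. The octahedron for g s = 1 identifies the cone of \<open>s\<close> with
  \<open>X\<close>, and the triangle on \<open>s\<close> is the required one.\<close>

lemma tri_split_swap:
  assumes t: "(X, E, Y, f, g, nul Y (Sh C X)) \<in> Tri C"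
  obtains f' g' h' where "(Y, E, X, f', g', h') \<in> Tri C"
proof -
  note o = tri_ob[OF t]
  have "nul Y (Sh C X) \<bullet> Idm C Y = nul Y (Sh C X)" using idm_right[OF o(6)] .
  then obtain s where s: "arr Y E s" "g \<bullet> s = Idm C Y" using tri_lift2[OF t arr_idm[OF o(3)]] by blast
  obtain W b c where w: "(Y, E, W, s, b, c) \<in> Tri C" using cone[OF s(1)] by blast
  obtain N where N: "is_zero C N" by (rule zero_exists)
  obtain u v z where uv: "(W, N, Sh C X, u, v, z) \<in> Tri C"
    using TR4[OF w rot[OF t]] tri_idm[OF o(3) N] s(2) by metis
  note ow = tri_ob[OF w] and ouv = tri_ob[OF uv]
  have "iso (Sh C X) (Sh C W) z" using iso_if_left_zero[OF rot[OF uv] N] .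
  then obtain z' where z': "iso (Sh C W) (Sh C X) z'" by (metis isoE)
  obtain z'' where "arr W X z''" "Shm C z'' = z'" using shm_surj[OF iso_arr[OF z']] ow o by blast
  then have "iso W X z''" using iso_shmD z' by blast
  then show ?thesis using tri_change_right[OF w] that by metis
qed

text \<open>If \<open>i < j\<close>, then the connecting morphism \<open>Y[j] \<rightarrow> X[i + 1]\<close> is zero or invertible: in the first
  case the two factors commute, in the second one they cancel.\<close>

lemma fil_swap:
  assumes E: "E \<in> fil (x # y # w)" and xy: "fst x < fst y" and S: "snd x \<in> S" "snd y \<in> S"
  shows "E \<in> fil (y # x # w) \<or> E \<in> fil w"
proof -
  let ?X = "shift C (fst x) (snd x)" and ?Y = "shift C (fst y) (snd y)"
  have "E \<in> star C (star C {?X} {?Y}) (fil w)" using E by (simp add: star_assoc)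
  then obtain B W f g h where t: "(B, E, W, f, g, h) \<in> Tri C" "B \<in> star C {?X} {?Y}" "W \<in> fil w" by (rule starE)
  then obtain f' g' h' where b: "(?X, B, ?Y, f', g', h') \<in> Tri C" by (auto elim!: starE)
  have X: "Sh C ?X = shift C (fst x + 1) (snd x)" using shift_Suc S_ob S by simp
  have "h' = nul ?Y (Sh C ?X) \<or> iso ?Y (Sh C ?X) h'"
    unfolding X using tri_ob(6)[OF b, unfolded X] xy S by (intro S_zero_or_iso) auto
  then show ?thesis
  proof
    assume "h' = nul ?Y (Sh C ?X)"
    then obtain f2 g2 h2 where "(?Y, B, ?X, f2, g2, h2) \<in> Tri C" using tri_split_swap b by metis
    then have "B \<in> star C {?Y} {?X}" by (rule star_mem) auto
    then have "E \<in> star C (star C {?Y} {?X}) (fil w)" using star_mem[OF t(1)] t by blast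
    then show ?thesis by (simp add: star_assoc)
  next
    assume "iso ?Y (Sh C ?X) h'"
    then have "is_zero C B" using zero_if_connecting_iso[OF b] by blast
    then have "iso E W g" using iso_if_left_zero[OF t(1)] by blast
    then show ?thesis using fil_iso[OF t(3)] by (metis isoE)
  qed
qed

text \<open>One round of insertion sort: \<open>x\<close> moves right past letters of larger shift,
  and if it cancels against such a letter, the remaining tail is already sorted. The length bound is
  recorded for the induction in \<open>fil_retract\<close>.\<close>

lemma fil_insert:
  assumes "E \<in> fil (x # w)" "word (x # w)" "desc w"
  shows "\<exists>w'. E \<in> fil w' \<and> desc w' \<and> set w' \<subseteq> insert x (set w) \<and> length w' \<le> Suc (length w)"
  using assms
proof (induction w arbitrary: E)
  case Nil
  then show ?case by (intro exI[of _ "[x]"]) (auto simp: desc_def)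
next
  case (Cons y w)
  show ?case
  proof (cases "fst y \<le> fst x")
    case True
    then show ?thesis using Cons.prems by (intro exI[of _ "x # y # w"]) (auto simp: desc_def)
  next
    case False
    consider "E \<in> fil (y # x # w)" | "E \<in> fil w"
      using fil_swap[OF Cons.prems(1)] False Cons.prems(2) by (auto simp: word_def)
    then show ?thesis
    proof cases
      case 1
      then obtain F f g h where t: "(shift C (fst y) (snd y), E, F, f, g, h) \<in> Tri C" "F \<in> fil (x # w)"
        by (auto elim!: starE[of E "{shift C (fst y) (snd y)}"])
      obtain w' where w': "F \<in> fil w'" "desc w'" "set w' \<subseteq> insert x (set w)" "length w' \<le> Suc (length w)"
        using Cons.IH[OF t(2)] Cons.prems by (auto simp: word_def desc_def)
      have "E \<in> fil (y # w')" using star_mem[OF t(1) _ w'(1)] by simp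
      moreover have "desc (y # w')" using w' Cons.prems(3) False by (auto simp: desc_def)
      ultimately show ?thesis using w' by (intro exI[of _ "y # w'"]) auto
    next
      case 2
      then show ?thesis using Cons.prems by (intro exI[of _ w]) (auto simp: desc_def)
    qed
  qed
qed

lemma fil_sort:
  assumes "E \<in> fil w" "word w"
  shows "\<exists>w'. E \<in> fil w' \<and> desc w' \<and> set w' \<subseteq> set w \<and> length w' \<le> length w"
  using assms
proof (induction w arbitrary: E)
  case Nil
  then show ?case by (auto simp: desc_def)
next
  case (Cons x w)
  then obtain F f g h where t: "(shift C (fst x) (snd x), E, F, f, g, h) \<in> Tri C" "F \<in> fil w"
    by (auto elim!: starE)
  then obtain w1 where w1: "F \<in> fil w1" "desc w1" "set w1 \<subseteq> set w" "length w1 \<le> length w"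
    using Cons by (force simp: word_def)
  have "E \<in> fil (x # w1)" using star_mem[OF t(1) _ w1(1)] by simp
  then obtain w2 where "E \<in> fil w2" "desc w2" "set w2 \<subseteq> insert x (set w1)" "length w2 \<le> Suc (length w1)"
    using fil_insert[of E x w1] w1 Cons.prems by (force simp: word_def)
  then show ?case using w1 by (intro exI[of _ w2]) auto
qed

text \<open>Peel off the last letter X from Z -> E -> X. If f vanishes on Z, it factors through X by
  a nonzero map, which Schur's lemma makes invertible because m is the lowest shift; then Z is the
  cocone. Otherwise the letter is deleted inside Z and X is put back by
  \<open>cocone_comp\<close>.\<close>

lemma fil_cocone:
  assumes "E \<in> fil w" "word w" "\<forall>x \<in> set w. m \<le> fst x" "Y \<in> S"
    and "arr E (shift C m Y) f" "f \<noteq> nul E (shift C m Y)"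
  shows "\<exists>W w' a b. (W, E, shift C m Y, a, f, b) \<in> Tri C \<and> W \<in> fil w' \<and> set w' \<subseteq> set w \<and>
    length w = Suc (length w')"
  using assms
proof (induction w arbitrary: E f rule: rev_induct)
  case Nil
  then show ?case using from_zero by auto
next
  case (snoc x w)
  let ?Y = "shift C m Y" and ?X = "shift C (fst x) (snd x)"
  obtain Z p q r where t: "(Z, E, ?X, p, q, r) \<in> Tri C" "Z \<in> fil w" using snoc.prems(1) by (rule fil_snocE)
  note o = tri_ob[OF t(1)]
  obtain W a b where w: "(W, E, ?Y, a, f, b) \<in> Tri C"
    using cone[OF snoc.prems(5)] rot_back by metis
  note ow = tri_ob[OF w]
  show ?case
  proof (cases "f \<bullet> p = nul Z ?Y")
    case True
    then obtain e where e: "arr ?X ?Y e" "e \<bullet> q = f" using tri_ext[OF t(1) snoc.prems(5)] by blast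
    have "e \<noteq> nul ?X ?Y" using e snoc.prems(6) nul_cmp[OF o(5)] ow by auto
    then have "iso ?X ?Y e"
      using S_zero_or_iso[OF _ snoc.prems(4) _ e(1)] snoc.prems by (auto simp: word_def)
    then obtain e' where e': "arr ?Y ?X e'" "e \<bullet> e' = Idm C ?Y" "e' \<bullet> e = Idm C ?X" "iso ?Y ?X e'" by (metis isoE)
    have i: "Idm C E \<bullet> p = p" "f = e \<bullet> q" using e idm_left[OF o(4)] by auto
    have tf: "(Z, E, ?Y, p, f, r \<bullet> e') \<in> Tri C"
    proof (rule tri_iso[OF t(1) o(4) snoc.prems(5) arr_cmp[OF e'(1) o(6)]])
      show "iso Z Z (Idm C Z)" "iso E E (Idm C E)" "iso ?X ?Y e" using o \<open>iso ?X ?Y e\<close> by (auto simp: iso_idm)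
      show "Idm C E \<bullet> p = p \<bullet> Idm C Z" using idm_left[OF o(4)] idm_right[OF o(4)] by simp
      show "e \<bullet> q = f \<bullet> Idm C E" using e idm_right[OF snoc.prems(5)] by simp
      show "Shm C (Idm C Z) \<bullet> r = (r \<bullet> e') \<bullet> e"
        using shm_idm[OF o(1)] idm_left[OF o(6)] idm_right[OF o(6)] assoc[OF e(1) e'(1) o(6)] e'(3) by simp
    qed
    show ?thesis using tf t(2) by (intro exI[of _ Z] exI[of _ w] exI[of _ p] exI[of _ "r \<bullet> e'"]) auto
  next
    case False
    obtain W' w' a' b' where w': "(W', Z, ?Y, a', f \<bullet> p, b') \<in> Tri C" "W' \<in> fil w'" "set w' \<subseteq> set w"
      "length w = Suc (length w')"
      using snoc.IH[OF t(2) _ _ snoc.prems(4) arr_cmp[OF o(4) snoc.prems(5)] False] snoc.prems(2,3)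
      by (auto simp: word_def)
    obtain W2 l m' u v z where w2: "(W2, E, ?Y, l, f, m') \<in> Tri C" "(W', W2, ?X, u, v, z) \<in> Tri C"
      using cocone_comp[OF t(1) snoc.prems(5) w'(1)] by blast
    have "snd x \<in> Ob C" using S_ob snoc.prems(2) by (simp add: word_def)
    then have "W2 \<in> fil (w' @ [x])" using fil_snoc[OF w2(2) w'(2)] by simp
    then show ?thesis using w2(1) w' by (intro exI[of _ W2] exI[of _ "w' @ [x]"] exI[of _ l] exI[of _ m']) auto
  qed
qed

section \<open>Direct summands of filtered objects\<close>

lemma desc_append:
  "desc (w @ w') \<longleftrightarrow> desc w \<and> desc w' \<and> (\<forall>x\<in>set w. \<forall>y\<in>set w'. fst y \<le> fst x)"
  by (simp add: desc_def sorted_wrt_append)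

text \<open>For \<open>q : E \<rightarrow> Y[m]\<close> the projection onto the last factor, either \<open>q i = 0\<close> and \<open>X\<close> is a retract of
  the shorter extension below, or \<open>q i r \<noteq> 0\<close> and the cocone of \<open>q i\<close> is a retract of the cocone of
  \<open>q i r\<close>, which is again a shorter extension.\<close>

lemma fil_retract:
  assumes "E \<in> fil w" "word w" "arr X E i" "arr E X r" "r \<bullet> i = Idm C X"
  shows "\<exists>w'. X \<in> fil w' \<and> word w'"
  using assms
proof (induction "length w" arbitrary: w E X i r rule: less_induct)
  case less
  note i = less.prems(3) and r = less.prems(4) and ri = less.prems(5)
  obtain w1 where w1: "E \<in> fil w1" "desc w1" "set w1 \<subseteq> set w" "length w1 \<le> length w"
    using fil_sort less.prems by blast
  have word1: "word w1" using w1 less.prems by (auto simp: word_def)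
  show ?case
  proof (cases w1 rule: rev_cases)
    case Nil
    then have "X \<in> fil []" using w1 retract_zero[OF i r ri] by simp
    then show ?thesis by (intro exI[of _ "[]"]) (simp add: word_def)
  next
    case (snoc w2 y)
    define m Y where mY: "m = fst y" "Y = snd y"
    let ?L = "shift C m Y"
    have Y: "Y \<in> S" and word2: "word w2" using word1 snoc by (auto simp: word_def mY)
    have len: "length w2 < length w" using w1 snoc by simp
    \<comment> \<open>The last letter of a decreasing word has the lowest shift, which is the
      situation of \<open>fil_cocone\<close>. Sorting has not lengthened the word, so the induction
      measure is intact.\<close>
    have min: "\<forall>x\<in>set w1. m \<le> fst x" using w1(2) snoc by (auto simp: desc_append mY)
    obtain Z p q s where t: "(Z, E, ?L, p, q, s) \<in> Tri C" "Z \<in> fil w2"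
      using w1(1) unfolding snoc mY by (rule fil_snocE)
    note o = tri_ob[OF t(1)]
    let ?g = "q \<bullet> i"
    have g: "arr X ?L ?g" using arr_cmp[OF i o(5)] .
    show ?thesis
    proof (cases "?g = nul X ?L")
      case True
      then obtain j where j: "arr X Z j" "p \<bullet> j = i" using tri_lift[OF t(1) i] by blast
      have "(r \<bullet> p) \<bullet> j = Idm C X" using assoc[OF j(1) o(4) r] j ri by simp
      then show ?thesis using less.hyps[OF len t(2) word2 j(1) arr_cmp[OF o(4) r]] by blast
    next
      case False
      let ?f = "?g \<bullet> r"
      have f: "arr E ?L ?f" using arr_cmp[OF r g] .
      have fi: "?f \<bullet> i = ?g" using assoc[OF i r g] ri idm_right[OF g] by simp
      then have "?f \<noteq> nul E ?L" using False nul_cmp[OF i o(3)] by auto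
      then obtain W w' a b where W: "(W, E, ?L, a, ?f, b) \<in> Tri C" "W \<in> fil w'" "set w' \<subseteq> set w1"
        "length w1 = Suc (length w')"
        using fil_cocone[OF w1(1) word1 min Y f] by metis
      obtain X' a' b' where X': "(X', X, ?L, a', ?g, b') \<in> Tri C" using cone[OF g] rot_back by metis
      note oW = tri_ob[OF W(1)] and oX = tri_ob[OF X']
      note iL = arr_idm[OF o(3)]
      obtain j where j: "arr X' W j" "i \<bullet> a' = a \<bullet> j" "Shm C j \<bullet> b' = b \<bullet> Idm C ?L"
        using tri_map'[OF X' W(1) i iL] fi idm_left[OF g] by auto
      obtain k where k: "arr W X' k" "r \<bullet> a = a' \<bullet> k" "Shm C k \<bullet> b = b' \<bullet> Idm C ?L"
        using tri_map'[OF W(1) X' r iL] idm_left[OF f] by auto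
      \<comment> \<open>The comparison maps \<open>j\<close> and \<open>k\<close> come from
        non-unique completions, so \<open>k j\<close> need not be the identity of \<open>X'\<close>.
        It is compatible with the neighbouring maps \<open>b''\<close> and \<open>a'\<close>, hence
        invertible by \<open>tri_endo_iso\<close>, and composing \<open>k\<close> with its inverse
        yields a genuine retraction of \<open>j\<close>.\<close>
      let ?e = "k \<bullet> j"
      have e: "arr X' X' ?e" using arr_cmp[OF j(1) k(1)] .
      have "a' \<bullet> ?e = r \<bullet> i \<bullet> a'"
        using assoc[OF j(1) k(1) oX(4)] k(2) assoc[OF j(1) oW(4) r] j(2) by simp
      then have ae: "a' \<bullet> ?e = a'" using assoc[OF oX(4) i r] ri idm_left[OF oX(4)] by simp
      have be: "Shm C ?e \<bullet> b' = b'"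
        using shm_comp[OF j(1) k(1)] assoc[OF oX(6) arr_shm[OF j(1)] arr_shm[OF k(1)]] j(3) k(3)
          idm_right[OF oW(6)] idm_right[OF oX(6)] by simp
      obtain L' b'' where L': "(L', X', X, b'', a', ?g) \<in> Tri C" "b' = neg ?L (Sh C X') (Shm C b'')" "Sh C L' = ?L"
        using rot_back[OF X'] by metis
      note oL = tri_ob[OF L'(1)]
      have b'': "arr ?L (Sh C X') (Shm C b'')" using arr_shm[OF oL(4)] L'(3) by simp
      have "neg ?L (Sh C X') (Shm C (?e \<bullet> b'')) = neg ?L (Sh C X') (Shm C b'')"
        using be shm_comp[OF oL(4) e] cmp_neg[OF b'' arr_shm[OF e]] L'(2) by simp
      then have "Shm C (?e \<bullet> b'') = Shm C b''"
        using neg_inj[OF _ b''] arr_shm[OF arr_cmp[OF oL(4) e]] L'(3) by simp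
      then have eb: "?e \<bullet> b'' = b''" using shm_inj[OF arr_cmp[OF oL(4) e] oL(4)] by blast
      have "iso X' X' ?e" using tri_endo_iso[OF L'(1) e eb ae] .
      then obtain e' where e': "arr X' X' e'" "e' \<bullet> ?e = Idm C X'" by (metis isoE)
      have ret: "(e' \<bullet> k) \<bullet> j = Idm C X'" using assoc[OF j(1) k(1) e'(1)] e' by simp
      have "length w' < length w" "word w'" using W snoc len word1 by (auto simp: word_def)
      then obtain w3 where w3: "X' \<in> fil w3" "word w3"
        using less.hyps[OF _ W(2) _ j(1) arr_cmp[OF k(1) e'(1)] ret] by blast
      have "X \<in> fil (w3 @ [(m, Y)])" using fil_snoc[OF X' w3(1) S_ob[OF Y]] .
      moreover have "word (w3 @ [(m, Y)])" using w3 Y by (simp add: word_def)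
      ultimately show ?thesis by blast
    qed
  qed
qed

text \<open>The filtered objects form a thick subcategory containing S, so they exhaust the
  category. The cone Z of X -> Y is an extension of X[1] by Y, hence concatenating words suffices
  for cones; \<open>fil_retract\<close> takes care of summands.\<close>

lemma S_words:
  assumes "X \<in> Ob C" shows "\<exists>w. X \<in> fil w \<and> word w"
proof -
  define U where "U = {X. \<exists>w. X \<in> fil w \<and> word w}"
  have shU: "shift C i X \<in> U" if X: "X \<in> U" for X i
  proof -
    obtain w where w: "X \<in> fil w" "word w" using X by (auto simp: U_def)
    have "snd ` set w \<subseteq> Ob C" using w S_ob by (auto simp: word_def)
    then have "shift C i X \<in> fil (map (\<lambda>(j, X). (i + j, X)) w)" using fil_shift w by blast
    moreover have "word (map (\<lambda>(j, X). (i + j, X)) w)" using w by (auto simp: word_def)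
    ultimately show ?thesis by (auto simp: U_def)
  qed
  have "thick C U"
    unfolding thick_def
  proof (intro conjI)
    show "U \<subseteq> Ob C" using fil_ob by (auto simp: U_def)
    then show "iso_closed C U" by (rule iso_closedI[rotated]) (use fil_iso in \<open>unfold U_def, blast\<close>)
    have "word []" by (simp add: word_def)
    then show "zeros \<subseteq> U" unfolding U_def using fil.simps(1) by blast
    show "\<forall>X\<in>Ob C. (Sh C X \<in> U) = (X \<in> U)"
    proof
      fix X assume X: "X \<in> Ob C"
      have "shift C (- 1) (Sh C X) = X" using shift_shift[OF X, of "- 1" 1] shift_1[OF X] shift_0 by simp
      then show "(Sh C X \<in> U) = (X \<in> U)" using shU[of X 1] shU[of "Sh C X" "- 1"] shift_1[OF X] by auto
    qed
    show "\<forall>X Y Z f g h. (X, Y, Z, f, g, h) \<in> Tri C \<longrightarrow> X \<in> U \<longrightarrow> Y \<in> U \<longrightarrow> Z \<in> U"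
    proof (intro allI impI)
      fix X Y Z f g h assume t: "(X, Y, Z, f, g, h) \<in> Tri C" and X: "X \<in> U" and Y: "Y \<in> U"
      have "Sh C X \<in> U" using shU[OF X, of 1] shift_1 tri_ob(1)[OF t] by simp
      then obtain w v where "Y \<in> fil w" "word w" "Sh C X \<in> fil v" "word v" using Y by (auto simp: U_def)
      moreover from this have "Z \<in> fil (w @ v)" unfolding fil_append using star_mem[OF rot[OF t]] by blast
      moreover from calculation have "word (w @ v)" by (simp add: word_def image_Un)
      ultimately show "Z \<in> U" unfolding U_def by blast
    qed
    show "summand_closed C U"
      unfolding summand_closed_def
    proof (intro allI impI)
      fix n A Z i assume s: "is_dsum C n A Z" and Z: "Z \<in> U" and i: "i < n"
      have ob: "Z \<in> Ob C" "A i \<in> Ob C" using s i by (auto simp: is_dsum_def)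
      from s obtain \<iota> \<pi> where
        m: "\<forall>i<n. \<iota> i \<in> carrier (Hom C (A i) Z) \<and> \<pi> i \<in> carrier (Hom C Z (A i))"
        and c: "\<forall>i<n. \<forall>j<n. \<pi> j \<bullet> \<iota> i = (if i = j then Idm C (A i) else nul (A i) (A j))"
        unfolding is_dsum_def by blast
      have "arr (A i) Z (\<iota> i)" "arr Z (A i) (\<pi> i)" "\<pi> i \<bullet> \<iota> i = Idm C (A i)"
        using ob m c i by (auto simp: arr_def)
      then show "A i \<in> U" using Z fil_retract unfolding U_def by blast
    qed
  qed
  moreover have "S \<subseteq> U"
  proof
    fix X assume X: "X \<in> S"
    have "X \<in> fil [(0, X)]" using fil_singleton[OF S_ob[OF X], of 0] by (simp add: shift_0)
    moreover have "word [(0, X)]" using X by (simp add: word_def)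
    ultimately show "X \<in> U" unfolding U_def by blast
  qed
  ultimately have "thick_closure C S \<subseteq> U" by (auto simp: thick_closure_def)
  then show ?thesis using assms smc by (auto simp: simple_minded_collection_def U_def)
qed

text \<open>If the map from the first factor L to E vanished, the identity of L[1] would lift along
  the connecting map to the rest Y. All letters of Y have shift at most i, so Hom(L[1], Y) = 0 and L
  would be zero.\<close>

lemma fil_head_bound:
  assumes E: "E \<in> fil ((i, X) # w)" and w: "word ((i, X) # w)" "desc ((i, X) # w)"
  shows "\<not> hom_zero C (shift C i X) E"
proof
  assume z: "hom_zero C (shift C i X) E"
  let ?L = "shift C i X"
  obtain Y f g h where t: "(?L, E, Y, f, g, h) \<in> Tri C" "Y \<in> fil w" using E by (auto elim!: starE)
  note o = tri_ob[OF t(1)]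
  have X: "X \<in> S" using w by (simp add: word_def)
  note L = sh_ob[OF o(1)]
  have "f = nul ?L E" using hom_zeroD[OF z o(4)] .
  then have "neg (Sh C ?L) (Sh C E) (Shm C f) \<bullet> Idm C (Sh C ?L) = nul (Sh C ?L) (Sh C E)"
    using shm_nul[OF o(1,2)] neg_nul[OF L sh_ob[OF o(2)]] idm_right[OF arr_nul[OF L sh_ob[OF o(2)]]] by simp
  then obtain a where a: "arr (Sh C ?L) Y a" "h \<bullet> a = Idm C (Sh C ?L)"
    using tri_lift2[OF rot[OF t(1)] arr_idm[OF L]] by blast
  have "hom_zero C (shift C (i + 1) X) Y"
    using w by (intro hom_zero_fil_right[OF t(2) shift_ob[OF S_ob[OF X]]] S_hom_zero[OF X])
      (force simp: word_def desc_def)+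
  then have "a = nul (Sh C ?L) Y" using hom_zeroD[of "Sh C ?L" Y a] a shift_Suc[OF S_ob[OF X]] by simp
  then have "is_zero C (Sh C ?L)" using a cmp_nul[OF o(6) L] L by (simp add: is_zero_def)
  then show False using S_not_zero[OF X] is_zero_shD o(1) by blast
qed

text \<open>Dually, if the map from E to the last factor L vanished, the identity of L would factor
  through Z[1], whose letters all have shift greater than i.\<close>

lemma fil_last_bound:
  assumes E: "E \<in> fil (w @ [(i, X)])" and w: "word (w @ [(i, X)])" "desc (w @ [(i, X)])"
  shows "\<not> hom_zero C E (shift C i X)"
proof
  assume z: "hom_zero C E (shift C i X)"
  let ?L = "shift C i X"
  obtain Z f g h where t: "(Z, E, ?L, f, g, h) \<in> Tri C" "Z \<in> fil w" using E fil_snocE by (metis fst_conv snd_conv)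
  note o = tri_ob[OF t(1)]
  have X: "X \<in> S" using w by (simp add: word_def)
  have "g = nul E ?L" using hom_zeroD[OF z o(5)] .
  then have "Idm C ?L \<bullet> g = nul E ?L" using idm_left[OF o(5)] by simp
  then obtain a where a: "arr (Sh C Z) ?L a" "a \<bullet> h = Idm C ?L"
    using tri_ext2[OF t(1) arr_idm[OF o(3)]] by blast
  have "snd ` set w \<subseteq> Ob C" using w S_ob by (auto simp: word_def)
  then have "Sh C Z \<in> fil (map (\<lambda>(j, X). (1 + j, X)) w)" using fil_shift[OF t(2), of 1] shift_1[OF o(1)] by simp
  then have "hom_zero C (Sh C Z) ?L"
  proof (rule hom_zero_fil_left[OF _ o(3)])
    fix j Y assume "(j, Y) \<in> set (map (\<lambda>(j, X). (1 + j, X)) w)"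
    then have "(j - 1, Y) \<in> set w" by auto
    then have "i < j" "Y \<in> S" using w by (auto simp: word_def desc_append)
    then show "hom_zero C (shift C j Y) ?L" using S_hom_zero X by blast
  qed
  then have "a = nul (Sh C Z) ?L" using a(1) by (rule hom_zeroD)
  then have "is_zero C ?L" using a nul_cmp[OF o(6) o(3)] o by (simp add: is_zero_def)
  then show False using S_not_zero[OF X] by blast
qed

text \<open>In a decreasing word only the ends have to be bounded: orthogonality on the right
  controls the first letter, orthogonality on the left the last.\<close>

lemma words_in_range:
  assumes "X \<in> left_perp C (shifts C S {..<0})" "X \<in> right_perp C (shifts C S {int n<..})"
  obtains w where "X \<in> fil w" "word w" "desc w" "fst ` set w \<subseteq> {0..int n}"
proof -
  have lo: "hom_zero C X (shift C i Y)" if "i < 0" "Y \<in> S" for i Y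
    using assms(1) that by (auto simp: left_perp_def shifts_def)
  have hi: "hom_zero C (shift C i Y) X" if "int n < i" "Y \<in> S" for i Y
    using assms(2) that by (auto simp: right_perp_def shifts_def)
  obtain w0 where "X \<in> fil w0" "word w0" using S_words assms(1) by (auto simp: left_perp_def)
  then obtain w where w: "X \<in> fil w" "word w" "desc w"
    using fil_sort[of X w0] by (auto simp: word_def)
  have "i \<le> int n" if "(i, Y) \<in> set w" for i Y
  proof (cases w)
    case (Cons x v)
    then have "fst x \<le> int n"
      using fil_head_bound[of X "fst x" "snd x" v] hi[of "fst x" "snd x"] w by (force simp: word_def)
    then show ?thesis using that Cons w(3) by (auto simp: desc_def)
  qed (use that in simp)
  moreover have "0 \<le> i" if "(i, Y) \<in> set w" for i Y
  proof (cases w rule: rev_cases)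
    case (snoc v x)
    then have "0 \<le> fst x"
      using fil_last_bound[of X v "fst x" "snd x"] lo[of "fst x" "snd x"] w by (force simp: word_def)
    then show ?thesis using that snoc w(3) by (auto simp: desc_append)
  qed (use that in simp)
  ultimately show ?thesis using that w by fastforce
qed

section \<open>The product of the shifted extension closures\<close>

lemma fil_Filt:
  assumes "X \<in> fil w" "word w" "fst ` set w \<subseteq> {0}" shows "X \<in> Filt C S"
  unfolding Filt_def
proof (intro InterI, elim CollectE conjE)
  fix Q assume Q: "extension_closed C Q" "S \<subseteq> Q"
  show "X \<in> Q" using assms(2,3) Q by (intro fil_mem[OF assms(1) Q(1)]) (force simp: word_def shift_0)
qed

lemma fil_star_chain:
  assumes "X \<in> fil w" "word w" "desc w" "fst ` set w \<subseteq> {0..int n}"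
  shows "X \<in> star_chain C (Filt C S) n"
  using assms
proof (induction n arbitrary: X w)
  case 0
  then show ?case using fil_Filt[of X w] by simp
next
  case (Suc n)
  let ?m = "int (Suc n)"
  let ?P = "\<lambda>x. fst x = ?m"
  \<comment> \<open>In a decreasing word bounded by n + 1 the letters of shift n + 1 form an initial
    segment, so \<open>takeWhile\<close> collects all of them.\<close>
  define u v where uv: "u = takeWhile ?P w" "v = dropWhile ?P w"
  have w: "w = u @ v" by (simp add: uv)
  have u: "fst x = ?m" if "x \<in> set u" for x using that set_takeWhileD unfolding uv by fast
  have v: "fst x \<le> int n" if x: "x \<in> set v" for x
  proof (cases v)
    case (Cons y v')
    then have "fst y \<noteq> ?m" using hd_dropWhile[of ?P w] uv by auto
    moreover have "fst y \<in> {0..?m}" using Suc.prems(4) w Cons by auto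
    ultimately have "fst y \<le> int n" by simp
    then show ?thesis using x Cons Suc.prems(3) w by (auto simp: desc_append) (auto simp: desc_def)
  qed (use x in simp)
  obtain A B f g h where t: "(A, X, B, f, g, h) \<in> Tri C" "A \<in> fil u" "B \<in> fil v"
    using Suc.prems(1) unfolding w fil_append by (rule starE)
  have "fst ` set v \<subseteq> {0..int n}" using v Suc.prems(4) w by auto
  then have B: "B \<in> star_chain C (Filt C S) n"
    using Suc.IH[OF t(3)] Suc.prems w by (auto simp: word_def desc_append)
  have "snd ` set u \<subseteq> Ob C" using Suc.prems(2) w S_ob by (auto simp: word_def)
  then have "shift C (- ?m) A \<in> fil (map (\<lambda>(j, X). (- ?m + j, X)) u)" using fil_shift[OF t(2)] by blast
  then have "shift C (- ?m) A \<in> Filt C S"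
    by (rule fil_Filt) (use Suc.prems(2) w u in \<open>force simp: word_def\<close>)+
  moreover have "A = shift C ?m (shift C (- ?m) A)" using shift_shift[OF tri_ob(1)[OF t(1)], of ?m "- ?m"] by (simp add: shift_0)
  ultimately have "A \<in> shifts C (Filt C S) {?m}" unfolding shifts_def by blast
  then show ?case using star_mem[OF t(1)] B by simp
qed

lemma shifts_ob: "P \<subseteq> Ob C \<Longrightarrow> shifts C P I \<subseteq> Ob C"
  using shift_ob by (auto simp: shifts_def)

lemma S_shifts_ob: "shifts C S I \<subseteq> Ob C"
  using shifts_ob S_ob by blast

lemma mem_left_perp_shifts:
  "X \<in> left_perp C (shifts C P I) \<longleftrightarrow> X \<in> Ob C \<and> (\<forall>i\<in>I. \<forall>Y\<in>P. hom_zero C X (shift C i Y))"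
  by (auto simp: left_perp_def shifts_def)

lemma mem_right_perp_shifts:
  "X \<in> right_perp C (shifts C P I) \<longleftrightarrow> X \<in> Ob C \<and> (\<forall>i\<in>I. \<forall>Y\<in>P. hom_zero C (shift C i Y) X)"
  by (auto simp: right_perp_def shifts_def)

lemma Filt_subset_perps:
  "Filt C S \<subseteq> left_perp C (shifts C S {..<0}) \<inter> right_perp C (shifts C S {0<..})"
proof -
  have "S \<subseteq> left_perp C (shifts C S {..<0}) \<inter> right_perp C (shifts C S {0<..})"
    using S_hom_zero[of _ _ _ 0] S_hom_zero[of _ _ 0] S_ob
    by (auto simp: left_perp_def right_perp_def shifts_def shift_0)
  then show ?thesis
    using extension_closed_Int[OF extension_closed_left_perp[OF S_shifts_ob] extension_closed_right_perp[OF S_shifts_ob]]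
    unfolding Filt_def by blast
qed

text \<open>A sorted word with letters in range, grouped by shift, is a member of the chain.
  Conversely the right-hand side is extension closed and contains every factor Filt(S)[i] with 0
  \<le> i \<le> n.\<close>

lemma star_chain_eq:
  "star_chain C (Filt C S) n = left_perp C (shifts C S {..<0}) \<inter> right_perp C (shifts C S {int n<..})"
proof (intro equalityI subsetI)
  fix X assume "X \<in> left_perp C (shifts C S {..<0}) \<inter> right_perp C (shifts C S {int n<..})"
  then obtain w where "X \<in> fil w" "word w" "desc w" "fst ` set w \<subseteq> {0..int n}"
    using words_in_range[of X n] by (metis IntE)
  then show "X \<in> star_chain C (Filt C S) n" by (rule fil_star_chain)
next
  fix X assume "X \<in> star_chain C (Filt C S) n"
  then show "X \<in> left_perp C (shifts C S {..<0}) \<inter> right_perp C (shifts C S {int n<..})"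
  proof (induction n arbitrary: X)
    case 0
    then show ?case using Filt_subset_perps by auto
  next
    case (Suc n)
    let ?m = "int (Suc n)"
    let ?G = "left_perp C (shifts C S {..<0}) \<inter> right_perp C (shifts C S {?m<..})"
    obtain A B f g h where t: "(A, X, B, f, g, h) \<in> Tri C" "A \<in> shifts C (Filt C S) {?m}"
      "B \<in> star_chain C (Filt C S) n" using Suc.prems by (auto elim: starE)
    have "B \<in> ?G" using Suc.IH[OF t(3)] by (auto simp: mem_left_perp_shifts mem_right_perp_shifts)
    moreover have "A \<in> ?G"
    proof -
      obtain A' where A': "A = shift C ?m A'" "A' \<in> Filt C S" using t(2) by (auto simp: shifts_def)
      have A'': "A' \<in> left_perp C (shifts C S {..<0})" "A' \<in> right_perp C (shifts C S {0<..})"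
        using A' Filt_subset_perps by auto
      then have ob: "A' \<in> Ob C" by (simp add: left_perp_def)
      have "hom_zero C A (shift C i Y)" if "i < 0" "Y \<in> S" for i Y
        using A''(1) that hom_zero_shift2[OF ob S_ob[of Y], of ?m i] by (simp add: A' mem_left_perp_shifts)
      moreover have "hom_zero C (shift C i Y) A" if i: "?m < i" and Y: "Y \<in> S" for i Y
      proof -
        have "hom_zero C (shift C (i - ?m) Y) A'" using A''(2) i Y by (simp add: mem_right_perp_shifts)
        then show ?thesis
          using hom_zero_shift[OF shift_ob[OF S_ob[OF Y]] ob, of ?m "i - ?m"] shift_shift[OF S_ob[OF Y], of ?m "i - ?m"]
          by (simp add: A')
      qed
      ultimately show ?thesis using tri_ob(1)[OF t(1)] by (simp add: mem_left_perp_shifts mem_right_perp_shifts)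
    qed
    ultimately have "X \<in> star C ?G ?G" using star_mem[OF t(1)] by blast
    then show ?case
      using extension_closed_Int[OF extension_closed_left_perp[OF S_shifts_ob] extension_closed_right_perp[OF S_shifts_ob]]
      unfolding extension_closed_def by blast
  qed
qed

end


section \<open>Calculus of fractions\<close>

locale thick_subcategory = triangulated_category K C
  for K :: "('k, 'r) ring_scheme" (structure) and C :: "('k, 'o, 'm) tricat" +
  fixes P :: "'o set"
  assumes thick: "thick C P"
begin

section \<open>Closure properties of a thick subcategory\<close>

lemma P_ob: "X \<in> P \<Longrightarrow> X \<in> Ob C"
  using thick by (auto simp: thick_def)

lemma P_zero: "is_zero C X \<Longrightarrow> X \<in> P"
  using thick by (auto simp: thick_def)

lemma P_sh: "X \<in> Ob C \<Longrightarrow> Sh C X \<in> P \<longleftrightarrow> X \<in> P"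
  using thick unfolding thick_def by blast

lemma P_third: "(X, Y, Z, f, g, h) \<in> Tri C \<Longrightarrow> X \<in> P \<Longrightarrow> Y \<in> P \<Longrightarrow> Z \<in> P"
  using thick unfolding thick_def by blast

lemma P_first: "(X, Y, Z, f, g, h) \<in> Tri C \<Longrightarrow> Y \<in> P \<Longrightarrow> Z \<in> P \<Longrightarrow> X \<in> P"
  using P_third[OF rot] P_sh tri_ob(1) by blast

lemma P_second: "(X, Y, Z, f, g, h) \<in> Tri C \<Longrightarrow> X \<in> P \<Longrightarrow> Z \<in> P \<Longrightarrow> Y \<in> P"
  using P_first[OF rot] P_sh tri_ob(1) by blast

lemma P_shift: assumes "X \<in> Ob C" shows "shift C i X \<in> P \<longleftrightarrow> X \<in> P"
  using shift_invariant[of "\<lambda>X Y. X \<in> P" X X i] P_sh assms by blast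

lemma P_retract:
  assumes "arr X Z i" "arr Z X r" "r \<bullet> i = Idm C X" "Z \<in> P" shows "X \<in> P"
proof -
  obtain A where A: "is_dsum C 2 A Z" "A 0 = X" using retract_dsum[OF assms(1-3)] by blast
  have "\<forall>i<2. A i \<in> P" using A(1) assms(4) thick unfolding thick_def summand_closed_def by blast
  then show ?thesis using A(2) by force
qed

text \<open>The morphisms inverted in the quotient.\<close>

definition den :: "'o \<Rightarrow> 'o \<Rightarrow> 'm \<Rightarrow> bool" where
  "den X Y s \<longleftrightarrow> arr X Y s \<and> cone_in C P X Y s"

section \<open>Denominators: two out of three and the Ore conditions\<close>

lemma den_arr: "den X Y s \<Longrightarrow> arr X Y s"
  by (simp add: den_def)

lemma denI: "(X, Y, Z, s, g, h) \<in> Tri C \<Longrightarrow> Z \<in> P \<Longrightarrow> den X Y s"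
  using tri_ob by (auto simp: den_def cone_in_def)

lemma denE: assumes "den X Y s" obtains Z g h where "(X, Y, Z, s, g, h) \<in> Tri C" "Z \<in> P"
  using assms by (auto simp: den_def cone_in_def)

lemma den_iso: assumes "iso X Y s" shows "den X Y s"
proof -
  obtain Z g h where "(X, Y, Z, s, g, h) \<in> Tri C" using cone[OF iso_arr[OF assms]] by blast
  then show ?thesis using denI cone_zero_if_iso assms P_zero by blast
qed

lemma den_idm: "X \<in> Ob C \<Longrightarrow> den X X (Idm C X)"
  using den_iso iso_idm by blast

lemma den_cmp: assumes s: "den X Y s" and t: "den Y Z t" shows "den X Z (t \<bullet> s)"
proof -
  obtain U a b where U: "(X, Y, U, s, a, b) \<in> Tri C" "U \<in> P" using s by (rule denE)
  obtain V c d where V: "(Y, Z, V, t, c, d) \<in> Tri C" "V \<in> P" using t by (rule denE)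
  obtain W e f where W: "(X, Z, W, t \<bullet> s, e, f) \<in> Tri C"
    using cone[OF arr_cmp[OF den_arr[OF s] den_arr[OF t]]] by blast
  then show ?thesis using TR4[OF U(1) V(1) W] P_second U V denI by blast
qed

text \<open>The cones of s, t s and t form a triangle by the octahedral axiom; with the last two in
  P, so is the first.\<close>

lemma den_cancel: assumes s: "arr X Y s" and t: "den Y Z t" and ts: "den X Z (t \<bullet> s)" shows "den X Y s"
proof -
  obtain U a b where U: "(X, Y, U, s, a, b) \<in> Tri C" using cone[OF s] by blast
  obtain V c d where V: "(Y, Z, V, t, c, d) \<in> Tri C" "V \<in> P" using t by (rule denE)
  obtain W e f where W: "(X, Z, W, t \<bullet> s, e, f) \<in> Tri C" "W \<in> P" using ts by (rule denE)
  show ?thesis using TR4[OF U V(1) W(1)] P_first W V denI U by blast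
qed

text \<open>Three rotations produce -s[1] instead of s[1]; composing with the automorphism -1 of
  X[1] corrects the sign.\<close>

lemma den_shm: assumes s: "den X Y s" shows "den (Sh C X) (Sh C Y) (Shm C s)"
proof -
  obtain Z a b where t: "(X, Y, Z, s, a, b) \<in> Tri C" "Z \<in> P" using s by (rule denE)
  note s' = arr_shm[OF den_arr[OF s]]
  have "Sh C Z \<in> P" using t P_sh P_ob by blast
  then have d: "den (Sh C X) (Sh C Y) (neg (Sh C X) (Sh C Y) (Shm C s))"
    using denI[OF rot[OF rot[OF rot[OF t(1)]]]] by blast
  note i = arr_idm[OF arr_dom[OF s']]
  let ?n = "neg (Sh C X) (Sh C X) (Idm C (Sh C X))"
  have "?n \<bullet> ?n = Idm C (Sh C X)"
    using neg_cmp[OF arr_neg[OF i] i] idm_left[OF arr_neg[OF i]] neg_neg[OF i] by simp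
  then have "den (Sh C X) (Sh C X) ?n" using den_iso isoI[OF arr_neg[OF i] arr_neg[OF i]] by blast
  then have "den (Sh C X) (Sh C Y) (neg (Sh C X) (Sh C Y) (Shm C s) \<bullet> ?n)" using den_cmp d by blast
  then show ?thesis
    using neg_cmp[OF arr_neg[OF i] s'] cmp_neg[OF i s'] idm_right[OF s'] neg_neg[OF s'] by simp
qed

text \<open>With q : X -> Q the cone of s, let u : W -> B be the cocone of q f. Its cone is again Q,
  and q f u = 0 lets f u lift along s.\<close>

lemma ore:
  assumes s: "den A X s" and f: "arr B X f"
  obtains W u v where "den W B u" "arr W A v" "f \<bullet> u = s \<bullet> v"
proof -
  obtain Q q h where t: "(A, X, Q, s, q, h) \<in> Tri C" "Q \<in> P" using s by (rule denE)
  note o = tri_ob[OF t(1)]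
  obtain W u k where w: "(W, B, Q, u, q \<bullet> f, k) \<in> Tri C" using cone[OF arr_cmp[OF f o(5)]] rot_back by metis
  note ow = tri_ob[OF w]
  have "q \<bullet> f \<bullet> u = nul W Q" using tri_cmp[OF w] assoc[OF ow(4) f o(5)] by simp
  then obtain v where "arr W A v" "s \<bullet> v = f \<bullet> u" using tri_lift[OF t(1) arr_cmp[OF ow(4) f]] by blast
  then show ?thesis using that denI[OF w t(2)] by metis
qed

text \<open>The difference f - g is killed by s, so it factors as j m through the cocone R of s,
  which lies in P. The cocone u of m has cone R and kills f - g.\<close>

lemma den_equalize:
  assumes s: "den A X s" and f: "arr B A f" and g: "arr B A g" and e: "s \<bullet> f = s \<bullet> g"
  obtains W u where "den W B u" "f \<bullet> u = g \<bullet> u"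
proof -
  obtain Q q h where t: "(A, X, Q, s, q, h) \<in> Tri C" "Q \<in> P" using s by (rule denE)
  obtain R j where r: "(R, A, X, j, s, q) \<in> Tri C" "Sh C R = Q" using rot_back[OF t(1)] by metis
  note o = tri_ob[OF r(1)]
  have R: "R \<in> P" using r(2) t(2) P_sh o(1) by blast
  let ?n = "f \<ominus>\<^bsub>Hom C B A\<^esub> g"
  have n: "arr B A ?n" using arr_diff[OF f g] .
  have "s \<bullet> ?n = nul B X" using cmp_diff[OF f g o(5)] e diff_self[OF arr_cmp[OF g o(5)]] by simp
  then obtain m where m: "arr B R m" "j \<bullet> m = ?n" using tri_lift[OF r(1) n] by blast
  obtain W u k where w: "(W, B, R, u, m, k) \<in> Tri C" using cone[OF m(1)] rot_back by metis
  note ow = tri_ob[OF w]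
  have "?n \<bullet> u = j \<bullet> m \<bullet> u" using assoc[OF ow(4) m(1) o(4)] m(2) by simp
  then have "?n \<bullet> u = nul W A" using tri_cmp[OF w] cmp_nul[OF o(4) ow(1)] by simp
  then have "f \<bullet> u = g \<bullet> u"
    using diff_cmp[OF ow(4) f g] diff_eq_nul[OF arr_cmp[OF ow(4) f] arr_cmp[OF ow(4) g]] by simp
  then show ?thesis using that denI[OF w R] by blast
qed

lemma den_refine:
  assumes "den A X s" "den B X t"
  obtains W u v where "den W A u" "den W B v" "s \<bullet> u = t \<bullet> v" "den W X (s \<bullet> u)"
proof -
  obtain W v u where w: "den W B v" "arr W A u" "t \<bullet> v = s \<bullet> u" using ore[OF assms(1) den_arr[OF assms(2)]] by blast
  have d: "den W X (s \<bullet> u)" using den_cmp[OF w(1) assms(2)] unfolding w(3) .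
  show ?thesis by (rule that[OF den_cancel[OF w(2) assms(1) d] w(1) w(3)[symmetric] d])
qed

section \<open>Equivalence of roofs\<close>

definition roof :: "'o \<Rightarrow> 'o \<Rightarrow> 'o \<Rightarrow> 'm \<Rightarrow> 'm \<Rightarrow> bool" where
  "roof X Z Y s f \<longleftrightarrow> den Z X s \<and> arr Z Y f"

definition req :: "'o \<Rightarrow> 'o \<Rightarrow> 'm \<Rightarrow> 'm \<Rightarrow> 'o \<Rightarrow> 'm \<Rightarrow> 'm \<Rightarrow> bool" where
  "req X Z s f Z' s' f' \<longleftrightarrow> (\<exists>W u v. arr W Z u \<and> arr W Z' v \<and> s \<bullet> u = s' \<bullet> v \<and> f \<bullet> u = f' \<bullet> v \<and> den W X (s \<bullet> u))"

lemma is_roof_iff: "is_roof C P (X, Z, Y, s, f) \<longleftrightarrow> roof X Z Y s f"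
  by (auto simp: is_roof_def roof_def den_def arr_def)

lemma roof_equiv_iff:
  "roof_equiv C P (X, Z, Y, s, f) (X', Z', Y', s', f') \<longleftrightarrow>
    roof X Z Y s f \<and> roof X Z' Y s' f' \<and> X' = X \<and> Y' = Y \<and> req X Z s f Z' s' f'"
proof -
  have "(\<exists>W\<in>Ob C. \<exists>u\<in>carrier (Hom C W Z). \<exists>v\<in>carrier (Hom C W Z').
      s \<bullet> u = s' \<bullet> v \<and> f \<bullet> u = f' \<bullet> v \<and> cone_in C P W X (s \<bullet> u)) \<longleftrightarrow> req X Z s f Z' s' f'"
    if "roof X Z Y s f" "roof X Z' Y s' f'"
  proof -
    have ob: "Z \<in> Ob C" "Z' \<in> Ob C" and s: "arr Z X s"
      using that den_arr by (auto simp: roof_def arr_def)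
    have "den W X (s \<bullet> u) \<longleftrightarrow> cone_in C P W X (s \<bullet> u)" if "arr W Z u" for W u
      using arr_cmp[OF that s] by (simp add: den_def)
    then show ?thesis unfolding req_def using ob unfolding arr_def by blast
  qed
  then show ?thesis unfolding roof_equiv_def prod.case is_roof_iff by blast
qed

lemma req_refl: assumes "roof X Z Y s f" shows "req X Z s f Z s f"
proof -
  have "den Z X s" "arr Z Y f" using assms by (auto simp: roof_def)
  then have "arr Z Z (Idm C Z)" "den Z X (s \<bullet> Idm C Z)" using arr_idm arr_dom idm_right den_arr by metis+
  then show ?thesis unfolding req_def by blast
qed

lemma req_sym: "req X Z s f Z' s' f' \<Longrightarrow> req X Z' s' f' Z s f"
  unfolding req_def by metis

lemma req_trans:
  assumes r1: "roof X Z1 Y s1 f1" and r2: "roof X Z2 Y s2 f2" and r3: "roof X Z3 Y s3 f3"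
    and e1: "req X Z1 s1 f1 Z2 s2 f2" and e2: "req X Z2 s2 f2 Z3 s3 f3"
  shows "req X Z1 s1 f1 Z3 s3 f3"
proof -
  obtain E a1 a2 where E: "arr E Z1 a1" "arr E Z2 a2" "s1 \<bullet> a1 = s2 \<bullet> a2" "f1 \<bullet> a1 = f2 \<bullet> a2"
    "den E X (s1 \<bullet> a1)" using e1 unfolding req_def by blast
  obtain F b2 b3 where F: "arr F Z2 b2" "arr F Z3 b3" "s2 \<bullet> b2 = s3 \<bullet> b3" "f2 \<bullet> b2 = f3 \<bullet> b3"
    "den F X (s2 \<bullet> b2)" using e2 unfolding req_def by blast
  have s: "arr Z1 X s1" "den Z2 X s2" "arr Z3 X s3" "arr Z2 X s2" using r1 r2 r3 den_arr by (auto simp: roof_def)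
  have f: "arr Z1 Y f1" "arr Z2 Y f2" "arr Z3 Y f3" using r1 r2 r3 by (auto simp: roof_def)
  obtain V y z where V: "den V E y" "den V F z" "(s1 \<bullet> a1) \<bullet> y = (s2 \<bullet> b2) \<bullet> z" "den V X ((s1 \<bullet> a1) \<bullet> y)"
    using den_refine[OF E(5) F(5)] by blast
  note y = den_arr[OF V(1)] and z = den_arr[OF V(2)]
  \<comment> \<open>\<open>V\<close> refines \<open>E\<close> and \<open>F\<close> only over
    \<open>X\<close>, so its two maps to \<open>Z2\<close> agree only after \<open>s2\<close>;
    \<open>den_equalize\<close> passes to a further refinement on which they coincide.\<close>
  have "s2 \<bullet> a2 \<bullet> y = s2 \<bullet> b2 \<bullet> z"
    using V(3) E(3) assoc[OF y E(2) s(4)] assoc[OF z F(1) s(4)] by simp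
  then obtain W w where W: "den W V w" "(a2 \<bullet> y) \<bullet> w = (b2 \<bullet> z) \<bullet> w"
    using den_equalize[OF s(2) arr_cmp[OF y E(2)] arr_cmp[OF z F(1)]] by blast
  note w = den_arr[OF W(1)]
  let ?y = "y \<bullet> w" and ?z = "z \<bullet> w"
  have yz: "arr W E ?y" "arr W F ?z" using arr_cmp w y z by auto
  have ab: "a2 \<bullet> ?y = b2 \<bullet> ?z" using W(2) assoc[OF w y E(2)] assoc[OF w z F(1)] by simp
  show ?thesis unfolding req_def
  proof (intro exI conjI)
    show "arr W Z1 (a1 \<bullet> ?y)" "arr W Z3 (b3 \<bullet> ?z)" using arr_cmp yz E F by auto
    have "s1 \<bullet> a1 \<bullet> ?y = s2 \<bullet> a2 \<bullet> ?y" using assoc[OF yz(1) E(1) s(1)] assoc[OF yz(1) E(2) s(4)] E(3) by simp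
    also have "\<dots> = s3 \<bullet> b3 \<bullet> ?z"
      unfolding ab using assoc[OF yz(2) F(1) s(4)] assoc[OF yz(2) F(2) s(3)] F(3) by simp
    finally show "s1 \<bullet> a1 \<bullet> ?y = s3 \<bullet> b3 \<bullet> ?z" .
    have "f1 \<bullet> a1 \<bullet> ?y = f2 \<bullet> a2 \<bullet> ?y" using assoc[OF yz(1) E(1) f(1)] assoc[OF yz(1) E(2) f(2)] E(4) by simp
    also have "\<dots> = f3 \<bullet> b3 \<bullet> ?z"
      unfolding ab using assoc[OF yz(2) F(1) f(2)] assoc[OF yz(2) F(2) f(3)] F(4) by simp
    finally show "f1 \<bullet> a1 \<bullet> ?y = f3 \<bullet> b3 \<bullet> ?z" .
    have "den W X (((s1 \<bullet> a1) \<bullet> y) \<bullet> w)" using den_cmp W V by blast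
    then show "den W X (s1 \<bullet> a1 \<bullet> ?y)"
      using assoc[OF w y arr_cmp[OF E(1) s(1)]] assoc[OF yz(1) E(1) s(1)] by simp
  qed
qed

abbreviation cls :: "'o \<Rightarrow> 'o \<Rightarrow> 'o \<Rightarrow> 'm \<Rightarrow> 'm \<Rightarrow> ('o, 'm) roof set" where
  "cls X Z Y s f \<equiv> roof_class C P (X, Z, Y, s, f)"

lemma mem_cls: "(X', Z', Y', s', f') \<in> cls X Z Y s f \<longleftrightarrow>
    roof X Z Y s f \<and> roof X Z' Y s' f' \<and> X' = X \<and> Y' = Y \<and> req X Z s f Z' s' f'"
  by (simp add: roof_class_def roof_equiv_iff)

lemma cls_eqI:
  assumes "roof X Z Y s f" "roof X Z' Y s' f'" "req X Z s f Z' s' f'"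
  shows "cls X Z Y s f = cls X Z' Y s' f'"
proof -
  have "(X1, W, Y1, t, g) \<in> cls X Z Y s f \<longleftrightarrow> (X1, W, Y1, t, g) \<in> cls X Z' Y s' f'" for X1 W Y1 t g
    unfolding mem_cls using assms req_trans req_sym by metis
  then show ?thesis by auto
qed

lemma cls_mem_eq: "(X', Z', Y', s', f') \<in> cls X Z Y s f \<Longrightarrow> cls X' Z' Y' s' f' = cls X Z Y s f"
  using cls_eqI unfolding mem_cls by metis

lemma cls_self: "roof X Z Y s f \<Longrightarrow> (X, Z, Y, s, f) \<in> cls X Z Y s f"
  by (simp add: mem_cls req_refl)

section \<open>Composition of roofs\<close>

definition composed ::
    "'o \<Rightarrow> 'o \<Rightarrow> 'o \<Rightarrow> 'o \<Rightarrow> 'o \<Rightarrow> 'm \<Rightarrow> 'm \<Rightarrow> 'm \<Rightarrow> 'm \<Rightarrow> 'o \<Rightarrow> 'm \<Rightarrow> 'm \<Rightarrow> bool" where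
  "composed X A Y B Z s f t g W u v \<longleftrightarrow>
     roof X A Y s f \<and> roof Y B Z t g \<and> den W A u \<and> arr W B v \<and> f \<bullet> u = t \<bullet> v"

lemma composed_exists:
  assumes "roof X A Y s f" "roof Y B Z t g" obtains W u v where "composed X A Y B Z s f t g W u v"
proof -
  obtain W u v where "den W A u" "arr W B v" "f \<bullet> u = t \<bullet> v"
    using assms ore[of B Y t A f] unfolding roof_def by blast
  then show ?thesis using assms that unfolding composed_def by blast
qed

lemma composed_roof:
  assumes "composed X A Y B Z s f t g W u v" shows "roof X W Z (s \<bullet> u) (g \<bullet> v)"
  using assms den_cmp arr_cmp by (auto simp: composed_def roof_def)

text \<open>Independence of the representatives is checked first for the choice of the square, and then
  for replacing one of the two roofs by a refinement; two equivalent roofs have a common refinement.\<close>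

lemma composed_unique:
  assumes c1: "composed X A Y B Z s f t g W1 u1 v1" and c2: "composed X A Y B Z s f t g W2 u2 v2"
  shows "cls X W1 Z (s \<bullet> u1) (g \<bullet> v1) = cls X W2 Z (s \<bullet> u2) (g \<bullet> v2)"
proof (rule cls_eqI[OF composed_roof[OF c1] composed_roof[OF c2]])
  have s: "den A X s" "arr A X s" and f: "arr A Y f" and t: "den B Y t" "arr B Y t" and g: "arr B Z g"
    and d1: "den W1 A u1" and a1: "arr W1 A u1" "arr W1 B v1" and e1: "f \<bullet> u1 = t \<bullet> v1"
    and d2: "den W2 A u2" and a2: "arr W2 A u2" "arr W2 B v2" and e2: "f \<bullet> u2 = t \<bullet> v2"
    using c1 c2 den_arr by (auto simp: composed_def roof_def)
  obtain V x1 x2 where V: "den V W1 x1" "den V W2 x2" "u1 \<bullet> x1 = u2 \<bullet> x2" "den V A (u1 \<bullet> x1)"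
    using den_refine[OF d1 d2] by blast
  note x1 = den_arr[OF V(1)] and x2 = den_arr[OF V(2)]
  have "t \<bullet> v1 \<bullet> x1 = f \<bullet> u1 \<bullet> x1" using assoc[OF x1 a1(2) t(2)] assoc[OF x1 a1(1) f] e1 by simp
  also have "\<dots> = t \<bullet> v2 \<bullet> x2" using assoc[OF x2 a2(2) t(2)] assoc[OF x2 a2(1) f] e2 V(3) by simp
  finally obtain W w where W: "den W V w" "(v1 \<bullet> x1) \<bullet> w = (v2 \<bullet> x2) \<bullet> w"
    using den_equalize[OF t(1) arr_cmp[OF x1 a1(2)] arr_cmp[OF x2 a2(2)]] by blast
  note w = den_arr[OF W(1)]
  let ?x1 = "x1 \<bullet> w" and ?x2 = "x2 \<bullet> w"
  have xx: "arr W W1 ?x1" "arr W W2 ?x2" using arr_cmp w x1 x2 by auto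
  have u: "u1 \<bullet> ?x1 = u2 \<bullet> ?x2" using V(3) assoc[OF w x1 a1(1)] assoc[OF w x2 a2(1)] by simp
  have v: "v1 \<bullet> ?x1 = v2 \<bullet> ?x2" using W(2) assoc[OF w x1 a1(2)] assoc[OF w x2 a2(2)] by simp
  show "req X W1 (s \<bullet> u1) (g \<bullet> v1) W2 (s \<bullet> u2) (g \<bullet> v2)" unfolding req_def
  proof (intro exI conjI)
    show "arr W W1 ?x1" "arr W W2 ?x2" by fact+
    show "(s \<bullet> u1) \<bullet> ?x1 = (s \<bullet> u2) \<bullet> ?x2"
      using assoc[OF xx(1) a1(1) s(2)] assoc[OF xx(2) a2(1) s(2)] u by simp
    show "(g \<bullet> v1) \<bullet> ?x1 = (g \<bullet> v2) \<bullet> ?x2"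
      using assoc[OF xx(1) a1(2) g] assoc[OF xx(2) a2(2) g] v by simp
    show "den W X ((s \<bullet> u1) \<bullet> ?x1)" using den_cmp[OF den_cmp[OF W(1) V(1)] den_cmp[OF d1 s(1)]] .
  qed
qed

text \<open>The refining map \<open>a\<close> is a denominator by \<open>den_cancel\<close>, so a
  square for the refined roof becomes one for the original roof on replacing \<open>u'\<close> by a
  u'; \<open>composed_unique\<close> compares it with the given square.\<close>

lemma composed_left:
  assumes c: "composed X A Y B Z s f t g W u v" and a: "arr E A a" "den E X (s \<bullet> a)"
    and c': "composed X E Y B Z (s \<bullet> a) (f \<bullet> a) t g W' u' v'"
  shows "cls X W Z (s \<bullet> u) (g \<bullet> v) = cls X W' Z ((s \<bullet> a) \<bullet> u') (g \<bullet> v')"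
proof -
  have s: "den A X s" "arr A X s" and f: "arr A Y f" and u': "den W' E u'" "arr W' E u'"
    and v': "arr W' B v'" "(f \<bullet> a) \<bullet> u' = t \<bullet> v'"
    using c c' den_arr by (auto simp: composed_def roof_def)
  have "den E A a" using den_cancel[OF a(1) s(1) a(2)] .
  then have "composed X A Y B Z s f t g W' (a \<bullet> u') v'"
    using c v' den_cmp[OF u'(1)] assoc[OF u'(2) a(1) f] by (simp add: composed_def)
  then show ?thesis using composed_unique[OF c] assoc[OF u'(2) a(1) s(2)] by simp
qed

lemma composed_right:
  assumes c: "composed X A Y B Z s f t g W u v" and b: "arr E B b" "den E Y (t \<bullet> b)"
    and c': "composed X A Y E Z s f (t \<bullet> b) (g \<bullet> b) W' u' v'"
  shows "cls X W Z (s \<bullet> u) (g \<bullet> v) = cls X W' Z (s \<bullet> u') ((g \<bullet> b) \<bullet> v')"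
proof -
  have t: "arr B Y t" and g: "arr B Z g" and u': "den W' A u'"
    and v': "arr W' E v'" "f \<bullet> u' = (t \<bullet> b) \<bullet> v'"
    using c c' den_arr by (auto simp: composed_def roof_def)
  have "composed X A Y B Z s f t g W' u' (b \<bullet> v')"
    using c u' v' arr_cmp[OF v'(1) b(1)] assoc[OF v'(1) b(1) t] by (simp add: composed_def)
  then show ?thesis using composed_unique[OF c] assoc[OF v'(1) b(1) g] by simp
qed

lemma composed_well_defined:
  assumes c1: "composed X A1 Y B1 Z s1 f1 t1 g1 W1 u1 v1" and c2: "composed X A2 Y B2 Z s2 f2 t2 g2 W2 u2 v2"
    and e: "req X A1 s1 f1 A2 s2 f2" and e': "req Y B1 t1 g1 B2 t2 g2"
  shows "cls X W1 Z (s1 \<bullet> u1) (g1 \<bullet> v1) = cls X W2 Z (s2 \<bullet> u2) (g2 \<bullet> v2)"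
proof -
  have r: "roof X A1 Y s1 f1" "roof Y B1 Z t1 g1" "roof X A2 Y s2 f2" "roof Y B2 Z t2 g2"
    using c1 c2 by (auto simp: composed_def)
  obtain E a1 a2 where E: "arr E A1 a1" "arr E A2 a2" "s1 \<bullet> a1 = s2 \<bullet> a2" "f1 \<bullet> a1 = f2 \<bullet> a2"
    "den E X (s1 \<bullet> a1)" using e unfolding req_def by blast
  obtain F b1 b2 where F: "arr F B1 b1" "arr F B2 b2" "t1 \<bullet> b1 = t2 \<bullet> b2" "g1 \<bullet> b1 = g2 \<bullet> b2"
    "den F Y (t1 \<bullet> b1)" using e' unfolding req_def by blast
  have rE: "roof X E Y (s1 \<bullet> a1) (f1 \<bullet> a1)" using E r arr_cmp by (auto simp: roof_def)
  have rF: "roof Y F Z (t1 \<bullet> b1) (g1 \<bullet> b1)" using F r arr_cmp by (auto simp: roof_def)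
  \<comment> \<open>Interpolating composites: the left roof passes from \<open>A1\<close> over its
    refinement \<open>E\<close> to \<open>A2\<close> with \<open>B1\<close> fixed, then the right
    roof passes from \<open>B1\<close> over \<open>F\<close> to \<open>B2\<close> with
    \<open>A2\<close> fixed.\<close>
  obtain W3 u3 v3 where c3: "composed X E Y B1 Z (s1 \<bullet> a1) (f1 \<bullet> a1) t1 g1 W3 u3 v3"
    using composed_exists[OF rE r(2)] by blast
  obtain W4 u4 v4 where c4: "composed X A2 Y B1 Z s2 f2 t1 g1 W4 u4 v4"
    using composed_exists[OF r(3) r(2)] by blast
  obtain W5 u5 v5 where c5: "composed X A2 Y F Z s2 f2 (t1 \<bullet> b1) (g1 \<bullet> b1) W5 u5 v5"
    using composed_exists[OF r(3) rF] by blast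
  have "cls X W1 Z (s1 \<bullet> u1) (g1 \<bullet> v1) = cls X W3 Z ((s1 \<bullet> a1) \<bullet> u3) (g1 \<bullet> v3)"
    using composed_left[OF c1 E(1,5) c3] .
  also have "\<dots> = cls X W4 Z (s2 \<bullet> u4) (g1 \<bullet> v4)"
    using composed_left[OF c4 E(2)] E c3 by simp
  also have "\<dots> = cls X W5 Z (s2 \<bullet> u5) ((g1 \<bullet> b1) \<bullet> v5)"
    using composed_right[OF c4 F(1,5) c5] .
  also have "\<dots> = cls X W2 Z (s2 \<bullet> u2) (g2 \<bullet> v2)"
    using composed_right[OF c2 F(2)] F c5 by simp
  finally show ?thesis .
qed

text \<open>All classes in the union defining the composite coincide by
  \<open>composed_well_defined\<close>, and the given square contributes one of them.\<close>

lemma quot_cmp_eq: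
  assumes c: "composed X A Y B Z s f t g W u v"
  shows "quot_cmp C P (cls Y B Z t g) (cls X A Y s f) = cls X W Z (s \<bullet> u) (g \<bullet> v)"
proof -
  let ?c = "cls X A Y s f" and ?c' = "cls Y B Z t g"
  have eq: "cls X' W' Z' (s' \<bullet> u') (g' \<bullet> v') = cls X W Z (s \<bullet> u) (g \<bullet> v)"
    if m: "(X', A', Y', s', f') \<in> ?c" "(Y', B', Z', t', g') \<in> ?c'"
      and h: "W' \<in> Ob C" "u' \<in> carrier (Hom C W' A')" "cone_in C P W' A' u'" "v' \<in> carrier (Hom C W' B')"
        "f' \<bullet> u' = t' \<bullet> v'"
    for X' A' Y' B' Z' W' s' f' t' g' u' v'
  proof -
    have r: "roof X A' Y s' f'" "roof Y B' Z t' g'" and X': "X' = X" "Z' = Z"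
      and e: "req X A s f A' s' f'" "req Y B t g B' t' g'"
      using m unfolding mem_cls by simp_all
    have "A' \<in> Ob C" "B' \<in> Ob C" using r by (simp_all add: roof_def arr_def)
    then have "den W' A' u'" "arr W' B' v'" using h by (simp_all add: den_def arr_def)
    then have "composed X A' Y B' Z s' f' t' g' W' u' v'" using r h(5) by (simp add: composed_def)
    then show ?thesis unfolding X' by (rule composed_well_defined[OF _ c req_sym[OF e(1)] req_sym[OF e(2)]])
  qed
  have r: "roof X A Y s f" "roof Y B Z t g" "den W A u" "arr W B v" "f \<bullet> u = t \<bullet> v"
    using c by (simp_all add: composed_def)
  show ?thesis
  proof (intro equalityI subsetI)
    fix r assume "r \<in> quot_cmp C P ?c' ?c"
    then obtain X' A' Y' B' Z' W' s' f' t' g' u' v' where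
      "(X', A', Y', s', f') \<in> ?c" "(Y', B', Z', t', g') \<in> ?c'" "W' \<in> Ob C" "u' \<in> carrier (Hom C W' A')"
      "cone_in C P W' A' u'" "v' \<in> carrier (Hom C W' B')" "f' \<bullet> u' = t' \<bullet> v'"
      "r \<in> cls X' W' Z' (s' \<bullet> u') (g' \<bullet> v')"
      unfolding quot_cmp_def by blast
    then show "r \<in> cls X W Z (s \<bullet> u) (g \<bullet> v)" using eq by metis
  next
    fix r assume "r \<in> cls X W Z (s \<bullet> u) (g \<bullet> v)"
    moreover have "W \<in> Ob C" "u \<in> carrier (Hom C W A)" "cone_in C P W A u" "v \<in> carrier (Hom C W B)"
      using r(3,4) by (simp_all add: den_def arr_def)
    ultimately show "r \<in> quot_cmp C P ?c' ?c"
      unfolding quot_cmp_def using cls_self[OF r(1)] cls_self[OF r(2)] r(5) by blast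
  qed
qed

section \<open>The quotient functor\<close>

abbreviation Q where "Q \<equiv> verdier_quotient C P"

abbreviation qf :: "'o \<Rightarrow> 'o \<Rightarrow> 'm \<Rightarrow> ('o, 'm) roof set" where
  "qf X Y f \<equiv> quot_functor C P X Y f"

lemma quotient_simps [simp]:
  "Ob Q = Ob C" "Hom Q = quot_hom C P" "Cmp Q = quot_cmp C P" "Sh Q = Sh C"
  "Idm Q X = qf X X (Idm C X)"
  by (simp_all add: verdier_quotient_def quot_cat_def quot_functor_def)

lemma qf_roof: "arr X Y f \<Longrightarrow> roof X X Y (Idm C X) f"
  using den_idm by (auto simp: roof_def arr_def)

lemma qf_carrier: "arr X Y f \<Longrightarrow> qf X Y f \<in> carrier (quot_hom C P X Y)"
  using qf_roof[of X Y f] by (auto simp: quot_hom_def quot_functor_def is_roof_iff)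

lemma qf_zero: "\<zero>\<^bsub>quot_hom C P X Y\<^esub> = qf X Y (nul X Y)"
  by (simp add: quot_hom_def quot_functor_def)

text \<open>As the other denominator is an identity, one leg of a common refinement is determined by
  the other leg \<open>w\<close>, which is itself a denominator by \<open>den_cancel\<close>. One
  map therefore witnesses the equivalence.\<close>

lemma mem_qf:
  assumes f: "arr X Y f"
  shows "(X', Z, Y', s, g) \<in> qf X Y f \<longleftrightarrow>
    X' = X \<and> Y' = Y \<and> roof X Z Y s g \<and> (\<exists>W w. den W Z w \<and> g \<bullet> w = f \<bullet> s \<bullet> w)"
proof -
  have "req X X (Idm C X) f Z s g \<longleftrightarrow> (\<exists>W w. den W Z w \<and> g \<bullet> w = f \<bullet> s \<bullet> w)" if r: "roof X Z Y s g"
  proof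
    have s: "den Z X s" "arr Z X s" using r den_arr by (auto simp: roof_def)
    assume "req X X (Idm C X) f Z s g"
    then obtain W u v where W: "arr W X u" "arr W Z v" "Idm C X \<bullet> u = s \<bullet> v" "f \<bullet> u = g \<bullet> v" "den W X (Idm C X \<bullet> u)"
      unfolding req_def by blast
    then have "u = s \<bullet> v" "den W X (s \<bullet> v)" using idm_left[OF W(1)] by auto
    then show "\<exists>W w. den W Z w \<and> g \<bullet> w = f \<bullet> s \<bullet> w" using den_cancel[OF W(2) s(1)] W(4) by (intro exI[of _ W] exI[of _ v]) simp
  next
    have s: "den Z X s" "arr Z X s" using r den_arr by (auto simp: roof_def)
    assume "\<exists>W w. den W Z w \<and> g \<bullet> w = f \<bullet> s \<bullet> w"
    then obtain W w where W: "den W Z w" "g \<bullet> w = f \<bullet> s \<bullet> w" by blast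
    note w = den_arr[OF W(1)]
    have "arr W X (s \<bullet> w)" "Idm C X \<bullet> s \<bullet> w = s \<bullet> w" "den W X (s \<bullet> w)"
      using arr_cmp[OF w s(2)] idm_left den_cmp[OF W(1) s(1)] by auto
    then show "req X X (Idm C X) f Z s g" unfolding req_def using w W(2) by (intro exI[of _ W] exI[of _ "s \<bullet> w"] exI[of _ w]) simp
  qed
  then show ?thesis using qf_roof[OF f] unfolding quot_functor_def mem_cls by blast
qed

lemma qf_eqI: "arr X Y f \<Longrightarrow> (X, Z, Y, s, g) \<in> qf X Y f \<Longrightarrow> cls X Z Y s g = qf X Y f"
  unfolding quot_functor_def by (rule cls_mem_eq)

lemma qf_self: "arr X Y f \<Longrightarrow> (X, X, Y, Idm C X, f) \<in> qf X Y f"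
  unfolding quot_functor_def by (rule cls_self[OF qf_roof])

lemma qf_eq_iff:
  assumes f: "arr X Y f" and g: "arr X Y g"
  shows "qf X Y f = qf X Y g \<longleftrightarrow> (\<exists>W w. den W X w \<and> f \<bullet> w = g \<bullet> w)"
proof -
  have i: "Idm C X \<bullet> w = w" if "den W X w" for W w using that idm_left den_arr by blast
  have "qf X Y f = qf X Y g \<longleftrightarrow> (X, X, Y, Idm C X, f) \<in> qf X Y g"
    using qf_self[OF f] qf_eqI[OF g] unfolding quot_functor_def by metis
  also have "\<dots> \<longleftrightarrow> (\<exists>W w. den W X w \<and> f \<bullet> w = g \<bullet> Idm C X \<bullet> w)"
    using qf_roof[OF f] by (simp add: mem_qf[OF g])
  finally show ?thesis using i by metis
qed

lemma qf_cmp: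
  assumes f: "arr X Y f" and g: "arr Y Z g" shows "quot_cmp C P (qf Y Z g) (qf X Y f) = qf X Z (g \<bullet> f)"
proof -
  have X: "X \<in> Ob C" using f by (simp add: arr_def)
  have "composed X X Y Y Z (Idm C X) f (Idm C Y) g X (Idm C X) f"
    using qf_roof f g den_idm[OF X] idm_left[OF f] idm_right[OF f] by (simp add: composed_def)
  then show ?thesis
    unfolding quot_functor_def using quot_cmp_eq idm_left[OF arr_idm[OF X]] by metis
qed

text \<open>Each pair of representatives with a common denominator yields the class of the sum:
  after a common refinement of their witnesses both numerators are restrictions of \<open>f\<close>
  and \<open>g\<close>. The identity roofs show that the union is not empty.\<close>

lemma qf_add:
  assumes f: "arr X Y f" and g: "arr X Y g"
  shows "qf X Y f \<oplus>\<^bsub>quot_hom C P X Y\<^esub> qf X Y g = qf X Y (f \<oplus>\<^bsub>Hom C X Y\<^esub> g)"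
proof -
  note fg = arr_add[OF f g]
  have eq: "cls X Z Y s (f' \<oplus>\<^bsub>Hom C Z Y\<^esub> g') = qf X Y (f \<oplus>\<^bsub>Hom C X Y\<^esub> g)"
    if f': "(X, Z, Y, s, f') \<in> qf X Y f" and g': "(X, Z, Y, s, g') \<in> qf X Y g" for Z s f' g'
  proof (rule qf_eqI[OF fg])
    obtain U u where U: "den U Z u" "f' \<bullet> u = f \<bullet> s \<bullet> u" using f' mem_qf[OF f] by blast
    obtain V v where V: "den V Z v" "g' \<bullet> v = g \<bullet> s \<bullet> v" using g' mem_qf[OF g] by blast
    have a: "arr Z X s" "den Z X s" "arr Z Y f'" "arr Z Y g'"
      using f' g' mem_qf[OF f] mem_qf[OF g] den_arr by (auto simp: roof_def)
    obtain W x y where W: "den W U x" "den W V y" "u \<bullet> x = v \<bullet> y" "den W Z (u \<bullet> x)"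
      using den_refine[OF U(1) V(1)] by blast
    note u = den_arr[OF U(1)] and v = den_arr[OF V(1)] and x = den_arr[OF W(1)] and y = den_arr[OF W(2)]
      and w = den_arr[OF W(4)]
    have "f' \<bullet> u \<bullet> x = (f \<bullet> s \<bullet> u) \<bullet> x" using assoc[OF x u a(3)] U(2) by simp
    then have 1: "f' \<bullet> u \<bullet> x = f \<bullet> s \<bullet> u \<bullet> x" using assoc[OF x arr_cmp[OF u a(1)] f] assoc[OF x u a(1)] by simp
    have "g' \<bullet> v \<bullet> y = (g \<bullet> s \<bullet> v) \<bullet> y" using assoc[OF y v a(4)] V(2) by simp
    then have "g' \<bullet> v \<bullet> y = g \<bullet> s \<bullet> v \<bullet> y" using assoc[OF y arr_cmp[OF v a(1)] g] assoc[OF y v a(1)] by simp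
    then have "(f' \<oplus>\<^bsub>Hom C Z Y\<^esub> g') \<bullet> u \<bullet> x = (f \<oplus>\<^bsub>Hom C X Y\<^esub> g) \<bullet> s \<bullet> u \<bullet> x"
      using add_cmp[OF w a(3,4)] add_cmp[OF arr_cmp[OF w a(1)] f g] 1 W(3) by simp
    then show "(X, Z, Y, s, f' \<oplus>\<^bsub>Hom C Z Y\<^esub> g') \<in> qf X Y (f \<oplus>\<^bsub>Hom C X Y\<^esub> g)"
      using mem_qf[OF fg] W(4) a arr_add by (auto simp: roof_def)
  qed
  have "{cls X Z Y s (f' \<oplus>\<^bsub>Hom C Z Y\<^esub> g') | Z s f' g'. (X, Z, Y, s, f') \<in> qf X Y f \<and> (X, Z, Y, s, g') \<in> qf X Y g}
     = {qf X Y (f \<oplus>\<^bsub>Hom C X Y\<^esub> g)}"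
    using eq qf_self[OF f] qf_self[OF g] by blast
  then show ?thesis by (simp add: quot_hom_def)
qed

lemma qf_smult:
  assumes a: "a \<in> carrier K" and f: "arr X Y f"
  shows "a \<odot>\<^bsub>quot_hom C P X Y\<^esub> qf X Y f = qf X Y (a \<odot>\<^bsub>Hom C X Y\<^esub> f)"
proof -
  note af = arr_smult[OF a f]
  have eq: "cls X Z Y s (a \<odot>\<^bsub>Hom C Z Y\<^esub> f') = qf X Y (a \<odot>\<^bsub>Hom C X Y\<^esub> f)"
    if f': "(X, Z, Y, s, f') \<in> qf X Y f" for Z s f'
  proof (rule qf_eqI[OF af])
    obtain U u where U: "den U Z u" "f' \<bullet> u = f \<bullet> s \<bullet> u" using f' mem_qf[OF f] by blast
    have b: "arr Z X s" "den Z X s" "arr Z Y f'"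
      using f' mem_qf[OF f] den_arr by (auto simp: roof_def)
    note u = den_arr[OF U(1)]
    have "(a \<odot>\<^bsub>Hom C Z Y\<^esub> f') \<bullet> u = (a \<odot>\<^bsub>Hom C X Y\<^esub> f) \<bullet> s \<bullet> u"
      using smult_cmp[OF a u b(3)] smult_cmp[OF a arr_cmp[OF u b(1)] f] U(2) by simp
    then show "(X, Z, Y, s, a \<odot>\<^bsub>Hom C Z Y\<^esub> f') \<in> qf X Y (a \<odot>\<^bsub>Hom C X Y\<^esub> f)"
      using mem_qf[OF af] U(1) b arr_smult[OF a] by (auto simp: roof_def)
  qed
  have "{cls X Z Y s (a \<odot>\<^bsub>Hom C Z Y\<^esub> f') | Z s f'. (X, Z, Y, s, f') \<in> qf X Y f}
     = {qf X Y (a \<odot>\<^bsub>Hom C X Y\<^esub> f)}"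
    using eq qf_self[OF f] by blast
  then show ?thesis by (simp add: quot_hom_def)
qed

lemma qf_shm:
  assumes f: "arr X Y f" shows "Shm Q (qf X Y f) = qf (Sh C X) (Sh C Y) (Shm C f)"
proof -
  note sf = arr_shm[OF f]
  have eq: "cls (Sh C X') (Sh C Z) (Sh C Y') (Shm C s) (Shm C f') = qf (Sh C X) (Sh C Y) (Shm C f)"
    if f': "(X', Z, Y', s, f') \<in> qf X Y f" for X' Z Y' s f'
  proof -
    obtain U u where U: "den U Z u" "f' \<bullet> u = f \<bullet> s \<bullet> u" and X': "X' = X" "Y' = Y"
      using f' mem_qf[OF f] by blast
    have b: "arr Z X s" "den Z X s" "arr Z Y f'"
      using f' mem_qf[OF f] den_arr by (auto simp: roof_def)
    note u = den_arr[OF U(1)]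
    have "Shm C f' \<bullet> Shm C u = Shm C f \<bullet> Shm C s \<bullet> Shm C u"
      using U(2) shm_comp[OF u b(3)] shm_comp[OF arr_cmp[OF u b(1)] f] shm_comp[OF u b(1)] by simp
    then have "(Sh C X, Sh C Z, Sh C Y, Shm C s, Shm C f') \<in> qf (Sh C X) (Sh C Y) (Shm C f)"
      using mem_qf[OF sf] den_shm[OF U(1)] den_shm[OF b(2)] arr_shm[OF b(3)] by (auto simp: roof_def)
    then show ?thesis unfolding X' by (rule qf_eqI[OF sf])
  qed
  have "{cls (Sh C X') (Sh C Z) (Sh C Y') (Shm C s) (Shm C f') | X' Z Y' s f'. (X', Z, Y', s, f') \<in> qf X Y f}
     = {qf (Sh C X) (Sh C Y) (Shm C f)}"
    using eq qf_self[OF f] by blast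
  then show ?thesis by (simp add: verdier_quotient_def quot_cat_def)
qed

text \<open>The inverse is the class of the roof with denominator \<open>s\<close> and numerator the
  identity of \<open>Z\<close>.\<close>

lemma quotient_iso_if_den:
  assumes s: "den Z X s" shows "is_iso Q Z X (qf Z X s)"
proof -
  note a = den_arr[OF s]
  have ob: "Z \<in> Ob C" "X \<in> Ob C" using a by (auto simp: arr_def)
  note i = arr_idm[OF ob(1)]
  have r: "roof X Z Z s (Idm C Z)" using s i by (simp add: roof_def)
  have "composed X Z Z Z X s (Idm C Z) (Idm C Z) s Z (Idm C Z) (Idm C Z)"
    using r qf_roof[OF a] den_idm[OF ob(1)] i by (simp add: composed_def)
  then have "quot_cmp C P (qf Z X s) (cls X Z Z s (Idm C Z)) = cls X Z X s s"
    unfolding quot_functor_def using quot_cmp_eq idm_right[OF a] by metis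
  moreover have "(X, Z, X, s, s) \<in> qf X X (Idm C X)"
    unfolding mem_qf[OF arr_idm[OF ob(2)]]
    using s a den_idm[OF ob(1)] idm_right[OF a] idm_left[OF a]
    by (auto simp: roof_def intro!: exI[of _ Z] exI[of _ "Idm C Z"])
  ultimately have 1: "quot_cmp C P (qf Z X s) (cls X Z Z s (Idm C Z)) = qf X X (Idm C X)"
    using qf_eqI[OF arr_idm[OF ob(2)]] by metis
  have "composed Z Z X Z Z (Idm C Z) s s (Idm C Z) Z (Idm C Z) (Idm C Z)"
    using r qf_roof[OF a] den_idm[OF ob(1)] i by (simp add: composed_def)
  then have "quot_cmp C P (cls X Z Z s (Idm C Z)) (qf Z X s) = cls Z Z Z (Idm C Z \<bullet> Idm C Z) (Idm C Z \<bullet> Idm C Z)"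
    unfolding quot_functor_def by (rule quot_cmp_eq)
  then have 2: "quot_cmp C P (cls X Z Z s (Idm C Z)) (qf Z X s) = qf Z Z (Idm C Z)"
    using idm_right[OF i] by (simp add: quot_functor_def)
  have "cls X Z Z s (Idm C Z) \<in> carrier (quot_hom C P X Z)"
    using r by (auto simp: quot_hom_def is_roof_iff)
  then show ?thesis using 1 2 qf_carrier[OF a] unfolding is_iso_def quotient_simps by blast
qed

lemma quotient_tri:
  assumes t: "(X, Y, Z, f, g, h) \<in> Tri C"
  shows "(X, Y, Z, qf X Y f, qf Y Z g, qf Z (Sh C X) h) \<in> Tri Q"
proof -
  note o = tri_ob[OF t]
  have can: "(X, Y, Z, qf X Y f, qf Y Z g, qf Z (Sh C X) h) \<in> candidates (quot_cat C P)"
    using o qf_carrier by (simp add: candidates_def quot_cat_def)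
  have iso: "is_iso (quot_cat C P) W W (qf W W (Idm C W))" if "W \<in> Ob C" for W
    using quotient_iso_if_den[OF den_idm[OF that]] by (simp add: is_iso_def quot_cat_def verdier_quotient_def)
  have nat: "quot_cmp C P (qf V V (Idm C V)) (qf W V k) = quot_cmp C P (qf W V k) (qf W W (Idm C W))"
    if "arr W V k" for W V k
    using that arr_idm arr_def idm_left idm_right qf_cmp by metis
  have sh: "Shm (quot_cat C P) (qf X X (Idm C X)) = qf (Sh C X) (Sh C X) (Idm C (Sh C X))"
    using qf_shm[OF arr_idm[OF o(1)]] shm_idm[OF o(1)] by (simp add: verdier_quotient_def)
  have "cand_iso (quot_cat C P) (X, Y, Z, qf X Y f, qf Y Z g, qf Z (Sh C X) h) (X, Y, Z, qf X Y f, qf Y Z g, qf Z (Sh C X) h)"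
    unfolding cand_iso_def prod.case
  proof (intro exI conjI)
    show "is_iso (quot_cat C P) X X (qf X X (Idm C X))" "is_iso (quot_cat C P) Y Y (qf Y Y (Idm C Y))"
      "is_iso (quot_cat C P) Z Z (qf Z Z (Idm C Z))" using iso o by auto
    show "Cmp (quot_cat C P) (qf Y Y (Idm C Y)) (qf X Y f) = Cmp (quot_cat C P) (qf X Y f) (qf X X (Idm C X))"
      "Cmp (quot_cat C P) (qf Z Z (Idm C Z)) (qf Y Z g) = Cmp (quot_cat C P) (qf Y Z g) (qf Y Y (Idm C Y))"
      using nat[OF o(4)] nat[OF o(5)] by (simp_all add: quot_cat_def)
    show "Cmp (quot_cat C P) (Shm (quot_cat C P) (qf X X (Idm C X))) (qf Z (Sh C X) h)
      = Cmp (quot_cat C P) (qf Z (Sh C X) h) (qf Z Z (Idm C Z))"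
      unfolding sh using nat[OF o(6)] by (simp add: quot_cat_def)
  qed
  then have "\<exists>X' Y' Z' f' g' h'. (X', Y', Z', f', g', h') \<in> Tri C \<and>
      cand_iso (quot_cat C P) (X', Y', Z', qf X' Y' f', qf Y' Z' g', qf Z' (Sh C X') h')
        (X, Y, Z, qf X Y f, qf Y Z g, qf Z (Sh C X) h)"
    using t by blast
  then show ?thesis using can by (simp add: verdier_quotient_def)
qed

text \<open>If the identity of X becomes zero, some denominator W -> X is the zero map; the identity
  then factors through its cone, so X is a retract of a member of P. Conversely, for X in P the zero
  map 0 -> X, with cone X, is a denominator that equalizes the identity and zero.\<close>

lemma quotient_is_zero: "is_zero Q X \<longleftrightarrow> X \<in> P"
proof
  assume z: "is_zero Q X"
  then have X: "X \<in> Ob C" by (simp add: is_zero_def)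
  note i = arr_idm[OF X]
  have "qf X X (Idm C X) = qf X X (nul X X)" using z by (simp add: is_zero_def qf_zero)
  then obtain W w where W: "den W X w" "Idm C X \<bullet> w = nul X X \<bullet> w" using qf_eq_iff[OF i arr_nul[OF X X]] by blast
  then have w: "Idm C X \<bullet> w = nul W X" using nul_cmp[OF den_arr[OF W(1)] X] by simp
  obtain Z g h where t: "(W, X, Z, w, g, h) \<in> Tri C" "Z \<in> P" using W(1) by (rule denE)
  obtain r where "arr Z X r" "r \<bullet> g = Idm C X" using tri_ext[OF t(1) i w] by blast
  then show "X \<in> P" using P_retract tri_ob(5)[OF t(1)] t(2) by blast
next
  assume P: "X \<in> P"
  then have X: "X \<in> Ob C" by (rule P_ob)
  obtain N where N: "is_zero C N" by (rule zero_exists)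
  have d: "den N X (nul N X)" using denI[OF tri_idm'[OF X N]] P by blast
  have "Idm C X \<bullet> nul N X = nul X X \<bullet> nul N X"
    using idm_left[OF den_arr[OF d]] nul_cmp[OF den_arr[OF d] X] by simp
  then have "qf X X (Idm C X) = qf X X (nul X X)"
    using qf_eq_iff[OF arr_idm[OF X] arr_nul[OF X X]] d by blast
  then show "is_zero Q X" using X by (simp add: is_zero_def qf_zero)
qed

lemma quotient_shift: "shift Q i X = shift C i X"
  by (simp add: shift_def)

end


section \<open>Calabi-Yau triples\<close>

context CY_triple
begin

notation comp (infixr \<open>\<bullet>\<close> 75)

sublocale smc K T S
  by unfold_locales (rule RS2(1))

sublocale thick_subcategory K T Tp
  by unfold_locales (rule RS0(3))

lemma serre_hom_zero:
  assumes P: "P \<in> Tp" and Y: "Y \<in> Ob T"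
  shows "hom_zero T P Y \<longleftrightarrow> hom_zero T Y (shift T (- int d) P)"
proof -
  let ?W = "Hom T Y (shift T (- int d) P)"
  interpret V: vectorspace K "Hom T P Y" using hom_vectorspace[OF P_ob[OF P] Y] .
  have fd: "V.fin_dim" using RS0(1) P_ob[OF P] Y by (simp add: hom_finite_def)
  obtain \<phi> where bij: "bij_betw \<phi> (carrier (dual_space K (Hom T P Y))) (carrier ?W)"
    using RS1 P Y unfolding relative_serre_duality_def by blast
  have z: "\<zero>\<^bsub>?W\<^esub> \<in> carrier ?W" using arr_nul[OF Y shift_ob[OF P_ob[OF P]]] by (simp add: arr_def)
  have "(\<exists>\<xi>. carrier (dual_space K (Hom T P Y)) = {\<xi>}) \<longleftrightarrow> (\<exists>w. carrier ?W = {w})"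
  proof
    assume "\<exists>\<xi>. carrier (dual_space K (Hom T P Y)) = {\<xi>}"
    then obtain \<xi> where "carrier (dual_space K (Hom T P Y)) = {\<xi>}" by blast
    then have "carrier ?W = {\<phi> \<xi>}" using bij_betw_imp_surj_on[OF bij] by simp
    then show "\<exists>w. carrier ?W = {w}" by blast
  next
    assume "\<exists>w. carrier ?W = {w}"
    then obtain w where w: "carrier ?W = {w}" by blast
    obtain \<xi> where \<xi>: "\<xi> \<in> carrier (dual_space K (Hom T P Y))" using V.zero_functional by blast
    have "\<eta> = \<xi>" if "\<eta> \<in> carrier (dual_space K (Hom T P Y))" for \<eta>
    proof (rule inj_onD[OF bij_betw_imp_inj_on[OF bij] _ that \<xi>])
      show "\<phi> \<eta> = \<phi> \<xi>" using bij_betwE[OF bij] that \<xi> w by auto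
    qed
    then show "\<exists>\<xi>. carrier (dual_space K (Hom T P Y)) = {\<xi>}" using \<xi> by blast
  qed
  also have "\<dots> \<longleftrightarrow> carrier ?W = {\<zero>\<^bsub>?W\<^esub>}" using z by auto
  finally show ?thesis using V.dual_space_trivial_iff[OF fd] by (simp add: hom_zero_def)
qed

abbreviation "inj_dom \<equiv> right_perp T (shifts T S {..<0})"

section \<open>The fundamental domain in terms of orthogonality to shifts of S\<close>

lemma torsion1: "right_perp T (T_pos T S) = left_perp T (shifts T S {..<0})"
    "star T (T_pos T S) (left_perp T (shifts T S {..<0})) = Ob T"
  using RS2(2) by (auto simp: co_t_structure_def torsion_pair_def T_pos_def)

lemma torsion2: "left_perp T inj_dom = right_perp T (shifts T S {0..})"
    "star T (right_perp T (shifts T S {0..})) inj_dom = Ob T"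
  using RS2(3) by (auto simp: co_t_structure_def torsion_pair_def)

lemma T_pos_Tp: "X \<in> T_pos T S \<Longrightarrow> X \<in> Tp"
  using RS2(4) by (auto simp: T_pos_def)

lemma hom_zero_shift_right:
  assumes "X \<in> Ob T" "Y \<in> Ob T"
  shows "hom_zero T (shift T i X) (shift T j Y) \<longleftrightarrow> hom_zero T (shift T (i - j) X) Y"
  using hom_zero_shift[OF shift_ob[OF assms(1)] assms(2), of j "i - j"] shift_shift[OF assms(1), of j "i - j"]
  by simp

text \<open>For M in Tp duality turns Hom(M, Y[i]) = 0 into Hom(Y[i], M[-d]) = 0, that is
  Hom(Y[i-1], M[-d-1]) = 0; here i < 1 amounts to i - 1 < 0. Conversely \<open>inj_dom\<close> lies
  in the shift-closed Tp, which forces M into Tp.\<close>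

lemma T_le_minus1_Tp:
  assumes M: "M \<in> Ob T"
  shows "M \<in> T_le_minus1 T S \<inter> Tp \<longleftrightarrow> shift T (- int d - 1) M \<in> inj_dom"
proof -
  have eq: "hom_zero T M (shift T i Y) \<longleftrightarrow> hom_zero T (shift T (i - 1) Y) (shift T (- int d - 1) M)"
    if "M \<in> Tp" "Y \<in> S" for i Y
    using serre_hom_zero[OF that(1) shift_ob[OF S_ob[OF that(2)]]]
      hom_zero_shift_right[OF S_ob[OF that(2)] M, of i "- int d"]
      hom_zero_shift_right[OF S_ob[OF that(2)] M, of "i - 1" "- int d - 1"] by simp
  have mem: "shift T (- int d - 1) M \<in> inj_dom \<longleftrightarrow>
      (\<forall>i<0. \<forall>Y\<in>S. hom_zero T (shift T i Y) (shift T (- int d - 1) M))"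
    using shift_ob[OF M] by (auto simp: mem_right_perp_shifts)
  have "(\<forall>i<1. \<forall>Y\<in>S. hom_zero T M (shift T i Y)) \<longleftrightarrow> shift T (- int d - 1) M \<in> inj_dom" if "M \<in> Tp"
  proof -
    have "(\<forall>i<1. \<forall>Y\<in>S. hom_zero T M (shift T i Y)) \<longleftrightarrow>
        (\<forall>i<1. \<forall>Y\<in>S. hom_zero T (shift T (i - 1) Y) (shift T (- int d - 1) M))" using eq[OF that] by blast
    also have "\<dots> \<longleftrightarrow> (\<forall>i<0. \<forall>Y\<in>S. hom_zero T (shift T i Y) (shift T (- int d - 1) M))"
    proof safe
      fix i :: int and Y assume "\<forall>i<1. \<forall>Y\<in>S. hom_zero T (shift T (i - 1) Y) (shift T (- int d - 1) M)" "i < 0" "Y \<in> S"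
      then show "hom_zero T (shift T i Y) (shift T (- int d - 1) M)" by (auto dest!: spec[of _ "i + 1"])
    qed auto
    finally show ?thesis using mem by blast
  qed
  moreover have "M \<in> Tp" if "shift T (- int d - 1) M \<in> inj_dom"
    using that RS2(5) P_shift[OF M] by blast
  ultimately show ?thesis using M by (auto simp: T_le_minus1_def mem_left_perp_shifts)
qed

text \<open>By \<open>T_le_minus1_Tp\<close> the condition on X says that X[-d-1] is left orthogonal
  to \<open>inj_dom\<close>, hence right orthogonal to S[\<ge>0] by the second torsion pair.
  Shifting back by d + 1 turns i \<ge> 0 into i > d.\<close>

lemma left_perp_T_le_minus1_Tp:
  "left_perp T (T_le_minus1 T S \<inter> Tp) = right_perp T (shifts T S {int d<..})"
proof -
  let ?n = "- int d - 1"
  have "X \<in> left_perp T (T_le_minus1 T S \<inter> Tp) \<longleftrightarrow> X \<in> right_perp T (shifts T S {int d<..})"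
    if X: "X \<in> Ob T" for X
  proof -
    have "X \<in> left_perp T (T_le_minus1 T S \<inter> Tp) \<longleftrightarrow>
        (\<forall>M\<in>Ob T. shift T ?n M \<in> inj_dom \<longrightarrow> hom_zero T X M)"
      using X T_le_minus1_Tp P_ob by (auto simp: left_perp_def)
    also have "\<dots> \<longleftrightarrow> (\<forall>N\<in>inj_dom. hom_zero T (shift T ?n X) N)"
    proof (intro iffI ballI impI)
      fix N assume a: "\<forall>M\<in>Ob T. shift T ?n M \<in> inj_dom \<longrightarrow> hom_zero T X M" and N: "N \<in> inj_dom"
      then have No: "N \<in> Ob T" by (simp add: right_perp_def)
      have s: "shift T ?n (shift T (- ?n) N) = N" using shift_shift[OF No, of ?n "- ?n"] by (simp add: shift_0)
      then have "hom_zero T X (shift T (- ?n) N)" using a N shift_ob[OF No] by simp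
      then show "hom_zero T (shift T ?n X) N" using hom_zero_shift[OF X shift_ob[OF No], of ?n] s by metis
    next
      fix M assume a: "\<forall>N\<in>inj_dom. hom_zero T (shift T ?n X) N" and M: "M \<in> Ob T" "shift T ?n M \<in> inj_dom"
      then show "hom_zero T X M" using hom_zero_shift[OF X M(1), of ?n] by blast
    qed
    also have "\<dots> \<longleftrightarrow> shift T ?n X \<in> right_perp T (shifts T S {0..})"
      unfolding torsion2(1)[symmetric] using shift_ob[OF X] by (simp add: left_perp_def)
    also have "\<dots> \<longleftrightarrow> (\<forall>i\<ge>0. \<forall>Y\<in>S. hom_zero T (shift T (i + int d + 1) Y) X)"
      using shift_ob[OF X] hom_zero_shift_right[OF S_ob X] by (auto simp: mem_right_perp_shifts algebra_simps)
    also have "\<dots> \<longleftrightarrow> (\<forall>i>int d. \<forall>Y\<in>S. hom_zero T (shift T i Y) X)"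
    proof safe
      fix i :: int and Y assume "\<forall>i\<ge>0. \<forall>Y\<in>S. hom_zero T (shift T (i + int d + 1) Y) X" "int d < i" "Y \<in> S"
      then show "hom_zero T (shift T i Y) X" by (auto dest!: spec[of _ "i - int d - 1"])
    qed auto
    finally show ?thesis using X by (auto simp: mem_right_perp_shifts)
  qed
  moreover have "left_perp T (T_le_minus1 T S \<inter> Tp) \<subseteq> Ob T" "right_perp T (shifts T S {int d<..}) \<subseteq> Ob T"
    by (auto simp: left_perp_def right_perp_def)
  ultimately show ?thesis by blast
qed

lemma fundamental_domain_eq:
  "fundamental_domain T Tp S = left_perp T (shifts T S {..<0}) \<inter> right_perp T (shifts T S {int d<..})"
  unfolding fundamental_domain_def torsion1(1) left_perp_T_le_minus1_Tp ..

lemma fundamental_domain_star_chain: "fundamental_domain T Tp S = star_chain T (Filt T S) d"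
  unfolding fundamental_domain_eq star_chain_eq ..

section \<open>Morphisms in the quotient between objects of the fundamental domain\<close>

lemma fundamental_domain_ob: "X \<in> fundamental_domain T Tp S \<Longrightarrow> X \<in> Ob T"
  by (simp add: fundamental_domain_def right_perp_def)

lemma shift_S_fundamental_domain:
  assumes "X \<in> S" "0 \<le> i" "i \<le> int d" shows "shift T i X \<in> fundamental_domain T Tp S"
  using assms S_hom_zero shift_ob S_ob
  by (auto simp: fundamental_domain_eq mem_left_perp_shifts mem_right_perp_shifts)

text \<open>For a roof \<open>X \<leftarrow> Z \<rightarrow> Y\<close> with cone \<open>M\<close> of \<open>Z \<rightarrow> X\<close>, orthogonality on the left lifts \<open>X \<rightarrow> M\<close> to
  the part of \<open>M\<close> in \<open>\<T>\<^sub>>\<^sub>0[1]\<close>, and orthogonality on the right extends the resulting \<open>W \<rightarrow> Y\<close> to \<open>X\<close>.\<close>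

lemma fundamental_domain_full:
  assumes X: "X \<in> fundamental_domain T Tp S" and Y: "Y \<in> fundamental_domain T Tp S"
  shows "carrier (quot_hom T Tp X Y) = qf X Y ` carrier (Hom T X Y)"
proof (intro equalityI subsetI)
  have XY: "X \<in> Ob T" "Y \<in> Ob T" using X Y fundamental_domain_ob by auto
  fix r assume "r \<in> qf X Y ` carrier (Hom T X Y)"
  then show "r \<in> carrier (quot_hom T Tp X Y)" using qf_carrier XY by (auto simp: arr_def)
next
  have XY: "X \<in> Ob T" "Y \<in> Ob T" using X Y fundamental_domain_ob by auto
  fix r assume "r \<in> carrier (quot_hom T Tp X Y)"
  then obtain Z s f where r: "r = cls X Z Y s f" "den Z X s" "arr Z Y f"
    by (auto simp: quot_hom_def is_roof_iff roof_def)
  obtain M p q where t: "(Z, X, M, s, p, q) \<in> Tri T" "M \<in> Tp" using r(2) by (rule denE)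
  note o = tri_ob[OF t(1)]
  obtain M0 where M0: "M0 \<in> Ob T" "Sh T M0 = M" using sh_surj[OF o(3)] by blast
  then have "M0 \<in> star T (T_pos T S) (left_perp T (shifts T S {..<0}))" using torsion1(2) by simp
  then obtain A B x y z where AB: "(A, M0, B, x, y, z) \<in> Tri T" "A \<in> T_pos T S"
      "B \<in> left_perp T (shifts T S {..<0})" by (rule starE)
  have Ap: "A \<in> Tp" using T_pos_Tp AB by blast
  have Bp: "B \<in> Tp" using P_third[OF AB(1) Ap] P_sh[OF M0(1)] M0(2) t(2) by simp
  note oAB = tri_ob[OF AB(1)]
  obtain \<alpha> \<beta> \<gamma> where t2: "(Sh T A, M, Sh T B, \<alpha>, \<beta>, \<gamma>) \<in> Tri T"
    using rot[OF rot[OF rot[OF AB(1)]]] M0(2) by blast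
  note o2 = tri_ob[OF t2]
  \<comment> \<open>The torsion pair was applied to M[-1] so that the right-hand part of M is B[1]:
    the condition defining \<open>T_le_minus1\<close> runs over i < 1, which is i - 1 < 0 for B.
    Since A and M[-1] lie in Tp, so does B.\<close>
  have "shift T 1 B \<in> T_le_minus1 T S"
    using AB(3) hom_zero_shift2[OF oAB(3) S_ob] shift_ob[OF oAB(3)]
    by (auto simp: T_le_minus1_def mem_left_perp_shifts)
  then have "Sh T B \<in> T_le_minus1 T S \<inter> Tp" using Bp P_sh oAB(3) shift_1[OF oAB(3)] by simp
  then have "hom_zero T X (Sh T B)" using X unfolding fundamental_domain_def left_perp_def by blast
  then have "\<beta> \<bullet> p = nul X (Sh T B)" using hom_zeroD arr_cmp[OF o(5) o2(5)] by blast
  then obtain p' where p': "arr X (Sh T A) p'" "\<alpha> \<bullet> p' = p" using tri_lift[OF t2 o(5)] by blast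
  obtain W w k where w: "(W, X, Sh T A, w, p', k) \<in> Tri T" using cone[OF p'(1)] rot_back by metis
  note ow = tri_ob[OF w]
  have dw: "den W X w" using denI[OF w] Ap P_sh[OF oAB(1)] by blast
  have "p' \<bullet> w = nul W (Sh T A)" using tri_cmp[OF w] .
  then have "p \<bullet> w = nul W M"
    using assoc[OF ow(4) p'(1) o2(4)] p'(2) cmp_nul[OF o2(4) ow(1)] by simp
  then obtain v where v: "arr W Z v" "s \<bullet> v = w" using tri_lift[OF t(1) ow(4)] by blast
  have dv: "den W Z v" using den_cancel[OF v(1) r(2)] v(2) dw by simp
  obtain A' l where A': "Sh T A' = Sh T A" "(A', W, X, l, w, p') \<in> Tri T" using rot_back[OF w] by metis
  have AA: "A' = A" using sh_inj A'(1) tri_ob(1)[OF A'(2)] oAB(1) by blast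
  note fv = arr_cmp[OF v(1) r(3)]
  have l: "arr A W l" using tri_ob(4)[OF A'(2)] AA by simp
  have "hom_zero T A Y" using Y AB(2) by (auto simp: fundamental_domain_def right_perp_def)
  then have "(f \<bullet> v) \<bullet> l = nul A Y" using arr_cmp[OF l fv] by (rule hom_zeroD)
  then obtain h where h: "arr X Y h" "h \<bullet> w = f \<bullet> v" using tri_ext[OF A'(2) fv] AA by blast
  have "f \<bullet> v = h \<bullet> s \<bullet> v" using h(2) v(2) by simp
  then have "(X, Z, Y, s, f) \<in> qf X Y h"
    unfolding mem_qf[OF h(1)] using r dv by (auto simp: roof_def)
  then have "r = qf X Y h" using qf_eqI[OF h(1)] r(1) by simp
  then show "r \<in> qf X Y ` carrier (Hom T X Y)" using h(1) by (auto simp: arr_def)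
qed

lemma quotient_has_dim:
  assumes X: "X \<in> S" "X \<notin> Tp" and Y: "Y \<in> S"
  shows "has_dim K (quot_hom T Tp X Y) (if X = Y then 1 else 0)"
proof (rule has_dim_transport[OF S_has_dim[OF X(1) Y]])
  have ob: "X \<in> Ob T" "Y \<in> Ob T" using X Y S_ob by auto
  have F: "X \<in> fundamental_domain T Tp S" "Y \<in> fundamental_domain T Tp S"
    using shift_S_fundamental_domain[of _ 0] X Y by (auto simp: shift_0)
  show "qf X Y f \<oplus>\<^bsub>quot_hom T Tp X Y\<^esub> qf X Y g = qf X Y (f \<oplus>\<^bsub>Hom T X Y\<^esub> g)"
    if "f \<in> carrier (Hom T X Y)" "g \<in> carrier (Hom T X Y)" for f g
    using qf_add that ob by (simp add: arr_def)
  show "a \<odot>\<^bsub>quot_hom T Tp X Y\<^esub> qf X Y f = qf X Y (a \<odot>\<^bsub>Hom T X Y\<^esub> f)"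
    if "a \<in> carrier K" "f \<in> carrier (Hom T X Y)" for a f
    using qf_smult that ob by (simp add: arr_def)
  show "\<zero>\<^bsub>quot_hom T Tp X Y\<^esub> = qf X Y (nul X Y)" by (rule qf_zero)
  have "inj_on (qf X Y) (carrier (Hom T X Y))"
  proof (rule inj_onI)
    fix f g assume "f \<in> carrier (Hom T X Y)" "g \<in> carrier (Hom T X Y)" and eq: "qf X Y f = qf X Y g"
    then have f: "arr X Y f" and g: "arr X Y g" using ob by (auto simp: arr_def)
    let ?n = "f \<ominus>\<^bsub>Hom T X Y\<^esub> g"
    note n = arr_diff[OF f g]
    obtain W w where w: "den W X w" "f \<bullet> w = g \<bullet> w" using eq qf_eq_iff[OF f g] by blast
    note w' = den_arr[OF w(1)]
    have nw: "?n \<bullet> w = nul W Y" using diff_cmp[OF w' f g] w(2) diff_self[OF arr_cmp[OF w' g]] by simp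
    \<comment> \<open>The denominator \<open>w\<close> kills f - g. Were f - g invertible,
      \<open>w\<close> would be zero, and X would vanish in the quotient and thus lie in Tp.\<close>
    have "\<not> iso X Y ?n"
    proof
      assume "iso X Y ?n"
      then obtain m where m: "arr Y X m" "m \<bullet> ?n = Idm T X" by (metis isoE)
      have "w = m \<bullet> ?n \<bullet> w" using assoc[OF w' n m(1)] m(2) idm_left[OF w'] by simp
      then have "w = nul W X" using nw cmp_nul[OF m(1) arr_dom[OF w']] by simp
      then have "Idm T X \<bullet> w = nul X X \<bullet> w" using idm_left[OF w'] nul_cmp[OF w' ob(1)] by simp
      then have "qf X X (Idm T X) = qf X X (nul X X)"
        using qf_eq_iff[OF arr_idm[OF ob(1)] arr_nul[OF ob(1) ob(1)]] w(1) by blast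
      then have "is_zero Q X" using ob by (simp add: is_zero_def qf_zero)
      then show False using quotient_is_zero X(2) by blast
    qed
    then have "?n = nul X Y"
      using S_zero_or_iso[OF X(1) Y, of 0 0 ?n] n by (simp add: shift_0)
    then show "f = g" by (rule diff_eq_nul[OF f g])
  qed
  then show "bij_betw (qf X Y) (carrier (Hom T X Y)) (carrier (quot_hom T Tp X Y))"
    using fundamental_domain_full[OF F] by (simp add: bij_betw_def)
qed

lemma quotient_hom_zero:
  assumes "X \<in> S" "Y \<in> S" "1 \<le> i" "i \<le> int d"
  shows "hom_zero Q (shift T i X) Y"
proof -
  have F: "shift T i X \<in> fundamental_domain T Tp S" "Y \<in> fundamental_domain T Tp S"
    using shift_S_fundamental_domain[of X i] shift_S_fundamental_domain[of Y 0] assms by (auto simp: shift_0)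
  have "hom_zero T (shift T i X) Y" using S_hom_zero[of X Y 0 i] assms by (simp add: shift_0)
  then have "carrier (Hom T (shift T i X) Y) = {nul (shift T i X) Y}" by (simp add: hom_zero_def)
  then show ?thesis using fundamental_domain_full[OF F] by (simp add: hom_zero_def qf_zero)
qed

text \<open>X -> Y removes a part in \<open>T_pos\<close>, and Z -> Y has a cone in the shift-closed
  Tp, so both maps are denominators. They point to the common target Y, and the result is left as
  this zigzag; closure under isomorphism is later applied along each leg.\<close>

lemma quotient_dense:
  assumes X: "X \<in> Ob T"
  obtains Z Y e e' where "Z \<in> fundamental_domain T Tp S" "Y \<in> Ob T" "is_iso Q Z Y e" "is_iso Q X Y e'"
proof -
  have "X \<in> star T (T_pos T S) (left_perp T (shifts T S {..<0}))" using X torsion1(2) by simp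
  then obtain A Y f g h where t: "(A, X, Y, f, g, h) \<in> Tri T" "A \<in> T_pos T S"
    "Y \<in> left_perp T (shifts T S {..<0})" by (rule starE)
  note o = tri_ob[OF t(1)]
  have "den X Y g" using denI[OF rot[OF t(1)]] P_sh[OF o(1)] T_pos_Tp[OF t(2)] by blast
  then have g: "is_iso Q X Y (qf X Y g)" by (rule quotient_iso_if_den)
  \<comment> \<open>Shifting by d + 1 carries right orthogonality to S[\<ge>0] into right
    orthogonality to S[>d].\<close>
  let ?n = "int d + 1"
  have "shift T (- ?n) Y \<in> star T (right_perp T (shifts T S {0..})) inj_dom"
    using torsion2(2) shift_ob[OF o(3)] by simp
  then obtain B J a b c where t0: "(B, shift T (- ?n) Y, J, a, b, c) \<in> Tri T"
    "B \<in> right_perp T (shifts T S {0..})" "J \<in> inj_dom" by (rule starE)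
  note o0 = tri_ob[OF t0(1)]
  let ?Z = "shift T ?n B"
  have Y: "shift T ?n (shift T (- ?n) Y) = Y" using shift_shift[OF o(3), of ?n "- ?n"] by (simp add: shift_0)
  obtain a b c where t1: "(?Z, Y, shift T ?n J, a, b, c) \<in> Tri T"
    using tri_shift[OF t0(1), of ?n] unfolding Y by blast
  note o1 = tri_ob[OF t1]
  have J: "J \<in> Tp" using t0(3) RS2(5) by blast
  then have dJ: "shift T (int d) J \<in> Tp" using P_shift[OF o0(3)] by blast
  have "den ?Z Y a" using denI[OF t1] P_shift[OF o0(3)] J by blast
  then have a: "is_iso Q ?Z Y (qf ?Z Y a)" by (rule quotient_iso_if_den)
  have "hom_zero T (shift T i V) ?Z" if "int d < i" "V \<in> S" for i V
    using t0(2) hom_zero_shift_right[OF S_ob[OF that(2)] o0(1), of i ?n] that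
    by (simp add: mem_right_perp_shifts)
  then have Z1: "?Z \<in> right_perp T (shifts T S {int d<..})" using o1(1) by (simp add: mem_right_perp_shifts)
  obtain J' j where J': "Sh T J' = shift T ?n J" "(J', ?Z, Y, j, a, b) \<in> Tri T" using rot_back[OF t1] by metis
  have "J' = shift T (int d) J"
    using sh_inj[OF tri_ob(1)[OF J'(2)] shift_ob[OF o0(3)]] J'(1) shift_Suc[OF o0(3), of "int d"] by simp
  then have t2: "(shift T (int d) J, ?Z, Y, j, a, b) \<in> Tri T" using J'(2) by simp
  \<comment> \<open>The second truncation preserves the left orthogonality gained by the first:
    \<open>Z\<close> is an extension of \<open>Y\<close> by J[d], and Hom(J[d], V[i]) is dual to
    Hom(V[i], J), which vanishes for i < 0.\<close>
  have "hom_zero T ?Z (shift T i V)" if i: "i < 0" and V: "V \<in> S" for i V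
  proof (rule hom_zero_ext_left[OF t2])
    note Vo = shift_ob[OF S_ob[OF V], of i]
    have "hom_zero T (shift T i V) J" using t0(3) i V by (simp add: mem_right_perp_shifts)
    moreover have "shift T (- int d) (shift T (int d) J) = J"
      using shift_shift[OF o0(3), of "- int d" "int d"] by (simp add: shift_0)
    ultimately show "hom_zero T (shift T (int d) J) (shift T i V)"
      using serre_hom_zero[OF dJ Vo] by simp
    show "hom_zero T Y (shift T i V)" using t(3) i V by (simp add: mem_left_perp_shifts)
    show "shift T i V \<in> Ob T" by (rule Vo)
  qed
  then have "?Z \<in> left_perp T (shifts T S {..<0})" using o1(1) by (simp add: mem_left_perp_shifts)
  then have Z: "?Z \<in> fundamental_domain T Tp S" using Z1 by (simp add: fundamental_domain_eq)
  show ?thesis by (rule that[OF Z o(3) a g])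
qed

text \<open>Triangles and isomorphisms of T persist in the quotient. Filtrations found in T can
  therefore be used to place objects in an extension-closed class of the quotient.\<close>

lemma quotient_extension_closed:
  assumes E: "extension_closed Q E" shows "extension_closed T E"
  unfolding extension_closed_def
proof (intro conjI)
  show ob: "E \<subseteq> Ob T" using E by (simp add: extension_closed_def)
  show "zeros \<subseteq> E" using E P_zero quotient_is_zero by (auto simp: extension_closed_def)
  show "iso_closed T E"
  proof (rule iso_closedI[OF _ ob])
    fix X Y f assume X: "X \<in> E" and f: "iso X Y f"
    have "is_iso Q X Y (qf X Y f)" using quotient_iso_if_den[OF den_iso[OF f]] .
    then show "Y \<in> E"
      using E X arr_cod[OF iso_arr[OF f]] unfolding extension_closed_def iso_closed_def quotient_simps by blast
  qed
  have "star T E E \<subseteq> star Q E E" unfolding star_def using quotient_tri by blast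
  then show "star T E E \<subseteq> E" using E unfolding extension_closed_def by blast
qed

text \<open>The hypotheses determine S' as the part of S outside Tp, so both assertions about the
  quotient are instances. For generation, every object is isomorphic in the quotient to one filtered
  in T by the shifts V[0], ..., V[d] with V in S.\<close>

lemma quotient_simple_minded_system:
  assumes S': "S' \<subseteq> S" "S' \<inter> Tp = {}" "S \<subseteq> S' \<union> Tp"
  shows "simple_minded_system K Q d S'"
  unfolding simple_minded_system_def
proof (intro conjI ballI impI)
  show "S' \<subseteq> Ob Q" using S' S_ob by auto
  show "has_dim K (Hom Q X Y) (if X = Y then 1 else 0)" if "X \<in> S'" "Y \<in> S'" for X Y
    unfolding quotient_simps using that S' by (intro quotient_has_dim) blast+
  show "hom_zero Q (shift Q i X) Y" if "X \<in> S'" "Y \<in> S'" "i \<in> {1..int d}" for X Y i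
    using quotient_hom_zero that S' quotient_shift by auto
  let ?U = "shifts Q S' {0..int d}"
  have U: "?U = shifts T S' {0..int d}" by (simp add: shifts_def quotient_shift)
  show "Ob Q = add_closure Q (Filt Q ?U)"
  proof (intro equalityI subsetI)
    fix X assume "X \<in> Ob Q"
    then have X: "X \<in> Ob T" by simp
    show "X \<in> add_closure Q (Filt Q ?U)"
      unfolding add_closure_def
    proof (intro InterI, elim CollectE conjE)
      fix R assume R: "iso_closed Q R" "Filt Q ?U \<subseteq> R"
      obtain Z Y e e' where Z: "Z \<in> fundamental_domain T Tp S" "Y \<in> Ob T" "is_iso Q Z Y e" "is_iso Q X Y e'"
        using X by (rule quotient_dense)
      obtain w where w: "Z \<in> fil w" "word w" "fst ` set w \<subseteq> {0..int d}"
        using words_in_range[of Z d] Z(1) unfolding fundamental_domain_eq by (metis IntE)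
      have "Z \<in> Filt Q ?U"
        unfolding Filt_def
      proof (intro InterI, elim CollectE conjE)
        fix E assume E: "extension_closed Q E" "?U \<subseteq> E"
        show "Z \<in> E"
        proof (rule fil_mem[OF w(1) quotient_extension_closed[OF E(1)]])
          fix j V assume jV: "(j, V) \<in> set w"
          have V: "V \<in> S" "j \<in> {0..int d}"
            using w(2,3) imageI[OF jV, of snd] imageI[OF jV, of fst] unfolding word_def by auto
          \<comment> \<open>Letters from Tp become zero objects of the quotient, which every
            extension-closed class contains; so deleting them from S does no harm.\<close>
          show "shift T j V \<in> E"
          proof (cases "V \<in> S'")
            case True
            then have "shift T j V \<in> shifts T S' {0..int d}" using V(2) unfolding shifts_def by blast
            then show ?thesis using E(2) unfolding U by blast
          next
            case False
            then have "V \<in> Tp" using V(1) S'(3) by blast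
            then have "is_zero Q (shift T j V)" using quotient_is_zero P_shift[OF S_ob[OF V(1)]] by simp
            then show ?thesis using E(1) unfolding extension_closed_def by blast
          qed
        qed
      qed
      then have "Y \<in> R" using R Z(2,3) unfolding iso_closed_def quotient_simps by blast
      moreover have "\<exists>g. is_iso Q Y X g" using Z(4) unfolding is_iso_def by blast
      ultimately show "X \<in> R" using R(1) X unfolding iso_closed_def quotient_simps by blast
    qed
  next
    fix X assume X: "X \<in> add_closure Q (Filt Q ?U)"
    have "extension_closed Q (Ob Q)"
      unfolding extension_closed_def
    proof (intro conjI)
      show "{Z. is_zero Q Z} \<subseteq> Ob Q" by (simp add: is_zero_def subset_eq)
      show "iso_closed Q (Ob Q)" by (simp add: iso_closed_def)
      have "E \<in> Ob Q" if "(X, E, Y, f, g, h) \<in> Tri Q" for X E Y f g h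
        using that by (simp add: verdier_quotient_def quot_cat_def candidates_def)
      then show "star Q (Ob Q) (Ob Q) \<subseteq> Ob Q" unfolding star_def by blast
    qed simp
    moreover have "?U \<subseteq> Ob Q" using shifts_ob[of S'] S'(1) S_ob unfolding U quotient_simps by blast
    ultimately have "Filt Q ?U \<subseteq> Ob Q" unfolding Filt_def by blast
    moreover have "iso_closed Q (Ob Q)" "dsum_closed Q (Ob Q)" "summand_closed Q (Ob Q)"
      by (auto simp: iso_closed_def dsum_closed_def summand_closed_def is_dsum_def)
    ultimately show "X \<in> Ob Q" using X unfolding add_closure_def by blast
  qed
qed

text \<open>For X in S and in Tp duality makes End(X) vanish together with Hom(X, X[-d]), which is
  zero as soon as -d is negative.\<close>

lemma S_disjoint_Tp: assumes "1 \<le> d" shows "S \<inter> Tp = {}"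
proof -
  have "X \<notin> Tp" if X: "X \<in> S" for X
  proof
    assume "X \<in> Tp"
    moreover have "hom_zero T X (shift T (- int d) X)"
      using S_hom_zero[OF X X, of "- int d" 0] assms by (simp add: shift_0)
    ultimately have "is_zero T X" using serre_hom_zero S_ob[OF X] is_zero_if_hom_zero by blast
    then show False using S_not_zero[OF X, of 0] by (simp add: shift_0)
  qed
  then show ?thesis by blast
qed

end

theorem proposition1p3:
  fixes K :: "('k, 'r) ring_scheme"
    and T :: "('k, 'o, 'm) tricat"
    and Tp S :: "'o set"
    and d :: nat
  assumes "CY_triple K T Tp S d"
  shows "fundamental_domain T Tp S = star_chain T (Filt T S) d \<and>
    (d \<ge> 1 \<or> S \<inter> Tp = {} \<longrightarrow> simple_minded_system K (verdier_quotient T Tp) d S) \<and>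
    simple_minded_system K (verdier_quotient T Tp) d
      {X \<in> S. \<not> is_zero (verdier_quotient T Tp) X}"
proof -
  interpret CY_triple K T Tp S d by fact
  show ?thesis
  proof (intro conjI impI)
    show "fundamental_domain T Tp S = star_chain T (Filt T S) d" by (rule fundamental_domain_star_chain)
    assume "d \<ge> 1 \<or> S \<inter> Tp = {}"
    then have "S \<inter> Tp = {}" using S_disjoint_Tp by blast
    then show "simple_minded_system K Q d S" by (intro quotient_simple_minded_system) auto
  next
    show "simple_minded_system K Q d {X \<in> S. \<not> is_zero Q X}"
      by (intro quotient_simple_minded_system) (auto simp: quotient_is_zero)
  qed
qed

end
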